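(* (Duality) As meromorphic functions on $\mathcal{O}=\{(w_1,w_2,\rho,\sigma,\tau,\upsilon,x,\lambda)\in\mathbb{C}_+^2\times\mathbb{C}^6\}$ one has $$S(\gamma;x,\lambda)=S(\hat\gamma;\lambda,x).$$
   Context: Convention: $\pm$ inside the argument of a function means a product over both signs, e.g. $f(z\pm a)=f(z+a)f(z-a)$; square roots are the principal branch. $\mathbb{C}_+=\{z\in\mathbb{C}:\Re(z)>0\}$; for $w_1,w_2\in\mathbb{C}_+$ set $w=(w_1+w_2)/2$. Hyperbolic gamma function: for $|\Im(z)|<\Re(w)$, $G(z)=G(w_1,w_2;z)=\exp\Big(i\int_0^\infty\Big(\frac{\sin(2yz)}{2\sinh(w_1y)\sinh(w_2y)}-\frac{z}{w_1w_2y}\Big)\frac{dy}{y}\Big)$, continued meromorphically to $z\in\mathbb{C}$ by $G(z+iw_1/2)=2\cosh(\pi z/w_2)G(z-iw_1/2)$ and $G(z+iw_2/2)=2\cosh(\pi z/w_1)G(z-iw_2/2)$. Parameters: $\gamma=(\gamma_0,\gamma_1,\gamma_2,\gamma_3)\in\mathbb{C}^4$ corresponds to $(\rho,\sigma,\tau,\upsilon)\in\mathbb{C}^4$ via $\gamma_0=-\rho+\sigma$, $\gamma_1=\rho+\sigma$, $\gamma_2=-\tau-\upsilon$, $\gamma_3=\tau-\upsilon$. Dual parameters $\hat\gamma$: $\hat\gamma_0=\frac12(\gamma_0+\gamma_1+\gamma_2+\gamma_3)$, $\hat\gamma_1=\frac12(\gamma_0+\gamma_1-\gamma_2-\gamma_3)$,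 $\hat\gamma_2=\frac12(\gamma_0-\gamma_1+\gamma_2-\gamma_3)$, $\hat\gamma_3=\frac12(\gamma_0-\gamma_1-\gamma_2+\gamma_3)$ (equivalently, $\gamma\mapsto\hat\gamma$ interchanges $\rho$ and $\upsilon$). The function $S$: let $\xi=\max(|\Re\rho|,|\Re\sigma|,|\Re\tau|,|\Re\upsilon|)$ and $\zeta=w/2-\xi-|\Im(\lambda/2)|$. For $w_1,w_2>0$, $\zeta>0$, $|\Im x|<\zeta$ put $$\psi(\gamma;x,\lambda)=\int_{\mathbb{R}}\frac{G(z+x+\lambda/2-iw/2\pm i\tau)\,G(z-\lambda/2-iw/2\pm i\sigma)}{G(z+x-\lambda/2+iw/2\pm i\rho)\,G(z+\lambda/2+iw/2\pm i\upsilon)}\,dz ;$$ $\psi$ extends to a meromorphic function on $\mathcal{O}$. With $\Delta(\gamma;x)=\frac{G(x+i\gamma_2)G(x+i\gamma_3)}{G(x-i\gamma_0)G(x-i\gamma_1)}$ and $N(\gamma)=\prod_{j=1}^3G(i\gamma_0+i\gamma_j+iw)$, define $$S(\gamma;x,\lambda)=\frac{N(\gamma)\,\psi(\gamma;x,\lambda)}{\sqrt{w_1w_2}\,\Delta(\gamma;x)\,\Delta(\hat\gamma;\lambda)}.$$ *)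

theory Defs
  imports "HOL-Analysis.Analysis"
begin

section \<open>Meromorphic functions of several complex variables\<close>

definition holomorphic_mv_on :: "(complex^'n \<Rightarrow> complex) \<Rightarrow> (complex^'n) set \<Rightarrow> bool"
    (infixl \<open>(holomorphic'_mv'_on)\<close> 50) where
  "f holomorphic_mv_on U \<longleftrightarrow>
     (\<forall>p\<in>U. \<exists>f'. (f has_derivative f') (at p) \<and> (\<forall>c v. f' (c *s v) = c * f' v))"

text \<open>A meromorphic function is represented by a total function that is locally a quotient
  \<open>g / h\<close> of holomorphic functions with \<open>h\<close> not identically zero. Its values on the thin sets
  \<open>h = 0\<close> are irrelevant; correspondingly, two representatives define the same meromorphic function
  iff locally they agree off the zero set of some holomorphic \<open>h\<close> that is not identically zero.\<close>

definition meromorphic_mv_on :: "(complex^'n \<Rightarrow> complex) \<Rightarrow> (complex^'n) set \<Rightarrow> bool"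
    (infixl \<open>(meromorphic'_mv'_on)\<close> 50) where
  "f meromorphic_mv_on U \<longleftrightarrow>
     (\<forall>p\<in>U. \<exists>V g h. open V \<and> connected V \<and> p \<in> V \<and> V \<subseteq> U \<and>
        g holomorphic_mv_on V \<and> h holomorphic_mv_on V \<and> (\<exists>q\<in>V. h q \<noteq> 0) \<and>
        (\<forall>q\<in>V. h q \<noteq> 0 \<longrightarrow> f q = g q / h q))"

definition equal_as_meromorphic_on ::
    "(complex^'n) set \<Rightarrow> (complex^'n \<Rightarrow> complex) \<Rightarrow> (complex^'n \<Rightarrow> complex) \<Rightarrow> bool" where
  "equal_as_meromorphic_on U f1 f2 \<longleftrightarrow>
     f1 meromorphic_mv_on U \<and> f2 meromorphic_mv_on U \<and>
     (\<forall>p\<in>U. \<exists>V h. open V \<and> connected V \<and> p \<in> V \<and> V \<subseteq> U \<and>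
        h holomorphic_mv_on V \<and> (\<exists>q\<in>V. h q \<noteq> 0) \<and>
        (\<forall>q\<in>V. h q \<noteq> 0 \<longrightarrow> f1 q = f2 q))"


section \<open>The hyperbolic gamma function\<close>

definition hyp_gamma_strip :: "complex \<Rightarrow> complex \<Rightarrow> complex \<Rightarrow> complex" where
  "hyp_gamma_strip w1 w2 z =
     exp (\<i> * set_lebesgue_integral lborel {0<..} (\<lambda>y::real.
       (sin (2 * of_real y * z) / (2 * sinh (w1 * of_real y) * sinh (w2 * of_real y))
          - z / (w1 * w2 * of_real y)) / of_real y))"

text \<open>The meromorphic continuation in \<open>z\<close> is carried out by iterating
  \<open>G(z + i w1/2) = 2 cosh(\<pi> z / w2) G(z - i w1/2)\<close> as often as is needed to reach the strip
  \<open>|Im z| < Re w\<close>, on which the integral represents \<open>G\<close>. The integral is symmetric in \<open>w1, w2\<close>, and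
  the continuation also satisfies the equation with \<open>w1\<close> and \<open>w2\<close> interchanged. Because the number of
  steps is minimal, the denominator below vanishes only at the poles of \<open>G\<close>, where the value is 0.\<close>

definition hyp_gamma :: "complex \<Rightarrow> complex \<Rightarrow> complex \<Rightarrow> complex" where
  "hyp_gamma w1 w2 z =
     (let w = (w1 + w2) / 2 in
      if Im z \<ge> 0 then
        let n = (LEAST n. Im z - real n * Re w1 < Re w) in
          (\<Prod>k<n. 2 * cosh (of_real pi * (z - \<i> * (of_nat k + 1/2) * w1) / w2))
            * hyp_gamma_strip w1 w2 (z - \<i> * of_nat n * w1)
      else
        let n = (LEAST n. - Re w < Im z + real n * Re w1) in
          hyp_gamma_strip w1 w2 (z + \<i> * of_nat n * w1)
            / (\<Prod>k<n. 2 * cosh (of_real pi * (z + \<i> * (of_nat k + 1/2) * w1) / w2)))"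


section \<open>Parameters and domains\<close>

datatype var = W1 | W2 | Rho | Sigma | Tau | Upsilon | X | Lambda

lemma UNIV_var: "UNIV = {W1, W2, Rho, Sigma, Tau, Upsilon, X, Lambda}"
  using var.exhaust by blast

instance var :: finite
  by standard (simp add: UNIV_var)

definition point :: "complex \<Rightarrow> complex \<Rightarrow> complex \<Rightarrow> complex \<Rightarrow> complex \<Rightarrow> complex \<Rightarrow> complex \<Rightarrow> complex
    \<Rightarrow> complex^var" where
  "point w1 w2 \<rho> \<sigma> \<tau> \<upsilon> x l =
     (\<chi> v. case v of W1 \<Rightarrow> w1 | W2 \<Rightarrow> w2 | Rho \<Rightarrow> \<rho> | Sigma \<Rightarrow> \<sigma> | Tau \<Rightarrow> \<tau> | Upsilon \<Rightarrow> \<upsilon>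
              | X \<Rightarrow> x | Lambda \<Rightarrow> l)"

definition dom_O :: "(complex^var) set" where
  "dom_O = {p. Re (p $ W1) > 0 \<and> Re (p $ W2) > 0}"

type_synonym params = "complex \<times> complex \<times> complex \<times> complex"

definition gamma_of :: "complex^var \<Rightarrow> params" where
  "gamma_of p = (- p $ Rho + p $ Sigma, p $ Rho + p $ Sigma,
                 - p $ Tau - p $ Upsilon, p $ Tau - p $ Upsilon)"

fun dual :: "params \<Rightarrow> params" where
  "dual (g0, g1, g2, g3) =
     ((g0 + g1 + g2 + g3) / 2, (g0 + g1 - g2 - g3) / 2,
      (g0 - g1 + g2 - g3) / 2, (g0 - g1 - g2 + g3) / 2)"


section \<open>The functions \<open>\<psi>\<close> and \<open>S\<close>\<close>

definition psi_integral :: "complex^var \<Rightarrow> complex" where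
  "psi_integral p =
     (let w1 = p $ W1; w2 = p $ W2; w = (w1 + w2) / 2; x = p $ X; l = p $ Lambda;
          \<rho> = p $ Rho; \<sigma> = p $ Sigma; \<tau> = p $ Tau; \<upsilon> = p $ Upsilon;
          G = hyp_gamma w1 w2;
          Gpm = (\<lambda>u a. G (u + a) * G (u - a))
      in lebesgue_integral lborel (\<lambda>z::real.
           (Gpm (of_real z + x + l/2 - \<i> * w/2) (\<i> * \<tau>) * Gpm (of_real z - l/2 - \<i> * w/2) (\<i> * \<sigma>))
         / (Gpm (of_real z + x - l/2 + \<i> * w/2) (\<i> * \<rho>) * Gpm (of_real z + l/2 + \<i> * w/2) (\<i> * \<upsilon>))))"

definition xi :: "complex^var \<Rightarrow> real" where
  "xi p = Max {\<bar>Re (p $ Rho)\<bar>, \<bar>Re (p $ Sigma)\<bar>, \<bar>Re (p $ Tau)\<bar>, \<bar>Re (p $ Upsilon)\<bar>}"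

definition zeta :: "complex^var \<Rightarrow> real" where
  "zeta p = Re ((p $ W1 + p $ W2) / 2) / 2 - xi p - \<bar>Im (p $ Lambda / 2)\<bar>"

definition dom_integral :: "(complex^var) set" where
  "dom_integral =
     {p. p $ W1 \<in> \<real> \<and> Re (p $ W1) > 0 \<and> p $ W2 \<in> \<real> \<and> Re (p $ W2) > 0 \<and>
         zeta p > 0 \<and> \<bar>Im (p $ X)\<bar> < zeta p}"

definition is_psi_extension :: "(complex^var \<Rightarrow> complex) \<Rightarrow> bool" where
  "is_psi_extension F \<longleftrightarrow>
     F meromorphic_mv_on dom_O \<and> (\<forall>p\<in>dom_integral. F p = psi_integral p)"

text \<open>\<open>psi_ext\<close> is the meromorphic extension of \<open>\<psi>\<close> to \<open>dom_O\<close>. It exists, and as a meromorphic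
  function it is unique, since \<open>dom_integral\<close> (an open condition on the last six variables over
  real positive \<open>w1, w2\<close>) is a set of uniqueness in the connected set \<open>dom_O\<close>. As \<open>psi_ext\<close> has to
  be total before this is known, it is set to 0 in the (non-occurring) case of no extension.\<close>

definition psi_ext :: "complex^var \<Rightarrow> complex" where
  "psi_ext = (if \<exists>F. is_psi_extension F then SOME F. is_psi_extension F else (\<lambda>p. 0))"

text \<open>Here \<open>(\<rho>, \<sigma>, \<tau>, \<upsilon>)\<close> is recovered from \<open>\<gamma>\<close> by inverting \<open>gamma_of\<close>.\<close>

fun psi :: "complex \<Rightarrow> complex \<Rightarrow> params \<Rightarrow> complex \<Rightarrow> complex \<Rightarrow> complex" where
  "psi w1 w2 (g0, g1, g2, g3) x l =
     psi_ext (point w1 w2 ((g1 - g0) / 2) ((g0 + g1) / 2) ((g3 - g2) / 2) (- (g2 + g3) / 2) x l)"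

fun Delta :: "complex \<Rightarrow> complex \<Rightarrow> params \<Rightarrow> complex \<Rightarrow> complex" where
  "Delta w1 w2 (g0, g1, g2, g3) x =
     (hyp_gamma w1 w2 (x + \<i> * g2) * hyp_gamma w1 w2 (x + \<i> * g3))
     / (hyp_gamma w1 w2 (x - \<i> * g0) * hyp_gamma w1 w2 (x - \<i> * g1))"

fun N_norm :: "complex \<Rightarrow> complex \<Rightarrow> params \<Rightarrow> complex" where
  "N_norm w1 w2 (g0, g1, g2, g3) =
     (\<Prod>g\<leftarrow>[g1, g2, g3]. hyp_gamma w1 w2 (\<i> * g0 + \<i> * g + \<i> * ((w1 + w2) / 2)))"

definition S_fun :: "complex \<Rightarrow> complex \<Rightarrow> params \<Rightarrow> complex \<Rightarrow> complex \<Rightarrow> complex" where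
  "S_fun w1 w2 \<gamma> x l =
     N_norm w1 w2 \<gamma> * psi w1 w2 \<gamma> x l
     / (csqrt (w1 * w2) * Delta w1 w2 \<gamma> x * Delta w1 w2 (dual \<gamma>) l)"

end

theory Submission
  imports Defs "HOL-Complex_Analysis.Conformal_Mappings"
begin

text \<open>Writing \<open>p'\<close> for \<open>p\<close> with \<open>\<rho>, \<upsilon>\<close> and \<open>x, \<lambda>\<close> interchanged, the dual parameters of \<open>p\<close> are the
  parameters of \<open>p'\<close>. The normalisation \<open>N\<close> and the product of the two \<open>\<Delta>\<close>-factors are invariant under
  \<open>p \<mapsto> p'\<close>, so the claim is \<open>\<psi>(p) = \<psi>(p')\<close>. Near the real point \<open>w\<^sub>1 = w\<^sub>2 = 1\<close>,
  \<open>\<rho> = \<sigma> = \<tau> = \<upsilon> = x = \<lambda> = 0\<close> both sides are given by the integral on all real points, and there the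
  translation of \<open>z\<close> by \<open>(x - \<lambda>) / 2\<close> maps one integrand to the other. Real points form a set of
  uniqueness, and the identity theorem spreads the equality over the connected domain.

  That the two sides are meromorphic rests on the joint meromorphy of the hyperbolic gamma function
  in \<open>(w\<^sub>1, w\<^sub>2, z)\<close>. Its definition counts the steps into the strip, so this requires the functional
  equation inside the strip, that is,
  \<open>exp (- \<integral> (cos (2 y u) / sinh (w y) - 1 / (w y)) dy / y) = 2 cosh (\<pi> u / w)\<close>. The logarithmic derivatives
  of the two sides agree by the partial fractions of the hyperbolic tangent, and the constant of
  integration follows from the duplication \<open>u = 0\<close> versus \<open>u = \<i> w / 4\<close>.\<close>

section \<open>Holomorphic functions of several variables\<close>

text \<open>In \<open>dom_integral\<close> the coordinates \<open>w1\<close> and \<open>w2\<close>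
  are real, so this set has no interior and agreement there is not agreement on an open set; hence
  the passage through real points. With x and \<lambda> real as well, the shift (x - \<lambda>) / 2
  is real, and the change of variable is a translation of Lebesgue measure instead of a movement of
  the contour. The prefactor of the integral divides by values of \<open>hyp_gamma\<close>.
  Meromorphy therefore has to be carried together with the fact that the function is nowhere locally
  the zero function, which is the content of \<open>nonzero_meromorphic_mv_on\<close>. For
  \<open>hyp_gamma\<close> this comes from a direction in parameter space that moves the argument
  and leaves \<open>w1\<close>, \<open>w2\<close> fixed. The step count in \<open>hyp_gamma\<close>
  jumps as the argument moves, while a local representation needs one formula on an open set. The
  functional equation allows the minimal count to be replaced by a count that is constant near a
  given point.\<close>

definition has_complex_derivative_at ::
    "(complex^'n \<Rightarrow> complex) \<Rightarrow> (complex^'n \<Rightarrow> complex) \<Rightarrow> complex^'n \<Rightarrow> bool" where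
  "has_complex_derivative_at f f' p \<longleftrightarrow>
     (f has_derivative f') (at p) \<and> (\<forall>c v. f' (c *s v) = c * f' v)"

lemma holomorphic_mv_onI:
  assumes "\<And>p. p \<in> U \<Longrightarrow> has_complex_derivative_at f (f' p) p"
  shows "f holomorphic_mv_on U"
  using assms unfolding holomorphic_mv_on_def has_complex_derivative_at_def by blast

lemma holomorphic_mv_onE:
  assumes "f holomorphic_mv_on U"
  obtains f' where "\<And>p. p \<in> U \<Longrightarrow> has_complex_derivative_at f (f' p) p"
  using assms unfolding holomorphic_mv_on_def has_complex_derivative_at_def by metis

lemma has_complex_derivative_at_compose:
  assumes "has_complex_derivative_at f f' p" "(g has_field_derivative d) (at (f p))"
  shows "has_complex_derivative_at (\<lambda>q. g (f q)) (\<lambda>v. d * f' v) p"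
  using assms diff_chain_at[of f f' p g "(*) d"]
  by (auto simp: has_complex_derivative_at_def has_field_derivative_def o_def)

lemma holomorphic_mv_on_const: "(\<lambda>p. c) holomorphic_mv_on U"
  by (rule holomorphic_mv_onI[where f' = "\<lambda>p v. 0"])
     (auto simp: has_complex_derivative_at_def)

lemma holomorphic_mv_on_nth: "(\<lambda>p. p $ v) holomorphic_mv_on U"
  by (rule holomorphic_mv_onI[where f' = "\<lambda>p u. u $ v"])
     (auto simp: has_complex_derivative_at_def
       intro!: bounded_linear_imp_has_derivative bounded_linear_vec_nth)

lemma holomorphic_mv_on_subset:
  "f holomorphic_mv_on U \<Longrightarrow> V \<subseteq> U \<Longrightarrow> f holomorphic_mv_on V"
  unfolding holomorphic_mv_on_def by blast

lemma holomorphic_mv_on_compose: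
  assumes "f holomorphic_mv_on U" "g holomorphic_on S" "open S" "\<And>p. p \<in> U \<Longrightarrow> f p \<in> S"
  shows "(\<lambda>p. g (f p)) holomorphic_mv_on U"
proof -
  obtain f' where f': "\<And>p. p \<in> U \<Longrightarrow> has_complex_derivative_at f (f' p) p"
    using assms(1) by (metis holomorphic_mv_onE)
  have "has_complex_derivative_at (\<lambda>q. g (f q)) (\<lambda>v. deriv g (f p) * f' p v) p" if "p \<in> U" for p
    using has_complex_derivative_at_compose[OF f'[OF that]] assms(2-4) that
    by (simp add: holomorphic_derivI)
  then show ?thesis by (rule holomorphic_mv_onI)
qed

lemma holomorphic_mv_on_add:
  assumes "f holomorphic_mv_on U" "g holomorphic_mv_on U"
  shows "(\<lambda>p. f p + g p) holomorphic_mv_on U"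
proof -
  obtain f' g' where d: "\<And>p. p \<in> U \<Longrightarrow> has_complex_derivative_at f (f' p) p"
    "\<And>p. p \<in> U \<Longrightarrow> has_complex_derivative_at g (g' p) p"
    using assms by (metis holomorphic_mv_onE)
  show ?thesis
    by (rule holomorphic_mv_onI[where f' = "\<lambda>p v. f' p v + g' p v"])
       (use d in \<open>auto simp: has_complex_derivative_at_def algebra_simps intro!: has_derivative_add\<close>)
qed

lemma holomorphic_mv_on_mult:
  assumes "f holomorphic_mv_on U" "g holomorphic_mv_on U"
  shows "(\<lambda>p. f p * g p) holomorphic_mv_on U"
proof -
  obtain f' g' where d: "\<And>p. p \<in> U \<Longrightarrow> has_complex_derivative_at f (f' p) p"
    "\<And>p. p \<in> U \<Longrightarrow> has_complex_derivative_at g (g' p) p"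
    using assms by (metis holomorphic_mv_onE)
  show ?thesis
  proof (rule holomorphic_mv_onI[where f' = "\<lambda>p v. f p * g' p v + f' p v * g p"])
    fix p assume "p \<in> U"
    from d(1)[OF this] d(2)[OF this]
    show "has_complex_derivative_at (\<lambda>p. f p * g p) (\<lambda>v. f p * g' p v + f' p v * g p) p"
      by (auto simp: has_complex_derivative_at_def algebra_simps dest: has_derivative_mult)
  qed
qed

lemma holomorphic_mv_on_uminus:
  "f holomorphic_mv_on U \<Longrightarrow> (\<lambda>p. - f p) holomorphic_mv_on U"
  using holomorphic_mv_on_mult[OF holomorphic_mv_on_const[of "-1"]] by simp

lemma holomorphic_mv_on_diff:
  "f holomorphic_mv_on U \<Longrightarrow> g holomorphic_mv_on U \<Longrightarrow> (\<lambda>p. f p - g p) holomorphic_mv_on U"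
  using holomorphic_mv_on_add[OF _ holomorphic_mv_on_uminus] by fastforce

lemma holomorphic_mv_on_divide:
  assumes "f holomorphic_mv_on U" "g holomorphic_mv_on U" "\<And>p. p \<in> U \<Longrightarrow> g p \<noteq> 0"
  shows "(\<lambda>p. f p / g p) holomorphic_mv_on U"
proof -
  have "(\<lambda>p. inverse (g p)) holomorphic_mv_on U"
    by (rule holomorphic_mv_on_compose[OF assms(2), of inverse "- {0}"])
       (auto intro!: holomorphic_intros assms(3))
  then show ?thesis
    using holomorphic_mv_on_mult[OF assms(1)] by (simp add: divide_inverse)
qed

lemma holomorphic_mv_on_prod:
  "(\<And>i. i \<in> I \<Longrightarrow> f i holomorphic_mv_on U) \<Longrightarrow> (\<lambda>p. \<Prod>i\<in>I. f i p) holomorphic_mv_on U"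
  by (induction I rule: infinite_finite_induct)
     (auto intro: holomorphic_mv_on_const holomorphic_mv_on_mult)

lemma holomorphic_mv_on_entire:
  assumes "f holomorphic_mv_on U" "g holomorphic_on UNIV"
  shows "(\<lambda>p. g (f p)) holomorphic_mv_on U"
  using holomorphic_mv_on_compose[OF assms] by simp

lemmas holomorphic_mv_intros =
  holomorphic_mv_on_const holomorphic_mv_on_nth holomorphic_mv_on_add holomorphic_mv_on_mult
  holomorphic_mv_on_uminus holomorphic_mv_on_diff holomorphic_mv_on_divide holomorphic_mv_on_prod

lemma holomorphic_mv_on_imp_continuous_on:
  "f holomorphic_mv_on U \<Longrightarrow> continuous_on U f"
  unfolding holomorphic_mv_on_def
  by (metis continuous_at_imp_continuous_on has_derivative_continuous)

lemma open_nonzero_mv: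
  assumes "f holomorphic_mv_on U" "open U"
  shows "open {p\<in>U. f p \<noteq> 0}"
proof -
  have "open (U \<inter> f -` (- {0}))"
    using assms by (intro continuous_open_preimage holomorphic_mv_on_imp_continuous_on) auto
  also have "U \<inter> f -` (- {0}) = {p\<in>U. f p \<noteq> 0}" by auto
  finally show ?thesis .
qed

section \<open>Restriction to complex lines and identity theorems\<close>

lemma norm_complex_vector_scalar_mult: "norm (c *s (v :: complex^'n)) = norm c * norm v"
  by (simp add: norm_vec_def norm_mult L2_set_right_distrib)

lemma bounded_linear_complex_line: "bounded_linear (\<lambda>t::complex. t *s (v::complex^'n))"
  by (rule bounded_linear_intro[where K = "norm v"])
     (auto simp: vec_eq_iff algebra_simps norm_complex_vector_scalar_mult)

lemma has_field_derivative_along_line: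
  assumes "has_complex_derivative_at f f' (p + t *s v)"
  shows "((\<lambda>t. f (p + t *s v)) has_field_derivative f' v) (at t)"
proof -
  have "((\<lambda>t. p + t *s v) has_derivative (\<lambda>t. t *s v)) (at t)"
    by (auto intro!: derivative_eq_intros bounded_linear_imp_has_derivative bounded_linear_complex_line)
  from diff_chain_at[OF this, of f f']
  have "((\<lambda>t. f (p + t *s v)) has_derivative (\<lambda>t. t * f' v)) (at t)"
    using assms by (simp add: has_complex_derivative_at_def o_def)
  moreover have "(\<lambda>t. t * f' v) = (*) (f' v)" by (simp add: fun_eq_iff mult.commute)
  ultimately show ?thesis by (simp add: has_field_derivative_def)
qed

lemma holomorphic_on_along_line:
  assumes "f holomorphic_mv_on U"
  shows "(\<lambda>t. f (p + t *s v)) holomorphic_on {t. p + t *s v \<in> U}"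
proof -
  obtain f' where f': "\<And>p. p \<in> U \<Longrightarrow> has_complex_derivative_at f (f' p) p"
    using assms by (metis holomorphic_mv_onE)
  show ?thesis
    unfolding holomorphic_on_def field_differentiable_def
    using has_field_derivative_along_line[OF f'] by (blast intro: has_field_derivative_at_within)
qed

lemma continuous_on_complex_line: "continuous_on A (\<lambda>t. p + t *s (v::complex^'n))"
  by (intro continuous_intros linear_continuous_on bounded_linear_complex_line)

lemma open_complex_line_vimage:
  assumes "open U" shows "open {t. p + t *s (v::complex^'n) \<in> U}"
  using open_vimage[OF assms continuous_on_complex_line[of UNIV p v]] by (simp add: vimage_def)

lemma convex_complex_line_vimage:
  assumes "convex U" shows "convex {t. p + t *s (v::complex^'n) \<in> U}"
proof (rule convexI)
  fix x y :: complex and a b :: real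
  assume *: "x \<in> {t. p + t *s v \<in> U}" "y \<in> {t. p + t *s v \<in> U}" "0 \<le> a" "0 \<le> b" "a + b = 1"
  have "a *\<^sub>R (p + x *s v) + b *\<^sub>R (p + y *s v) \<in> U"
    using * by (intro convexD[OF assms]) auto
  moreover have "a *\<^sub>R (p + x *s v) + b *\<^sub>R (p + y *s v) = (a + b) *\<^sub>R p + (a *\<^sub>R x + b *\<^sub>R y) *s v"
    by (simp add: vec_eq_iff algebra_simps)
  ultimately show "a *\<^sub>R x + b *\<^sub>R y \<in> {t. p + t *s v \<in> U}"
    using * by simp
qed

text \<open>The complex line through \<open>q\<close> and \<open>p\<close> meets the convex set
  \<open>U\<close> in a convex, hence connected, set of parameters, and meets \<open>W\<close> in an
  open one containing 0. The identity theorem in one variable carries the zero to parameter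
  1.\<close>

lemma holomorphic_mv_zero_convex:
  assumes "f holomorphic_mv_on U" "open U" "convex U" "open W" "q \<in> W" "W \<subseteq> U"
    "\<And>p. p \<in> W \<Longrightarrow> f p = 0" "p \<in> U"
  shows "f p = 0"
proof -
  let ?S = "{t. q + t *s (p - q) \<in> U}" and ?W = "{t. q + t *s (p - q) \<in> W}"
  have "f (q + 1 *s (p - q)) = 0"
  proof (rule analytic_continuation_open[of ?W ?S "\<lambda>t. f (q + t *s (p - q))" "\<lambda>_. 0" 1])
    show "open ?W" "open ?S" by (intro open_complex_line_vimage assms)+
    show "?W \<noteq> {}" using \<open>q \<in> W\<close> by (auto intro: exI[of _ 0])
    show "connected ?S" using assms by (intro convex_connected convex_complex_line_vimage)
    show "?W \<subseteq> ?S" using assms by auto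
    show "(\<lambda>t. f (q + t *s (p - q))) holomorphic_on ?S"
      by (rule holomorphic_on_along_line[OF assms(1)])
  qed (use assms in auto)
  then show ?thesis by simp
qed

text \<open>The property that propagates is vanishing on a whole neighbourhood, called
  \<open>P\<close>: inside a ball it passes from any point to any other by the convex case, and
  connectedness of \<open>U\<close> chains the balls.\<close>

lemma holomorphic_mv_zero:
  assumes "f holomorphic_mv_on U" "open U" "connected U" "open W" "q \<in> W" "W \<subseteq> U"
    "\<And>p. p \<in> W \<Longrightarrow> f p = 0" "p \<in> U"
  shows "f p = 0"
proof -
  define P where "P p \<longleftrightarrow> (\<exists>W. open W \<and> p \<in> W \<and> W \<subseteq> U \<and> (\<forall>q\<in>W. f q = 0))" for p
  have "P p"
  proof (rule connected_induction_simple[of U q p P])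
    show "\<exists>T. openin (top_of_set U) T \<and> a \<in> T \<and> (\<forall>x\<in>T. \<forall>y\<in>T. P x \<longrightarrow> P y)" if "a \<in> U" for a
    proof -
      obtain r where r: "r > 0" "ball a r \<subseteq> U" using \<open>open U\<close> \<open>a \<in> U\<close> by (meson openE)
      have "P y" if xy: "x \<in> ball a r" "y \<in> ball a r" and "P x" for x y
      proof -
        obtain W where W: "open W" "x \<in> W" "W \<subseteq> U" "\<forall>q\<in>W. f q = 0" using \<open>P x\<close> P_def by blast
        have "f z = 0" if "z \<in> ball a r" for z
          by (rule holomorphic_mv_zero_convex[of f "ball a r" "W \<inter> ball a r" x])
             (use W xy r that assms(1) in \<open>auto intro: holomorphic_mv_on_subset\<close>)
        then show ?thesis unfolding P_def using r xy by (intro exI[of _ "ball a r"]) auto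
      qed
      moreover have "openin (top_of_set U) (ball a r)" using r by (intro open_subset) auto
      ultimately show ?thesis using r by (meson centre_in_ball)
    qed
    show "P q" unfolding P_def using assms by blast
  qed (use assms in auto)
  then show ?thesis unfolding P_def by blast
qed

text \<open>Holomorphic functions on a connected open set form an integral domain: otherwise
  \<open>g\<close> would vanish on the nonempty open set where \<open>f\<close> does not, hence
  everywhere.\<close>

lemma holomorphic_mv_mult_nonzero:
  assumes "f holomorphic_mv_on U" "g holomorphic_mv_on U" "open U" "connected U"
    "a \<in> U" "f a \<noteq> 0" "b \<in> U" "g b \<noteq> 0"
  shows "\<exists>c\<in>U. f c * g c \<noteq> 0"
proof (rule ccontr)
  assume "\<not> ?thesis"
  then have "g p = 0" if "p \<in> {p\<in>U. f p \<noteq> 0}" for p using that by auto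
  then have "g b = 0"
    by (intro holomorphic_mv_zero[OF assms(2-4) open_nonzero_mv[OF assms(1,3)], of a b])
       (use assms in auto)
  then show False using assms by simp
qed

lemma holomorphic_mv_nonzero_subset:
  assumes "f holomorphic_mv_on U" "open U" "connected U" "a \<in> U" "f a \<noteq> 0"
    "open V" "V \<subseteq> U" "V \<noteq> {}"
  shows "\<exists>c\<in>V. f c \<noteq> 0"
  using holomorphic_mv_zero[OF assms(1-3,6)] assms by blast

text \<open>Real points form a set of uniqueness: the coordinates are released one after the other, each
  time by the identity theorem in one variable.\<close>

lemma holomorphic_mv_zero_real_points:
  fixes p0 :: "complex^'n"
  assumes hol: "f holomorphic_mv_on U" and U: "open U" "connected U" "p0 \<in> U"
    and p0: "\<And>v. p0 $ v \<in> \<real>" and r: "r > 0"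
    and zero: "\<And>p. p \<in> U \<Longrightarrow> (\<And>v. p $ v \<in> \<real>) \<Longrightarrow> (\<And>v. norm (p $ v - p0 $ v) < r) \<Longrightarrow> f p = 0"
    and "p \<in> U"
  shows "f p = 0"
proof -
  obtain e where e: "e > 0" "ball p0 e \<subseteq> U" using U by (meson openE)
  \<comment> \<open>The norm is at most the sum of the \<open>CARD('n)\<close> coordinate norms, so
    the polydisc of radius \<open>d\<close> around \<open>p0\<close> lies in the ball of radius
    \<open>e\<close>.\<close>
  define d where "d = min r (e / CARD('n))"
  have d: "d > 0" "d \<le> r" using r e by (auto simp: d_def)
  have inU: "q \<in> U" if "\<And>v. norm (q $ v - p0 $ v) < d" for q
  proof -
    have "norm (q - p0) \<le> (\<Sum>v\<in>UNIV. norm ((q - p0) $ v))" unfolding norm_vec_def by (rule L2_set_le_sum) simp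
    also have "\<dots> < (\<Sum>v\<in>(UNIV::'n set). e / CARD('n))"
      using that by (intro sum_strict_mono) (auto simp: d_def)
    also have "\<dots> = e" by simp
    finally show ?thesis using e by (auto simp: dist_norm norm_minus_commute)
  qed
  \<comment> \<open>\<open>S\<close> collects the coordinates that may be nonreal. It grows from the
    empty set, where the hypothesis on real points applies, to \<open>UNIV\<close>, where the whole
    polydisc is covered.\<close>
  have "f q = 0" if "finite S" "\<And>v. norm (q $ v - p0 $ v) < d" "\<And>v. v \<notin> S \<Longrightarrow> q $ v \<in> \<real>" for S q
    using that
  proof (induction S arbitrary: q rule: finite_induct)
    case empty
    from empty d show ?case by (intro zero inU) (auto intro: less_le_trans)
  next
    case (insert v S)
    \<comment> \<open>Coordinate \<open>v\<close> is set to 0 so that the parameter \<open>t\<close>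
      along \<open>axis v 1\<close> is exactly that coordinate.\<close>
    define q0 where "q0 = (\<chi> u. if u = v then 0 else q $ u)"
    define \<phi> where "\<phi> t = f (q0 + t *s axis v 1)" for t
    have nth: "(q0 + t *s axis v 1) $ u = (if u = v then t else q $ u)" for t u
      by (auto simp: q0_def axis_def)
    have near: "norm ((q0 + t *s axis v 1) $ u - p0 $ u) < d" if "t \<in> ball (p0 $ v) d" for t u
      unfolding nth using that insert.prems(1)[of u] by (auto simp: dist_norm norm_minus_commute)
    have "\<phi> (q $ v) = 0"
    proof (rule analytic_continuation[of \<phi> "ball (p0 $ v) d" "\<real> \<inter> ball (p0 $ v) d" "p0 $ v"])
      show "\<phi> holomorphic_on ball (p0 $ v) d"
        unfolding \<phi>_def
        by (rule holomorphic_on_subset[OF holomorphic_on_along_line[OF hol]]) (auto intro!: inU near)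
      show "p0 $ v islimpt \<real> \<inter> ball (p0 $ v) d"
      proof (rule islimptI)
        fix T assume T: "p0 $ v \<in> T" "open T"
        then obtain \<epsilon> where \<epsilon>: "\<epsilon> > 0" "ball (p0 $ v) \<epsilon> \<subseteq> T" by (meson openE)
        define m where "m = min \<epsilon> d / 2"
        have m: "m > 0" "m < \<epsilon>" "m < d" using \<epsilon> d by (auto simp: m_def)
        then show "\<exists>y\<in>\<real> \<inter> ball (p0 $ v) d. y \<in> T \<and> y \<noteq> p0 $ v"
          using p0[of v] \<epsilon> by (intro bexI[of _ "p0 $ v + of_real m"]) (auto simp: dist_norm subset_eq)
      qed
      show "\<phi> z = 0" if "z \<in> \<real> \<inter> ball (p0 $ v) d" for z
        unfolding \<phi>_def
      proof (rule insert.IH)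
        show "norm ((q0 + z *s axis v 1) $ u - p0 $ u) < d" for u using that near by blast
        show "(q0 + z *s axis v 1) $ u \<in> \<real>" if "u \<notin> S" for u
          unfolding nth using \<open>z \<in> _\<close> insert.prems(2)[of u] that by auto
      qed
    qed (use insert.prems(1)[of v] d in \<open>auto simp: dist_norm norm_minus_commute\<close>)
    moreover have "q0 + (q $ v) *s axis v 1 = q" by (simp add: vec_eq_iff nth del: vector_add_component)
    ultimately show ?case by (simp add: \<phi>_def)
  qed
  from this[of UNIV] have poly: "f q = 0" if "\<And>v. norm (q $ v - p0 $ v) < d" for q
    using that by simp
  show ?thesis
  proof (rule holomorphic_mv_zero[OF hol U(1,2) open_ball[of p0 "min e d"], where q = p0])
    show "f q = 0" if "q \<in> ball p0 (min e d)" for q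
    proof (rule poly)
      fix v
      show "norm (q $ v - p0 $ v) < d"
        using that Finite_Cartesian_Product.norm_nth_le[of "q - p0" v]
        by (simp add: dist_norm norm_minus_commute)
    qed
  qed (use e d \<open>p \<in> U\<close> in auto)
qed

section \<open>Meromorphic functions of several variables\<close>

definition quotient_rep_on ::
    "(complex^'n) set \<Rightarrow> (complex^'n \<Rightarrow> complex) \<Rightarrow> (complex^'n \<Rightarrow> complex) \<Rightarrow> (complex^'n \<Rightarrow> complex) \<Rightarrow> bool" where
  "quotient_rep_on V f g h \<longleftrightarrow> g holomorphic_mv_on V \<and> h holomorphic_mv_on V \<and>
     (\<exists>q\<in>V. h q \<noteq> 0) \<and> (\<forall>q\<in>V. h q \<noteq> 0 \<longrightarrow> f q = g q / h q)"

text \<open>Demanding a numerator that is not identically zero gives a class closed under products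
  and inverses, which is what the denominators of \<open>S_fun\<close> call for.\<close>

definition nonzero_meromorphic_mv_on :: "(complex^'n \<Rightarrow> complex) \<Rightarrow> (complex^'n) set \<Rightarrow> bool" where
  "nonzero_meromorphic_mv_on f U \<longleftrightarrow>
     (\<forall>p\<in>U. \<exists>V g h. open V \<and> connected V \<and> p \<in> V \<and> V \<subseteq> U \<and>
        quotient_rep_on V f g h \<and> (\<exists>q\<in>V. g q \<noteq> 0))"

lemma meromorphic_mv_on_iff:
  "f meromorphic_mv_on U \<longleftrightarrow>
     (\<forall>p\<in>U. \<exists>V g h. open V \<and> connected V \<and> p \<in> V \<and> V \<subseteq> U \<and> quotient_rep_on V f g h)"
  unfolding meromorphic_mv_on_def quotient_rep_on_def by blast

text \<open>Shrinking could lose the points where \<open>h\<close> is nonzero; the identity theorem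
  on the connected set \<open>V\<close> prevents it.\<close>

lemma quotient_rep_on_subset:
  assumes "quotient_rep_on V f g h" "open V" "connected V" "open W" "W \<subseteq> V" "W \<noteq> {}"
  shows "quotient_rep_on W f g h"
  using assms holomorphic_mv_nonzero_subset[of h V _ W]
  unfolding quotient_rep_on_def by (meson holomorphic_mv_on_subset subsetD)

text \<open>The representation is offered for every radius up to \<open>e\<close>, so that two
  functions can be represented on one common ball; unlike an intersection of arbitrary connected
  sets, that ball is connected.\<close>

lemma quotient_rep_ball:
  assumes "quotient_rep_on V f g h" "open V" "connected V" "p \<in> V"
  obtains e where "e > 0" "ball p e \<subseteq> V"
    "\<And>r. 0 < r \<Longrightarrow> r \<le> e \<Longrightarrow> quotient_rep_on (ball p r) f g h"
proof -
  obtain e where e: "e > 0" "ball p e \<subseteq> V" using assms by (meson openE)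
  have "quotient_rep_on (ball p r) f g h" if "0 < r" "r \<le> e" for r
    by (rule quotient_rep_on_subset[OF assms(1-3)]) (use e that in auto)
  then show thesis using e that by blast
qed

lemma meromorphic_mv_onE:
  assumes "f meromorphic_mv_on U" "p \<in> U"
  obtains e g h where "e > 0" "ball p e \<subseteq> U"
    "\<And>r. 0 < r \<Longrightarrow> r \<le> e \<Longrightarrow> quotient_rep_on (ball p r) f g h"
proof -
  obtain V g h where V: "open V" "connected V" "p \<in> V" "V \<subseteq> U" "quotient_rep_on V f g h"
    using assms unfolding meromorphic_mv_on_iff by blast
  obtain e where "e > 0" "ball p e \<subseteq> V"
    "\<And>r. 0 < r \<Longrightarrow> r \<le> e \<Longrightarrow> quotient_rep_on (ball p r) f g h"
    by (rule quotient_rep_ball[OF V(5,1,2,3)]) blast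
  with V(4) show thesis by (intro that[of e g h]) auto
qed

lemma nonzero_meromorphic_mv_onE:
  assumes "nonzero_meromorphic_mv_on f U" "p \<in> U"
  obtains e g h where "e > 0" "ball p e \<subseteq> U"
    "\<And>r. 0 < r \<Longrightarrow> r \<le> e \<Longrightarrow> quotient_rep_on (ball p r) f g h"
    "\<And>r. 0 < r \<Longrightarrow> r \<le> e \<Longrightarrow> \<exists>q\<in>ball p r. g q \<noteq> 0"
proof -
  obtain V g h where V: "open V" "connected V" "p \<in> V" "V \<subseteq> U" "quotient_rep_on V f g h"
    and "\<exists>q\<in>V. g q \<noteq> 0"
    using assms unfolding nonzero_meromorphic_mv_on_def by blast
  then obtain q where q: "q \<in> V" "g q \<noteq> 0" by blast
  obtain e where e: "e > 0" "ball p e \<subseteq> V"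
    "\<And>r. 0 < r \<Longrightarrow> r \<le> e \<Longrightarrow> quotient_rep_on (ball p r) f g h"
    by (rule quotient_rep_ball[OF V(5,1,2,3)]) blast
  have "g holomorphic_mv_on V" using V(5) by (simp add: quotient_rep_on_def)
  from holomorphic_mv_nonzero_subset[OF this V(1,2) q open_ball]
  have "\<exists>q\<in>ball p r. g q \<noteq> 0" if "0 < r" "r \<le> e" for r
    using e that by (simp add: subset_iff)
  with e V(4) show thesis by (intro that[of e g h]) auto
qed

lemma nonzero_meromorphic_imp_meromorphic:
  "nonzero_meromorphic_mv_on f U \<Longrightarrow> f meromorphic_mv_on U"
  unfolding nonzero_meromorphic_mv_on_def meromorphic_mv_on_iff by blast

lemma quotient_rep_on_mult:
  assumes "quotient_rep_on V f1 g1 h1" "quotient_rep_on V f2 g2 h2" "open V" "connected V"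
  shows "quotient_rep_on V (\<lambda>p. f1 p * f2 p) (\<lambda>p. g1 p * g2 p) (\<lambda>p. h1 p * h2 p)"
  using assms holomorphic_mv_mult_nonzero[of h1 V h2]
  by (auto simp: quotient_rep_on_def intro: holomorphic_mv_on_mult)

lemma meromorphic_mv_on_mult:
  assumes "f1 meromorphic_mv_on U" "f2 meromorphic_mv_on U"
  shows "(\<lambda>p. f1 p * f2 p) meromorphic_mv_on U"
  unfolding meromorphic_mv_on_iff
proof
  fix p assume "p \<in> U"
  obtain e1 g1 h1 where 1: "e1 > 0" "ball p e1 \<subseteq> U"
    "\<And>r. 0 < r \<Longrightarrow> r \<le> e1 \<Longrightarrow> quotient_rep_on (ball p r) f1 g1 h1"
    using meromorphic_mv_onE[OF assms(1) \<open>p \<in> U\<close>] by metis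
  obtain e2 g2 h2 where 2: "e2 > 0"
    "\<And>r. 0 < r \<Longrightarrow> r \<le> e2 \<Longrightarrow> quotient_rep_on (ball p r) f2 g2 h2"
    using meromorphic_mv_onE[OF assms(2) \<open>p \<in> U\<close>] by metis
  have "quotient_rep_on (ball p (min e1 e2)) (\<lambda>p. f1 p * f2 p) (\<lambda>p. g1 p * g2 p) (\<lambda>p. h1 p * h2 p)"
    using 1 2 by (intro quotient_rep_on_mult) auto
  then show "\<exists>V g h. open V \<and> connected V \<and> p \<in> V \<and> V \<subseteq> U \<and> quotient_rep_on V (\<lambda>p. f1 p * f2 p) g h"
    by (intro exI[of _ "ball p (min e1 e2)"] exI conjI) (use 1 2 in auto)
qed

lemma nonzero_meromorphic_mult:
  assumes "nonzero_meromorphic_mv_on f1 U" "nonzero_meromorphic_mv_on f2 U"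
  shows "nonzero_meromorphic_mv_on (\<lambda>p. f1 p * f2 p) U"
  unfolding nonzero_meromorphic_mv_on_def
proof
  fix p assume "p \<in> U"
  obtain e1 g1 h1 where 1: "e1 > 0" "ball p e1 \<subseteq> U"
    "\<And>r. 0 < r \<Longrightarrow> r \<le> e1 \<Longrightarrow> quotient_rep_on (ball p r) f1 g1 h1"
    "\<And>r. 0 < r \<Longrightarrow> r \<le> e1 \<Longrightarrow> \<exists>q\<in>ball p r. g1 q \<noteq> 0"
    using nonzero_meromorphic_mv_onE[OF assms(1) \<open>p \<in> U\<close>] by metis
  obtain e2 g2 h2 where 2: "e2 > 0"
    "\<And>r. 0 < r \<Longrightarrow> r \<le> e2 \<Longrightarrow> quotient_rep_on (ball p r) f2 g2 h2"
    "\<And>r. 0 < r \<Longrightarrow> r \<le> e2 \<Longrightarrow> \<exists>q\<in>ball p r. g2 q \<noteq> 0"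
    using nonzero_meromorphic_mv_onE[OF assms(2) \<open>p \<in> U\<close>] by metis
  let ?r = "min e1 e2"
  have r: "0 < ?r" "?r \<le> e1" "?r \<le> e2" using 1 2 by auto
  note rep = 1(3)[OF r(1,2)] 2(2)[OF r(1,3)]
  obtain a b where "a \<in> ball p ?r" "g1 a \<noteq> 0" "b \<in> ball p ?r" "g2 b \<noteq> 0"
    using 1(4)[OF r(1,2)] 2(3)[OF r(1,3)] by blast
  then have "\<exists>q\<in>ball p ?r. g1 q * g2 q \<noteq> 0"
    using rep by (intro holomorphic_mv_mult_nonzero) (auto simp: quotient_rep_on_def)
  moreover have "quotient_rep_on (ball p ?r) (\<lambda>p. f1 p * f2 p) (\<lambda>p. g1 p * g2 p) (\<lambda>p. h1 p * h2 p)"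
    using rep by (intro quotient_rep_on_mult) auto
  ultimately show "\<exists>V g h. open V \<and> connected V \<and> p \<in> V \<and> V \<subseteq> U \<and>
      quotient_rep_on V (\<lambda>p. f1 p * f2 p) g h \<and> (\<exists>q\<in>V. g q \<noteq> 0)"
    by (intro exI[of _ "ball p (min e1 e2)"] exI conjI) (use 1 2 in auto)
qed

text \<open>Where only \<open>h\<close> vanishes, \<open>f\<close> is arbitrary and \<open>inverse f\<close> need not vanish; hence the inverse
  of \<open>g / h\<close> is represented as \<open>h\<^sup>2 / (g h)\<close>.\<close>

lemma nonzero_meromorphic_inverse:
  assumes "nonzero_meromorphic_mv_on f U"
  shows "nonzero_meromorphic_mv_on (\<lambda>p. inverse (f p)) U"
  unfolding nonzero_meromorphic_mv_on_def
proof
  fix p assume "p \<in> U"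
  then obtain V g h where V: "open V" "connected V" "p \<in> V" "V \<subseteq> U" "quotient_rep_on V f g h"
    and g: "\<exists>q\<in>V. g q \<noteq> 0"
    using assms unfolding nonzero_meromorphic_mv_on_def by blast
  have "\<exists>q\<in>V. g q * h q \<noteq> 0" "\<exists>q\<in>V. h q * h q \<noteq> 0"
    using V g holomorphic_mv_mult_nonzero[of g V h] by (auto simp: quotient_rep_on_def)
  moreover from this have "quotient_rep_on V (\<lambda>p. inverse (f p)) (\<lambda>p. h p * h p) (\<lambda>p. g p * h p)"
    using V by (auto simp: quotient_rep_on_def intro: holomorphic_mv_on_mult)
  ultimately show "\<exists>V g h. open V \<and> connected V \<and> p \<in> V \<and> V \<subseteq> U \<and>
      quotient_rep_on V (\<lambda>p. inverse (f p)) g h \<and> (\<exists>q\<in>V. g q \<noteq> 0)"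
    using V by blast
qed

lemma nonzero_meromorphic_divide:
  "nonzero_meromorphic_mv_on f U \<Longrightarrow> nonzero_meromorphic_mv_on g U \<Longrightarrow>
     nonzero_meromorphic_mv_on (\<lambda>p. f p / g p) U"
  unfolding divide_inverse by (intro nonzero_meromorphic_mult nonzero_meromorphic_inverse)

lemma nonvanishing_holomorphic_imp_nonzero_meromorphic:
  assumes "f holomorphic_mv_on U" "open U" "\<And>p. p \<in> U \<Longrightarrow> f p \<noteq> 0"
  shows "nonzero_meromorphic_mv_on f U"
  unfolding nonzero_meromorphic_mv_on_def
proof
  fix p assume "p \<in> U"
  then obtain r where r: "r > 0" "ball p r \<subseteq> U" using assms(2) by (meson openE)
  have "quotient_rep_on (ball p r) f f (\<lambda>_. 1)"
    unfolding quotient_rep_on_def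
  proof (intro conjI)
    show "f holomorphic_mv_on ball p r" using assms(1) r(2) by (rule holomorphic_mv_on_subset)
    show "\<exists>q\<in>ball p r. (1::complex) \<noteq> 0" using r(1) by (intro bexI[of _ p]) auto
  qed (auto intro: holomorphic_mv_on_const)
  moreover have "\<exists>q\<in>ball p r. f q \<noteq> 0" using assms(3) \<open>p \<in> U\<close> r by (intro bexI[of _ p]) auto
  ultimately show "\<exists>V g h. open V \<and> connected V \<and> p \<in> V \<and> V \<subseteq> U \<and>
      quotient_rep_on V f g h \<and> (\<exists>q\<in>V. g q \<noteq> 0)"
    using r by (intro exI[of _ "ball p r"] exI conjI) auto
qed

section \<open>Identity theorems for meromorphic functions\<close>

definition agree_near :: "(complex^'n) set \<Rightarrow> (complex^'n \<Rightarrow> complex) \<Rightarrow> (complex^'n \<Rightarrow> complex) \<Rightarrow> complex^'n \<Rightarrow> bool" where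
  "agree_near U f1 f2 p \<longleftrightarrow> (\<exists>V h. open V \<and> connected V \<and> p \<in> V \<and> V \<subseteq> U \<and>
        h holomorphic_mv_on V \<and> (\<exists>q\<in>V. h q \<noteq> 0) \<and> (\<forall>q\<in>V. h q \<noteq> 0 \<longrightarrow> f1 q = f2 q))"

text \<open>Cross products are holomorphic on all of \<open>V\<close>, unlike the quotients; the
  product of the two denominators serves as the exceptional function.\<close>

lemma agree_nearI:
  assumes V: "open V" "connected V" "p \<in> V" "V \<subseteq> U"
    and rep: "quotient_rep_on V f1 g1 h1" "quotient_rep_on V f2 g2 h2"
    and eq: "\<And>q. q \<in> V \<Longrightarrow> g1 q * h2 q = g2 q * h1 q"
  shows "agree_near U f1 f2 p"
  unfolding agree_near_def
proof (intro exI conjI ballI impI)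
  show "(\<lambda>p. h1 p * h2 p) holomorphic_mv_on V"
    using rep by (auto simp: quotient_rep_on_def intro: holomorphic_mv_on_mult)
  show "\<exists>q\<in>V. h1 q * h2 q \<noteq> 0"
    using rep V holomorphic_mv_mult_nonzero[of h1 V h2] by (auto simp: quotient_rep_on_def)
  show "f1 q = f2 q" if "q \<in> V" "h1 q * h2 q \<noteq> 0" for q
    using rep that eq[OF that(1)] by (auto simp: quotient_rep_on_def frac_eq_eq)
qed (use V in auto)

text \<open>The cross difference \<open>?D\<close> is holomorphic on a ball carrying representations
  of both functions. Agreement near one point of the ball makes it vanish on a nonempty open set,
  hence on the ball, and this returns agreement near every point of the ball.\<close>

lemma agree_near_spread:
  assumes mero: "f1 meromorphic_mv_on U" "f2 meromorphic_mv_on U"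
    and U: "connected U" "open U" and ab: "a \<in> U" "b \<in> U" "agree_near U f1 f2 a"
  shows "agree_near U f1 f2 b"
proof (rule connected_induction_simple[where P = "agree_near U f1 f2", OF U(1) ab])
  fix p assume "p \<in> U"
  obtain e1 g1 h1 where 1: "e1 > 0" "ball p e1 \<subseteq> U"
    "\<And>r. 0 < r \<Longrightarrow> r \<le> e1 \<Longrightarrow> quotient_rep_on (ball p r) f1 g1 h1"
    using meromorphic_mv_onE[OF mero(1) \<open>p \<in> U\<close>] by metis
  obtain e2 g2 h2 where 2: "e2 > 0"
    "\<And>r. 0 < r \<Longrightarrow> r \<le> e2 \<Longrightarrow> quotient_rep_on (ball p r) f2 g2 h2"
    using meromorphic_mv_onE[OF mero(2) \<open>p \<in> U\<close>] by metis
  define B where "B = ball p (min e1 e2)"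
  have B: "open B" "connected B" "p \<in> B" "B \<subseteq> U" using 1 2 by (auto simp: B_def)
  have rep: "quotient_rep_on B f1 g1 h1" "quotient_rep_on B f2 g2 h2"
    unfolding B_def using 1 2 by auto
  then have hol: "g1 holomorphic_mv_on B" "h1 holomorphic_mv_on B"
      "g2 holomorphic_mv_on B" "h2 holomorphic_mv_on B"
    and nz: "\<exists>q\<in>B. h1 q \<noteq> 0" "\<exists>q\<in>B. h2 q \<noteq> 0"
    by (auto simp: quotient_rep_on_def)
  let ?D = "\<lambda>q. g1 q * h2 q - g2 q * h1 q"
  have D: "?D holomorphic_mv_on B" using hol by (intro holomorphic_mv_intros)
  have "agree_near U f1 f2 y" if xy: "x \<in> B" "y \<in> B" and "agree_near U f1 f2 x" for x y
  proof -
    obtain V h where V: "open V" "connected V" "x \<in> V" "V \<subseteq> U" "h holomorphic_mv_on V"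
        "\<exists>q\<in>V. h q \<noteq> 0" "\<And>q. q \<in> V \<Longrightarrow> h q \<noteq> 0 \<Longrightarrow> f1 q = f2 q"
      using \<open>agree_near U f1 f2 x\<close> unfolding agree_near_def by blast
    obtain c where c: "c \<in> B" "h1 c * h2 c \<noteq> 0"
      using nz hol B holomorphic_mv_mult_nonzero[of h1 B h2] by blast
    have hh: "(\<lambda>q. h1 q * h2 q) holomorphic_mv_on B" using hol by (intro holomorphic_mv_intros)
    have "\<exists>c\<in>B \<inter> V. h1 c * h2 c \<noteq> 0"
      by (rule holomorphic_mv_nonzero_subset[OF hh B(1,2) c]) (use B V xy in auto)
    then obtain c where c: "c \<in> B \<inter> V" "h1 c * h2 c \<noteq> 0" by blast
    \<comment> \<open>On \<open>W\<close> both quotients are valid, and \<open>W\<close> lies in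
      \<open>V\<close>, where \<open>f1\<close> and \<open>f2\<close> can be compared. Removing the
      zeros of \<open>h\<close> leaves an open set on which \<open>?D\<close> vanishes.\<close>
    define W where "W = {q\<in>B. h1 q * h2 q \<noteq> 0} \<inter> V"
    have W: "open W" "c \<in> W" unfolding W_def using open_nonzero_mv[OF hh B(1)] V c by auto
    have "\<exists>d\<in>W. h d \<noteq> 0"
      using V(6) W by (elim bexE, intro holomorphic_mv_nonzero_subset[OF V(5,1,2)]) (auto simp: W_def)
    then obtain d where d: "d \<in> W" "h d \<noteq> 0" by blast
    have "?D y = 0"  if "y \<in> B" for y
    proof (rule holomorphic_mv_zero[OF D B(1,2), of "W \<inter> {q\<in>V. h q \<noteq> 0}" d])
      show "open (W \<inter> {q\<in>V. h q \<noteq> 0})" using W open_nonzero_mv[OF V(5,1)] by auto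
      show "?D q = 0" if "q \<in> W \<inter> {q\<in>V. h q \<noteq> 0}" for q
        using that V(7)[of q] rep by (auto simp: W_def quotient_rep_on_def frac_eq_eq)
    qed (use d that in \<open>auto simp: W_def\<close>)
    then show ?thesis
      by (intro agree_nearI[OF B(1,2) xy(2) B(4) rep]) auto
  qed
  moreover have "openin (top_of_set U) B" using B by (intro open_subset) auto
  ultimately show "\<exists>T. openin (top_of_set U) T \<and> p \<in> T \<and>
      (\<forall>x\<in>T. \<forall>y\<in>T. agree_near U f1 f2 x \<longrightarrow> agree_near U f1 f2 y)"
    using B(3) by meson
qed

text \<open>The quotients say nothing at real points where a denominator vanishes. Multiplying the
  cross difference by both denominators makes it zero there too, so the product vanishes at all real
  points near \<open>p\<close> and hence on the ball; the factor \<open>?h\<close> is cancelled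
  afterwards.\<close>

lemma agree_near_real_points:
  assumes mero: "f1 meromorphic_mv_on U" "f2 meromorphic_mv_on U" and p: "p \<in> U"
    and r: "\<And>v. p $ v \<in> \<real>" "r > 0"
    and eq: "\<And>q. (\<And>v. q $ v \<in> \<real>) \<Longrightarrow> (\<And>v. norm (q $ v - p $ v) < r) \<Longrightarrow> f1 q = f2 q"
  shows "agree_near U f1 f2 p"
proof -
  obtain e1 g1 h1 where 1: "e1 > 0" "ball p e1 \<subseteq> U"
    "\<And>r. 0 < r \<Longrightarrow> r \<le> e1 \<Longrightarrow> quotient_rep_on (ball p r) f1 g1 h1"
    using meromorphic_mv_onE[OF mero(1) p] by metis
  obtain e2 g2 h2 where 2: "e2 > 0"
    "\<And>r. 0 < r \<Longrightarrow> r \<le> e2 \<Longrightarrow> quotient_rep_on (ball p r) f2 g2 h2"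
    using meromorphic_mv_onE[OF mero(2) p] by metis
  define B where "B = ball p (min e1 e2)"
  have B: "open B" "connected B" "p \<in> B" "B \<subseteq> U" using 1 2 by (auto simp: B_def)
  have rep: "quotient_rep_on B f1 g1 h1" "quotient_rep_on B f2 g2 h2"
    unfolding B_def using 1 2 by auto
  then have hol: "g1 holomorphic_mv_on B" "h1 holomorphic_mv_on B"
      "g2 holomorphic_mv_on B" "h2 holomorphic_mv_on B"
    and nz: "\<exists>q\<in>B. h1 q \<noteq> 0" "\<exists>q\<in>B. h2 q \<noteq> 0"
    by (auto simp: quotient_rep_on_def)
  let ?D = "\<lambda>q. g1 q * h2 q - g2 q * h1 q" and ?h = "\<lambda>q. h1 q * h2 q"
  have D: "?D holomorphic_mv_on B" "?h holomorphic_mv_on B" using hol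
    by (auto intro!: holomorphic_mv_on_mult holomorphic_mv_on_diff)
  have Dh: "?D q * ?h q = 0" if "q \<in> B" for q
  proof (rule holomorphic_mv_zero_real_points[of "\<lambda>q. ?D q * ?h q" B p r])
    show "?D q * ?h q = 0" if "q \<in> B" "\<And>v. q $ v \<in> \<real>" "\<And>v. norm (q $ v - p $ v) < r" for q
      using eq[OF that(2,3)] rep that(1)
      by (cases "h1 q = 0 \<or> h2 q = 0") (auto simp: quotient_rep_on_def frac_eq_eq)
  qed (use B D r that in \<open>auto intro: holomorphic_mv_on_mult\<close>)
  obtain c where c: "c \<in> B" "?h c \<noteq> 0"
    using nz hol B holomorphic_mv_mult_nonzero[of h1 B h2] by blast
  have "?D q = 0" if "q \<in> B" for q
    using holomorphic_mv_mult_nonzero[OF D B(1,2) that _ c] Dh by blast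
  then show ?thesis by (intro agree_nearI[OF B rep]) auto
qed

section \<open>Permutation of the coordinates\<close>

lemma holomorphic_mv_on_permute:
  fixes \<pi> :: "'n::finite \<Rightarrow> 'n"
  assumes "f holomorphic_mv_on U"
  shows "(\<lambda>p. f (\<chi> v. p $ \<pi> v)) holomorphic_mv_on {p. (\<chi> v. p $ \<pi> v) \<in> U}"
proof -
  obtain f' where f': "\<And>p. p \<in> U \<Longrightarrow> has_complex_derivative_at f (f' p) p"
    using assms by (metis holomorphic_mv_onE)
  have lin: "bounded_linear (\<lambda>p::complex^'n. \<chi> v. p $ \<pi> v)"
    by (intro linear_conv_bounded_linear[THEN iffD1] linearI) (auto simp: vec_eq_iff)
  show ?thesis
  proof (rule holomorphic_mv_onI[where f' = "\<lambda>p u. f' (\<chi> v. p $ \<pi> v) (\<chi> v. u $ \<pi> v)"])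
    fix p assume "p \<in> {p. (\<chi> v. p $ \<pi> v) \<in> U}"
    then have d: "has_complex_derivative_at f (f' (\<chi> v. p $ \<pi> v)) (\<chi> v. p $ \<pi> v)" using f' by auto
    have *: "(\<chi> v. (c *s u) $ \<pi> v) = c *s (\<chi> v. u $ \<pi> v)" for c and u :: "complex^'n"
      by (simp add: vec_eq_iff)
    show "has_complex_derivative_at (\<lambda>p. f (\<chi> v. p $ \<pi> v))
        (\<lambda>u. f' (\<chi> v. p $ \<pi> v) (\<chi> v. u $ \<pi> v)) p"
      using d diff_chain_at[OF bounded_linear_imp_has_derivative[OF lin], of f _ p]
      unfolding has_complex_derivative_at_def * by (simp add: o_def)
  qed
qed

text \<open>As \<open>\<pi>\<close> is an involution, the preimage of a neighbourhood is also its
  image under the same continuous map; the first description makes it open, the second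
  connected.\<close>

lemma meromorphic_mv_on_permute:
  fixes \<pi> :: "'n::finite \<Rightarrow> 'n"
  assumes f: "f meromorphic_mv_on U" and \<pi>: "\<And>v. \<pi> (\<pi> v) = v"
    and U: "\<And>p. p \<in> U \<Longrightarrow> (\<chi> v. p $ \<pi> v) \<in> U"
  shows "(\<lambda>p. f (\<chi> v. p $ \<pi> v)) meromorphic_mv_on U"
  unfolding meromorphic_mv_on_iff
proof
  let ?s = "\<lambda>p::complex^'n. \<chi> v. p $ \<pi> v"
  have ss: "?s (?s p) = p" for p by (simp add: vec_eq_iff \<pi>)
  have lin: "bounded_linear ?s"
    by (intro linear_conv_bounded_linear[THEN iffD1] linearI) (auto simp: vec_eq_iff)
  fix p assume "p \<in> U"
  then obtain V g h where V: "open V" "connected V" "?s p \<in> V" "V \<subseteq> U" "quotient_rep_on V f g h"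
    using f U unfolding meromorphic_mv_on_iff by blast
  let ?W = "{p. ?s p \<in> V}"
  have W: "?W = ?s ` V"
  proof
    show "?W \<subseteq> ?s ` V"
    proof
      fix q assume "q \<in> ?W"
      then show "q \<in> ?s ` V" by (intro image_eqI[of q ?s "?s q"] ss[symmetric]) simp
    qed
    show "?s ` V \<subseteq> ?W" by (intro image_subsetI CollectI) (simp only: ss)
  qed
  have "open ?W" using open_vimage[OF V(1) linear_continuous_on[OF lin]] by (simp add: vimage_def)
  moreover have "connected ?W" unfolding W
    by (intro connected_continuous_image linear_continuous_on lin V)
  moreover have "?W \<subseteq> U" using U[of "?s _"] V(4) ss by (metis (no_types, lifting) mem_Collect_eq subset_iff)
  moreover have "quotient_rep_on ?W (\<lambda>p. f (?s p)) (\<lambda>p. g (?s p)) (\<lambda>p. h (?s p))"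
    using V(5) unfolding quotient_rep_on_def
    by (auto intro: holomorphic_mv_on_permute) (metis ss)
  ultimately show "\<exists>V g h. open V \<and> connected V \<and> p \<in> V \<and> V \<subseteq> U \<and>
      quotient_rep_on V (\<lambda>p. f (?s p)) g h"
    using V(3) by blast
qed

section \<open>Estimates for hyperbolic functions\<close>

text \<open>The modulus of sinh u is at least sinh (Re u), and 1 + 2 r \<le> exp (2 r) bounds 1 -
  exp (-2 r) below by 2 r / (1 + 2 r). The first form keeps the exponential growth for large
  arguments, the second the linear behaviour near 0.\<close>

lemma norm_sinh_ge:
  fixes u :: complex
  assumes "Re u > 0"
  shows "exp (Re u) * (Re u / (1 + 2 * Re u)) \<le> norm (sinh u)" "Re u / 2 \<le> norm (sinh u)"
proof -
  define r where "r = Re u"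
  have r: "r > 0" using assms by (simp add: r_def)
  have "1 + 2 * r \<le> exp (2 * r)" using exp_ge_add_one_self[of "2*r"] by simp
  then have "exp (- (2 * r)) \<le> 1 / (1 + 2 * r)"
    using r by (simp add: exp_minus field_simps)
  then have "r / (1 + 2 * r) \<le> (1 - exp (- (2 * r))) / 2" using r by (simp add: field_simps)
  then have "exp r * (r / (1 + 2 * r)) \<le> exp r * ((1 - exp (- (2 * r))) / 2)"
    by (intro mult_left_mono) auto
  also have "\<dots> = (exp r - exp (- r)) / 2"
    by (simp add: algebra_simps flip: exp_add)
  also have "\<dots> \<le> norm (exp u - exp (- u)) / 2"
    using norm_triangle_ineq2[of "exp u" "exp (-u)"] by (simp add: r_def)
  also have "\<dots> = norm (sinh u)" by (simp add: sinh_def norm_mult)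
  finally show *: "exp (Re u) * (Re u / (1 + 2 * Re u)) \<le> norm (sinh u)" by (simp add: r_def)
  have "r / 2 * (1 + 2 * r) \<le> exp r * r"
    using r exp_ge_add_one_self[of r] mult_right_mono[of "1 + r" "exp r" r] by (simp add: algebra_simps)
  then have "r / 2 \<le> exp r * (r / (1 + 2 * r))" using r by (simp add: field_simps)
  with * show "Re u / 2 \<le> norm (sinh u)" unfolding r_def by (rule order_trans[rotated])
qed

lemma sinh_nonzero: "Re u > 0 \<Longrightarrow> sinh (u :: complex) \<noteq> 0"
  using norm_sinh_ge(2)[of u] by auto

lemma norm_sin_le_exp: "norm (sin z) \<le> exp \<bar>Im z\<bar>"
  using cmod_sin_le_exp[of 1 z] by simp

lemma norm_sin_le_linear: "norm (sin z) \<le> exp \<bar>Im z\<bar> * norm z"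
  using Taylor_sin[of z 0] by simp

lemma norm_sin_diff_le: "norm (sin z - z) \<le> exp \<bar>Im z\<bar> * norm z ^ 3 / 2"
  using Taylor_sin[of z 2] by (simp add: numeral_2_eq_2 numeral_3_eq_3 sin_coeff_def)

lemma norm_sinh_diff_le: "norm (sinh z - z) \<le> exp \<bar>Re z\<bar> * norm (z::complex) ^ 3 / 2"
proof -
  have "sinh z - z = - \<i> * (sin (\<i> * z) - \<i> * z)"
    by (simp add: sinh_conv_sin algebra_simps)
  then show ?thesis using norm_sin_diff_le[of "\<i> * z"] by (simp add: norm_mult)
qed

text \<open>Since exp (\<delta> y) dominates the cube of 1 + \<delta> y / 3, it dominates that of 1
  + y up to a constant: one factor absorbs 1 + c y, the other two absorb 1 + y^2.\<close>

lemma poly_exp_bound: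
  fixes c \<delta> y :: real
  assumes "c \<ge> 0" "\<delta> > 0" "y > 0"
  shows "(1 + c * y) * exp (- (\<delta> * y)) \<le> (1 + c) * (1 + 3 / \<delta>) ^ 3 / (1 + y\<^sup>2)"
proof -
  define M where "M = 1 + 3 / \<delta>"
  have M: "M \<ge> 1" "M * \<delta> / 3 \<ge> 1" using assms by (auto simp: M_def field_simps)
  have "1 + y \<le> M * (1 + \<delta> * y / 3)"
    using add_mono[OF M(1) mult_right_mono[OF M(2), of y]] assms by (simp add: algebra_simps)
  then have "(1 + y) ^ 3 \<le> (M * (1 + \<delta> * y / 3)) ^ 3" using assms by (intro power_mono) auto
  also have "\<dots> = M ^ 3 * (1 + \<delta> * y / real 3) ^ 3" by (simp add: power_mult_distrib)
  also have "\<dots> \<le> M ^ 3 * exp (\<delta> * y)"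
  proof (intro mult_left_mono exp_ge_one_plus_x_over_n_power_n)
    have "0 \<le> \<delta> * y" using assms by simp
    then show "- real 3 \<le> \<delta> * y" by simp
  qed (use M in auto)
  finally have 1: "(1 + y) ^ 3 \<le> M ^ 3 * exp (\<delta> * y)" .
  have "(1 + c * y) * (1 + y\<^sup>2) \<le> ((1 + c) * (1 + y)) * (1 + y)\<^sup>2"
    using assms by (intro mult_mono) (auto simp: power2_eq_square algebra_simps)
  also have "\<dots> = (1 + c) * (1 + y) ^ 3" by (simp add: power2_eq_square power3_eq_cube)
  also have "\<dots> \<le> (1 + c) * (M ^ 3 * exp (\<delta> * y))" using 1 assms by (intro mult_left_mono) auto
  finally have "(1 + c * y) * (1 + y\<^sup>2) \<le> (1 + c) * M ^ 3 * exp (\<delta> * y)" by (simp add: mult.assoc)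
  moreover have "1 + y\<^sup>2 > 0" by (simp add: add_pos_nonneg)
  ultimately show ?thesis unfolding M_def[symmetric] by (simp add: exp_minus field_simps)
qed

lemma set_integrable_inverse_square: "set_integrable lborel {0<..} (\<lambda>y::real. C / (1 + y\<^sup>2))"
proof -
  have "set_integrable lborel (einterval 0 \<infinity>) (\<lambda>y::real. 1 / (1 + y\<^sup>2))"
  proof (rule interval_integral_FTC_nonneg(1)[of 0 \<infinity> arctan])
    show "(arctan has_real_derivative 1 / (1 + x\<^sup>2)) (at x)" for x
      by (auto intro!: derivative_eq_intros simp: field_simps)
    show "isCont (\<lambda>y::real. 1 / (1 + y\<^sup>2)) x" for x
      by (intro continuous_intros) (auto simp: add_nonneg_eq_0_iff)
    show "((arctan \<circ> real_of_ereal) \<longlongrightarrow> arctan 0) (at_right 0)"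
      unfolding zero_ereal_def ereal_tendsto_simps by (intro tendsto_intros)
    show "((arctan \<circ> real_of_ereal) \<longlongrightarrow> pi / 2) (at_left \<infinity>)"
      unfolding ereal_tendsto_simps by (rule tendsto_arctan_at_top)
  qed auto
  then have "set_integrable lborel {0<..} (\<lambda>y::real. C * (1 / (1 + y\<^sup>2)))"
    by (intro set_integrable_mult_right) (simp add: zero_ereal_def)
  then show ?thesis by simp
qed

lemma set_integrable_positive_dominated:
  fixes f :: "real \<Rightarrow> complex"
  assumes "continuous_on {0<..} f" "\<And>y. y > 0 \<Longrightarrow> norm (f y) \<le> C / (1 + y\<^sup>2)"
  shows "set_integrable lborel {0<..} f"
proof (rule set_integrable_bound[OF set_integrable_inverse_square[of C]])
  show "set_borel_measurable lborel {0<..} f"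
    unfolding set_borel_measurable_def
    using borel_measurable_continuous_on_indicator[OF _ assms(1)] by simp
  show "AE y in lborel. y \<in> {0<..} \<longrightarrow> norm (f y) \<le> norm (C / (1 + y\<^sup>2))"
    using assms(2) unfolding real_norm_def
    by (intro AE_I2 impI) (metis abs_ge_self greaterThan_iff order_trans)
qed

section \<open>The integrand of the hyperbolic gamma function\<close>

definition gamma_kernel :: "complex \<Rightarrow> complex \<Rightarrow> complex \<Rightarrow> real \<Rightarrow> complex" where
  "gamma_kernel w1 w2 z y =
     (sin (2 * of_real y * z) / (2 * sinh (w1 * of_real y) * sinh (w2 * of_real y))
          - z / (w1 * w2 * of_real y)) / of_real y"

text \<open>After writing the sine and both sinh as linear part plus remainder, the terms 2 w1 w2 z
  y^2 cancel over the common denominator. Numerator and denominator are then both of order y^4, so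
  the quotient stays bounded at 0. All arguments have modulus at most 2 R y, hence \<open>E\<close>
  controls all three cubic remainders.\<close>

lemma gamma_kernel_bound_small:
  assumes a: "\<alpha> > 0" "Re w1 \<ge> \<alpha>" "Re w2 \<ge> \<alpha>" and R: "norm w1 \<le> R" "norm w2 \<le> R" "norm z \<le> R"
    and y: "0 < y" "y \<le> 1" and E: "E = exp (2 * R) * (2 * R) ^ 3 / 2"
  shows "norm (gamma_kernel w1 w2 z y) \<le> 2 * (R\<^sup>2 * E + 2 * R * (2 * R * E + E\<^sup>2)) / \<alpha> ^ 4"
proof -
  have R0: "R \<ge> 0" using R(1) norm_ge_zero order_trans by blast
  have E0: "E \<ge> 0" using R0 by (simp add: E)
  define Y where "Y = complex_of_real y"
  have nY: "norm Y = y" using y by (simp add: Y_def)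
  have rw: "\<alpha> \<le> norm w1" "\<alpha> \<le> norm w2" using a complex_Re_le_cmod order_trans by blast+
  define e1 where "e1 = sin (2 * Y * z) - 2 * Y * z"
  define e2 where "e2 = sinh (w1 * Y) - w1 * Y"
  define e3 where "e3 = sinh (w2 * Y) - w2 * Y"
  have gen: "exp c * n ^ 3 / 2 \<le> E * y ^ 3" if "c \<le> 2 * R" "0 \<le> n" "n \<le> 2 * R * y" for c n
  proof -
    have "exp c * n ^ 3 / 2 \<le> exp (2 * R) * (2 * R * y) ^ 3 / 2"
      using that by (intro divide_right_mono mult_mono power_mono) auto
    then show ?thesis by (simp add: E power_mult_distrib mult_ac)
  qed
  have le: "norm v * y \<le> norm v" for v :: complex using y mult_left_le[of y "norm v"] by auto
  have "norm e1 \<le> exp \<bar>Im (2 * Y * z)\<bar> * norm (2 * Y * z) ^ 3 / 2"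
    unfolding e1_def by (rule norm_sin_diff_le)
  also have "\<dots> \<le> E * y ^ 3"
  proof (rule gen)
    have "\<bar>Im (2 * Y * z)\<bar> \<le> norm (2 * Y * z)" by (rule abs_Im_le_cmod)
    also have "\<dots> \<le> 2 * R" using le[of z] R(3) by (simp add: norm_mult nY mult.commute)
    finally show "\<bar>Im (2 * Y * z)\<bar> \<le> 2 * R" .
    show "norm (2 * Y * z) \<le> 2 * R * y" using R(3) y by (simp add: norm_mult nY)
  qed auto
  finally have e1: "norm e1 \<le> E * y ^ 3" .
  have sh: "norm (sinh (w * Y) - w * Y) \<le> E * y ^ 3" if "norm w \<le> R" for w
  proof -
    have "norm (sinh (w * Y) - w * Y) \<le> exp \<bar>Re (w * Y)\<bar> * norm (w * Y) ^ 3 / 2"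
      by (rule norm_sinh_diff_le)
    also have "\<dots> \<le> E * y ^ 3"
    proof (rule gen)
      have "\<bar>Re (w * Y)\<bar> \<le> norm (w * Y)" by (rule abs_Re_le_cmod)
      also have "\<dots> \<le> 2 * R" using le[of w] that R0 by (simp add: norm_mult nY)
      finally show "\<bar>Re (w * Y)\<bar> \<le> 2 * R" .
      show "norm (w * Y) \<le> 2 * R * y"
        using mult_right_mono[OF that, of y] R0 y by (simp add: norm_mult nY)
    qed auto
    finally show ?thesis .
  qed
  have e2: "norm e2 \<le> E * y ^ 3" and e3: "norm e3 \<le> E * y ^ 3"
    unfolding e2_def e3_def using sh R by auto
  have pos: "Re (w1 * Y) > 0" "Re (w2 * Y) > 0" using a y by (auto simp: Y_def)
  then have nz: "sinh (w1 * Y) \<noteq> 0" "sinh (w2 * Y) \<noteq> 0" "w1 \<noteq> 0" "w2 \<noteq> 0" "Y \<noteq> 0"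
    using sinh_nonzero a y by (auto simp: Y_def)
  let ?num = "w1 * w2 * Y * e1 - 2 * z * (w1 * Y * e3 + e2 * (w2 * Y) + e2 * e3)"
  let ?den = "2 * w1 * w2 * Y * sinh (w1 * Y) * sinh (w2 * Y) * Y"
  have "gamma_kernel w1 w2 z y = ?num / ?den"
  proof -
    have s: "sin (2 * Y * z) = 2 * Y * z + e1" by (simp add: e1_def)
    have "?num = w1 * w2 * Y * (2 * Y * z + e1) - 2 * z * ((w1 * Y + e2) * (w2 * Y + e3))"
      by (simp add: algebra_simps)
    also have "\<dots> = w1 * w2 * Y * sin (2 * Y * z) - 2 * z * (sinh (w1 * Y) * sinh (w2 * Y))"
      by (simp add: e1_def e2_def e3_def)
    finally show ?thesis using nz unfolding gamma_kernel_def Y_def[symmetric]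
      by (simp add: divide_simps)
  qed
  moreover have "norm ?num \<le> (R\<^sup>2 * E + 2 * R * (2 * R * E + E\<^sup>2)) * y ^ 4"
  proof -
    \<comment> \<open>The product of the two sinh remainders is of order y^6 and is absorbed because
      y \<le> 1.\<close>
    have y6: "y ^ 6 \<le> y ^ 4" using y by (intro power_decreasing) auto
    have "norm (w1 * w2 * Y * e1) \<le> R * R * y * (E * y ^ 3)"
      unfolding norm_mult nY using R R0 y e1 by (intro mult_mono) auto
    also have "\<dots> = R\<^sup>2 * E * y ^ 4" by (simp add: power2_eq_square power_numeral_reduce)
    finally have 1: "norm (w1 * w2 * Y * e1) \<le> R\<^sup>2 * E * y ^ 4" .
    have "norm (w1 * Y * e3) \<le> R * y * (E * y ^ 3)"
      unfolding norm_mult nY using R R0 y e3 by (intro mult_mono) auto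
    moreover have "norm (e2 * (w2 * Y)) \<le> (E * y ^ 3) * (R * y)"
      unfolding norm_mult nY using R R0 y e2 E0 by (intro mult_mono) auto
    moreover have "norm (e2 * e3) \<le> (E * y ^ 3) * (E * y ^ 3)"
      unfolding norm_mult using e2 e3 E0 y by (intro mult_mono) auto
    ultimately have "norm (w1 * Y * e3 + e2 * (w2 * Y) + e2 * e3)
        \<le> R * y * (E * y ^ 3) + (E * y ^ 3) * (R * y) + (E * y ^ 3) * (E * y ^ 3)"
      by (intro order_trans[OF norm_triangle_ineq] add_mono)
    also have "\<dots> = 2 * R * E * y ^ 4 + E\<^sup>2 * y ^ 6"
      by (simp add: power2_eq_square power_numeral_reduce)
    also have "\<dots> \<le> (2 * R * E + E\<^sup>2) * y ^ 4"
      using y6 mult_left_mono[OF y6, of "E\<^sup>2"] by (simp add: algebra_simps)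
    finally have "norm (2 * z * (w1 * Y * e3 + e2 * (w2 * Y) + e2 * e3))
        \<le> 2 * R * ((2 * R * E + E\<^sup>2) * y ^ 4)"
      unfolding norm_mult[of "2 * z"] using R(3) R0 by (intro mult_mono) (auto simp: norm_mult)
    with 1 have "norm ?num \<le> R\<^sup>2 * E * y ^ 4 + 2 * R * ((2 * R * E + E\<^sup>2) * y ^ 4)"
      by (intro order_trans[OF norm_triangle_ineq4] add_mono)
    then show ?thesis by (simp add: algebra_simps)
  qed
  moreover have "\<alpha> ^ 4 * y ^ 4 / 2 \<le> norm ?den"
  proof -
    have "\<alpha> * y / 2 \<le> norm (sinh (w * Y))" if "\<alpha> \<le> Re w" for w
    proof -
      have "\<alpha> * y / 2 \<le> Re (w * Y) / 2" using that y by (simp add: Y_def)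
      also have "\<dots> \<le> norm (sinh (w * Y))" using that a(1) y by (intro norm_sinh_ge(2)) (simp add: Y_def)
      finally show ?thesis .
    qed
    with a have "2 * \<alpha> * \<alpha> * y * (\<alpha> * y / 2) * (\<alpha> * y / 2) * y \<le> norm ?den"
      unfolding norm_mult nY using rw y by (intro mult_mono) auto
    then show ?thesis by (simp add: power_numeral_reduce mult_ac)
  qed
  moreover have "\<alpha> ^ 4 * y ^ 4 / 2 > 0" using a y by simp
  moreover have "0 \<le> (R\<^sup>2 * E + 2 * R * (2 * R * E + E\<^sup>2)) * y ^ 4" using R0 E0 y by simp
  ultimately have "norm (gamma_kernel w1 w2 z y)
      \<le> ((R\<^sup>2 * E + 2 * R * (2 * R * E + E\<^sup>2)) * y ^ 4) / (\<alpha> ^ 4 * y ^ 4 / 2)"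
    unfolding norm_divide by (metis (no_types, lifting) frac_le norm_divide)
  also have "\<dots> = 2 * (R\<^sup>2 * E + 2 * R * (2 * R * E + E\<^sup>2)) / \<alpha> ^ 4" using y by simp
  finally show ?thesis .
qed

text \<open>The sine grows at most like exp (2 y |Im z|), the sinh product at least like exp ((Re w1
  + Re w2) y); the margin \<open>d\<close> leaves exp (-2 d y) \<le> 1 / (2 d y). Both terms thus
  decay like 1 / y, and the outer division by y supplies the square.\<close>

lemma gamma_kernel_bound_large:
  assumes a: "\<alpha> > 0" "Re w1 \<ge> \<alpha>" "Re w2 \<ge> \<alpha>" and R: "norm z \<le> R"
    and d: "d > 0" "\<bar>Im z\<bar> + d \<le> Re ((w1 + w2) / 2)" and y: "1 \<le> y"
  shows "norm (gamma_kernel w1 w2 z y) \<le> (1 / (4 * d * (\<alpha> / (1 + 2 * \<alpha>))\<^sup>2) + R / \<alpha>\<^sup>2) / y\<^sup>2"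
proof -
  have R0: "R \<ge> 0" using R norm_ge_zero order_trans by blast
  \<comment> \<open>The function r / (1 + 2 r) increases, and Re w y \<ge> \<alpha> for y \<ge> 1,
    so \<open>m\<close> bounds the rational factor of \<open>norm_sinh_ge\<close> from
    below.\<close>
  define m where "m = \<alpha> / (1 + 2 * \<alpha>)"
  have m: "m > 0" using a by (simp add: m_def)
  define Y where "Y = complex_of_real y"
  have nY: "norm Y = y" using y by (simp add: Y_def)
  have rw: "\<alpha> \<le> norm w1" "\<alpha> \<le> norm w2" using a complex_Re_le_cmod order_trans by blast+
  have sh: "m * exp (Re w * y) \<le> norm (sinh (w * Y))" if "\<alpha> \<le> Re w" for w
  proof -
    have "\<alpha> \<le> Re w * y" using mult_mono[OF that y] a that by simp
    then have "m \<le> Re w * y / (1 + 2 * (Re w * y))"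
      using a unfolding m_def by (simp add: divide_simps) (simp add: algebra_simps)
    then have "m * exp (Re w * y) \<le> exp (Re w * y) * (Re w * y / (1 + 2 * (Re w * y)))"
      unfolding mult.commute[of m] by (intro mult_left_mono) auto
    also have "\<dots> \<le> norm (sinh (w * Y))"
      using norm_sinh_ge(1)[of "w * Y"] that a y by (simp add: Y_def)
    finally show ?thesis .
  qed
  let ?t1 = "sin (2 * Y * z) / (2 * sinh (w1 * Y) * sinh (w2 * Y))" and ?t2 = "z / (w1 * w2 * Y)"
  have "norm ?t1 \<le> exp (2 * y * \<bar>Im z\<bar>) / (2 * (m * exp (Re w1 * y)) * (m * exp (Re w2 * y)))"
    unfolding norm_divide
  proof (rule frac_le)
    show "norm (sin (2 * Y * z)) \<le> exp (2 * y * \<bar>Im z\<bar>)"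
      using norm_sin_le_exp[of "2 * Y * z"] y by (simp add: Y_def abs_mult)
    show "2 * (m * exp (Re w1 * y)) * (m * exp (Re w2 * y)) \<le> norm (2 * sinh (w1 * Y) * sinh (w2 * Y))"
      unfolding norm_mult using sh a m by (intro mult_mono) auto
  qed (use m in auto)
  also have "\<dots> = exp (2 * y * \<bar>Im z\<bar> - (Re w1 * y + Re w2 * y)) / (2 * m\<^sup>2)"
    by (simp add: exp_diff exp_add power2_eq_square)
  also have "\<dots> \<le> exp (- (2 * d * y)) / (2 * m\<^sup>2)"
  proof -
    have "2 * (\<bar>Im z\<bar> + d) \<le> Re w1 + Re w2" using d(2) by simp
    from mult_right_mono[OF this, of y] y
    have "2 * y * \<bar>Im z\<bar> - (Re w1 * y + Re w2 * y) \<le> - (2 * d * y)" by (simp add: algebra_simps)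
    then show ?thesis by (intro divide_right_mono) auto
  qed
  also have "\<dots> \<le> (1 / (2 * d * y)) / (2 * m\<^sup>2)"
  proof (rule divide_right_mono)
    have "2 * d * y \<le> exp (2 * d * y)" using exp_ge_add_one_self[of "2 * d * y"] by linarith
    then show "exp (- (2 * d * y)) \<le> 1 / (2 * d * y)"
      using d y by (simp add: exp_minus divide_simps)
  qed simp
  finally have 1: "norm ?t1 \<le> 1 / (4 * d * m\<^sup>2) / y" by (simp add: mult_ac)
  have "norm ?t2 \<le> R / (\<alpha> * \<alpha> * y)"
    unfolding norm_divide norm_mult nY using R R0 rw a y by (intro frac_le mult_mono) auto
  then have 2: "norm ?t2 \<le> R / \<alpha>\<^sup>2 / y" by (simp add: power2_eq_square)
  have "norm (gamma_kernel w1 w2 z y) = norm (?t1 - ?t2) / y"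
    by (simp add: gamma_kernel_def Y_def[symmetric] norm_divide nY)
  also have "\<dots> \<le> (1 / (4 * d * m\<^sup>2) / y + R / \<alpha>\<^sup>2 / y) / y"
    using 1 2 y by (intro divide_right_mono order_trans[OF norm_triangle_ineq4] add_mono) auto
  also have "\<dots> = (1 / (4 * d * m\<^sup>2) + R / \<alpha>\<^sup>2) / y\<^sup>2"
    by (simp add: add_divide_distrib power2_eq_square)
  finally show ?thesis by (simp add: m_def)
qed

text \<open>\<open>C\<close> depends on \<open>\<alpha>\<close>, \<open>d\<close> and
  \<open>R\<close> alone; holomorphic dependence on \<open>w1\<close>, \<open>w2\<close> and
  \<open>z\<close> jointly rests on this uniformity. The factor 2 in the constant comes from 1 + y^2
  \<le> 2 for y \<le> 1 and 1 + y^2 \<le> 2 y^2 beyond.\<close>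

lemma gamma_kernel_bound:
  assumes "\<alpha> > 0" "d > 0"
  shows "\<exists>C. \<forall>w1 w2 z y. \<alpha> \<le> Re w1 \<longrightarrow> \<alpha> \<le> Re w2 \<longrightarrow> norm w1 \<le> R \<longrightarrow> norm w2 \<le> R \<longrightarrow> norm z \<le> R
    \<longrightarrow> \<bar>Im z\<bar> + d \<le> Re ((w1 + w2) / 2) \<longrightarrow> y > 0 \<longrightarrow> norm (gamma_kernel w1 w2 z y) \<le> C / (1 + y\<^sup>2)"
proof -
  define E where "E = exp (2 * R) * (2 * R) ^ 3 / 2"
  define C1 where "C1 = 2 * (R\<^sup>2 * E + 2 * R * (2 * R * E + E\<^sup>2)) / \<alpha> ^ 4"
  define C2 where "C2 = 1 / (4 * d * (\<alpha> / (1 + 2 * \<alpha>))\<^sup>2) + R / \<alpha>\<^sup>2"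
  have "norm (gamma_kernel w1 w2 z y) \<le> (2 * max C1 C2) / (1 + y\<^sup>2)"
    if *: "\<alpha> \<le> Re w1" "\<alpha> \<le> Re w2" "norm w1 \<le> R" "norm w2 \<le> R" "norm z \<le> R"
      "\<bar>Im z\<bar> + d \<le> Re ((w1 + w2) / 2)" "y > 0" for w1 w2 z y
  proof (cases "y \<le> 1")
    case True
    have "y\<^sup>2 \<le> 1" using True that by (simp add: power_le_one)
    have 1: "norm (gamma_kernel w1 w2 z y) \<le> C1"
      unfolding C1_def using gamma_kernel_bound_small[OF assms(1) *(1-5,7) True E_def] .
    then have "0 \<le> C1" using norm_ge_zero order_trans by blast
    then have "C1 * (1 + y\<^sup>2) \<le> C1 * 2" using \<open>y\<^sup>2 \<le> 1\<close> by (intro mult_left_mono) auto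
    then have "C1 \<le> (2 * max C1 C2) / (1 + y\<^sup>2)"
      by (simp add: pos_le_divide_eq add_pos_nonneg)
    with 1 show ?thesis by linarith
  next
    case False
    then have y: "1 \<le> y" "1 \<le> y\<^sup>2" by (auto intro: one_le_power)
    have 1: "norm (gamma_kernel w1 w2 z y) \<le> C2 / y\<^sup>2"
      unfolding C2_def using gamma_kernel_bound_large[OF assms(1) *(1,2,5) assms(2) *(6) y(1)] .
    then have "0 \<le> C2 / y\<^sup>2" using norm_ge_zero order_trans by blast
    then have "0 \<le> C2" using y by (simp add: zero_le_divide_iff)
    then have "C2 * (1 + y\<^sup>2) \<le> C2 * (2 * y\<^sup>2)" using y by (intro mult_left_mono) auto
    also have "\<dots> \<le> max C1 C2 * (2 * y\<^sup>2)" by (intro mult_right_mono) auto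
    finally have "C2 / y\<^sup>2 \<le> (2 * max C1 C2) / (1 + y\<^sup>2)"
      using y by (simp add: divide_simps add_pos_nonneg)
    with 1 show ?thesis by linarith
  qed
  then show ?thesis by blast
qed

lemma continuous_on_gamma_kernel:
  assumes "Re w1 > 0" "Re w2 > 0"
  shows "continuous_on {0<..} (gamma_kernel w1 w2 z)"
  unfolding gamma_kernel_def
  by (intro continuous_intros) (use assms in \<open>auto intro!: sinh_nonzero\<close>)

lemma set_integrable_gamma_kernel:
  assumes "Re w1 > 0" "Re w2 > 0" "\<bar>Im z\<bar> < Re ((w1 + w2) / 2)"
  shows "set_integrable lborel {0<..} (gamma_kernel w1 w2 z)"
proof -
  define d where "d = Re ((w1 + w2) / 2) - \<bar>Im z\<bar>"
  define \<alpha> where "\<alpha> = min (Re w1) (Re w2)"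
  define R where "R = Max {norm w1, norm w2, norm z}"
  have "\<alpha> > 0" "d > 0" using assms by (auto simp: \<alpha>_def d_def)
  then obtain C where C: "\<And>a b z y. \<alpha> \<le> Re a \<Longrightarrow> \<alpha> \<le> Re b \<Longrightarrow> norm a \<le> R \<Longrightarrow> norm b \<le> R \<Longrightarrow>
      norm z \<le> R \<Longrightarrow> \<bar>Im z\<bar> + d \<le> Re ((a + b) / 2) \<Longrightarrow> y > 0 \<Longrightarrow>
      norm (gamma_kernel a b z y) \<le> C / (1 + y\<^sup>2)"
    using gamma_kernel_bound[of \<alpha> d R] by blast
  have "norm (gamma_kernel w1 w2 z y) \<le> C / (1 + y\<^sup>2)" if "y > 0" for y
    by (rule C) (use that in \<open>auto simp: \<alpha>_def d_def R_def\<close>)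
  then show ?thesis
    using assms by (intro set_integrable_positive_dominated continuous_on_gamma_kernel)
qed

section \<open>Differentiation under the integral sign\<close>

text \<open>Dominated convergence for difference quotients: \<open>B\<close> dominates the
  quotients, and \<open>D y v\<close>, as their pointwise limit, inherits measurability and the
  bound \<open>B y * norm v\<close>.\<close>

lemma has_derivative_integral:
  fixes F :: "'a::real_normed_vector \<Rightarrow> 'b \<Rightarrow> complex"
  assumes r: "r > 0"
    and int: "\<And>x. x \<in> ball p r \<Longrightarrow> integrable M (F x)"
    and der: "\<And>y. y \<in> space M \<Longrightarrow> ((\<lambda>x. F x y) has_derivative D y) (at p)"
    and lip: "\<And>x y. x \<in> ball p r \<Longrightarrow> y \<in> space M \<Longrightarrow> norm (F x y - F p y) \<le> B y * norm (x - p)"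
    and B: "integrable M B"
  shows "\<And>v. integrable M (\<lambda>y. D y v)"
    and "((\<lambda>x. \<integral>y. F x y \<partial>M) has_derivative (\<lambda>v. \<integral>y. D y v \<partial>M)) (at p)"
proof -
  have lin: "bounded_linear (D y)" if "y \<in> space M" for y
    using der[OF that] by (rule has_derivative_bounded_linear)
  have D: "integrable M (\<lambda>y. D y v)" "\<forall>y\<in>space M. norm (D y v) \<le> B y * norm v" for v
  proof -
    \<comment> \<open>\<open>N\<close> is so large that every increment v / m n, also the one for n
      = 0, is shorter than \<open>r\<close>.\<close>
    obtain N :: nat where N: "norm v / r < real N" using reals_Archimedean2 by blast
    define m where "m n = real (n + N + 1)" for n
    have m: "m n > 0" for n by (simp add: m_def)
    have "norm v < r * m n" for n
    proof -
      have "norm v < r * real N" using N r by (simp add: field_simps)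
      also have "\<dots> \<le> r * m n" using r by (intro mult_left_mono) (auto simp: m_def)
      finally show ?thesis .
    qed
    then have inb: "p + (1 / m n) *\<^sub>R v \<in> ball p r" for n
      using m[of n] by (simp add: dist_norm pos_divide_less_eq)
    have lim0: "(\<lambda>n. p + (1 / m n) *\<^sub>R v) \<longlonglongrightarrow> p"
    proof -
      have "(\<lambda>n. 1 / m n) \<longlonglongrightarrow> 0"
        using LIMSEQ_ignore_initial_segment[OF LIMSEQ_inverse_real_of_nat, of N]
        by (simp add: m_def inverse_eq_divide add_ac)
      then have "(\<lambda>n. p + (1 / m n) *\<^sub>R v) \<longlonglongrightarrow> p + 0 *\<^sub>R v" by (intro tendsto_intros)
      then show ?thesis by simp
    qed
    have quot: "(\<lambda>n. m n *\<^sub>R (F (p + (1 / m n) *\<^sub>R v) y - F p y)) \<longlonglongrightarrow> D y v"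
      if y: "y \<in> space M" for y
    \<comment> \<open>For v = 0 the sequence stays at \<open>p\<close>, so limits along the
      punctured filter \<open>at p\<close> do not apply to it.\<close>
    proof (cases "v = 0")
      case True
      then show ?thesis using lin[OF y] by (simp add: linear_simps)
    next
      case False
      have "((\<lambda>x. norm (F x y - F p y - D y (x - p)) / norm (x - p)) \<longlongrightarrow> 0) (at p)"
        using der[OF y] by (simp add: has_derivative_iff_norm)
      moreover have "filterlim (\<lambda>n. p + (1 / m n) *\<^sub>R v) (at p) sequentially"
        unfolding filterlim_at using lim0 False m by (auto simp: less_imp_neq[symmetric])
      ultimately have "(\<lambda>n. norm (F (p + (1 / m n) *\<^sub>R v) y - F p y - D y (p + (1 / m n) *\<^sub>R v - p))
          / norm (p + (1 / m n) *\<^sub>R v - p)) \<longlonglongrightarrow> 0"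
        by (rule filterlim_compose)
      from tendsto_mult_right[OF this, of "norm v"]
      have "(\<lambda>n. norm (F (p + (1 / m n) *\<^sub>R v) y - F p y - D y (p + (1 / m n) *\<^sub>R v - p))
          / norm (p + (1 / m n) *\<^sub>R v - p) * norm v) \<longlonglongrightarrow> 0" by simp
      moreover have "norm (F (p + (1 / m n) *\<^sub>R v) y - F p y - D y (p + (1 / m n) *\<^sub>R v - p))
          / norm (p + (1 / m n) *\<^sub>R v - p) * norm v
          = norm (m n *\<^sub>R (F (p + (1 / m n) *\<^sub>R v) y - F p y) - D y v)" for n
      proof -
        have "D y (p + (1 / m n) *\<^sub>R v - p) = (1 / m n) *\<^sub>R D y v"
          using lin[OF y] by (simp add: linear_simps)
        then have "m n *\<^sub>R (F (p + (1 / m n) *\<^sub>R v) y - F p y) - D y v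
            = m n *\<^sub>R (F (p + (1 / m n) *\<^sub>R v) y - F p y - D y (p + (1 / m n) *\<^sub>R v - p))"
          using m[of n] by (simp add: scaleR_diff_right)
        then show ?thesis using m[of n] False by simp
      qed
      ultimately have "(\<lambda>n. norm (m n *\<^sub>R (F (p + (1 / m n) *\<^sub>R v) y - F p y) - D y v)) \<longlonglongrightarrow> 0"
        by simp
      then show ?thesis using LIM_zero_cancel tendsto_norm_zero_iff by blast
    qed
    have nb: "norm (m n *\<^sub>R (F (p + (1 / m n) *\<^sub>R v) y - F p y)) \<le> B y * norm v"
      if y: "y \<in> space M" for n y
      using lip[OF inb y, of n] m[of n] unfolding norm_scaleR by (simp add: field_simps)
    have pB: "p \<in> ball p r" using r by simp
    show "integrable M (\<lambda>y. D y v)"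
    proof (rule integrable_dominated_convergence)
      show "(\<lambda>y. D y v) \<in> borel_measurable M"
      proof (rule borel_measurable_LIMSEQ_metric[OF _ quot])
        show "(\<lambda>y. m n *\<^sub>R (F (p + (1 / m n) *\<^sub>R v) y - F p y)) \<in> borel_measurable M" for n
          using int[OF inb] int[OF pB] by (intro borel_measurable_integrable) auto
      qed
      show "(\<lambda>y. m n *\<^sub>R (F (p + (1 / m n) *\<^sub>R v) y - F p y)) \<in> borel_measurable M" for n
        using int[OF inb] int[OF pB] by (intro borel_measurable_integrable) auto
      show "integrable M (\<lambda>y. B y * norm v)" using B by simp
    qed (auto intro!: AE_I2 quot nb simp del: norm_scaleR)
    show "\<forall>y\<in>space M. norm (D y v) \<le> B y * norm v"
      using Lim_bounded[OF tendsto_norm[OF quot]] nb by blast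
  qed
  show "integrable M (\<lambda>y. D y v)" for v by (rule D(1))
  show "((\<lambda>x. \<integral>y. F x y \<partial>M) has_derivative (\<lambda>v. \<integral>y. D y v \<partial>M)) (at p)"
    unfolding has_derivative_iff_norm
  proof
    show "bounded_linear (\<lambda>v. \<integral>y. D y v \<partial>M)"
    proof (rule bounded_linear_intro)
      show "(\<integral>y. D y (u + v) \<partial>M) = (\<integral>y. D y u \<partial>M) + (\<integral>y. D y v \<partial>M)" for u v
        using lin by (subst Bochner_Integration.integral_add[symmetric])
          (auto intro!: D(1) Bochner_Integration.integral_cong simp: linear_simps)
      show "(\<integral>y. D y (c *\<^sub>R v) \<partial>M) = c *\<^sub>R (\<integral>y. D y v \<partial>M)" for c v
        using lin by (subst integral_scaleR_right[symmetric])
          (auto intro!: D(1) Bochner_Integration.integral_cong simp: linear_simps simp del: integral_scaleR_right)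
      show "norm (\<integral>y. D y v \<partial>M) \<le> norm v * (\<integral>y. B y \<partial>M)" for v
      proof -
        have "norm (\<integral>y. D y v \<partial>M) \<le> (\<integral>y. norm (D y v) \<partial>M)" by (rule integral_norm_bound)
        also have "\<dots> \<le> (\<integral>y. B y * norm v \<partial>M)"
          using D B by (intro integral_mono) auto
        finally show ?thesis by (simp add: mult.commute)
      qed
    qed
    show "((\<lambda>x. norm ((\<integral>y. F x y \<partial>M) - (\<integral>y. F p y \<partial>M) - (\<integral>y. D y (x - p) \<partial>M)) / norm (x - p)) \<longlongrightarrow> 0) (at p)"
      unfolding tendsto_at_iff_sequentially
    proof (intro allI impI)
      fix X :: "nat \<Rightarrow> 'a"
      assume X: "\<forall>i. X i \<in> UNIV - {p}" and lim: "X \<longlonglongrightarrow> p"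
      have "eventually (\<lambda>i. X i \<in> ball p r) sequentially"
        using topological_tendstoD[OF lim open_ball] r by simp
      then obtain N where N: "\<And>i. i \<ge> N \<Longrightarrow> X i \<in> ball p r" by (auto simp: eventually_sequentially)
      define Y where "Y i = X (i + N)" for i
      have Y: "Y i \<in> ball p r" "Y i \<noteq> p" for i using N X by (auto simp: Y_def simp del: mem_ball)
      have Ylim: "filterlim Y (at p) sequentially"
        unfolding filterlim_at using LIMSEQ_ignore_initial_segment[OF lim, of N] Y
        by (auto simp: Y_def[abs_def])
      let ?G = "\<lambda>i y. (F (Y i) y - F p y - D y (Y i - p)) /\<^sub>R norm (Y i - p)"
      have pB: "p \<in> ball p r" using r by simp
      have Gint: "integrable M (?G i)" for i
        using int[OF Y(1)] int[OF pB] D(1) by (intro integrable_scaleR_right) auto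
      have lim_G: "(\<lambda>i. \<integral>y. ?G i y \<partial>M) \<longlonglongrightarrow> (\<integral>y. 0 \<partial>M)"
      proof (rule integral_dominated_convergence[where w = "\<lambda>y. 2 * B y"])
        show "AE y in M. (\<lambda>i. ?G i y) \<longlonglongrightarrow> 0"
        proof (rule AE_I2)
          fix y assume y: "y \<in> space M"
          have "((\<lambda>x. norm (F x y - F p y - D y (x - p)) / norm (x - p)) \<longlongrightarrow> 0) (at p)"
            using der[OF y] by (simp add: has_derivative_iff_norm)
          from filterlim_compose[OF this Ylim] have "(\<lambda>i. norm (?G i y)) \<longlonglongrightarrow> 0"
            by (simp add: divide_inverse mult.commute)
          then show "(\<lambda>i. ?G i y) \<longlonglongrightarrow> 0" by (rule tendsto_norm_zero_cancel)
        qed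
        \<comment> \<open>One \<open>B y\<close> bounds the increment of \<open>F\<close>, the other
          the linear term.\<close>
        show "AE y in M. norm (?G i y) \<le> 2 * B y" for i
        proof (rule AE_I2)
          fix y assume y: "y \<in> space M"
          have "norm (F (Y i) y - F p y - D y (Y i - p)) \<le> B y * norm (Y i - p) + B y * norm (Y i - p)"
            using norm_triangle_ineq4[of "F (Y i) y - F p y" "D y (Y i - p)"] lip[OF Y(1) y, of i]
              D(2)[of "Y i - p"] y by force
          then show "norm (?G i y) \<le> 2 * B y"
            unfolding norm_scaleR using Y(2)[of i] by (simp add: field_simps)
        qed
        show "integrable M (\<lambda>y. 2 * B y)" using B by simp
      qed (use Gint in auto)
      have eq_G: "(\<integral>y. ?G i y \<partial>M)
          = ((\<integral>y. F (Y i) y \<partial>M) - (\<integral>y. F p y \<partial>M) - (\<integral>y. D y (Y i - p) \<partial>M)) /\<^sub>R norm (Y i - p)" for i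
        using int[OF Y(1)] int[OF pB] D(1) by simp
      from lim_G have "(\<lambda>i. ((\<integral>y. F (Y i) y \<partial>M) - (\<integral>y. F p y \<partial>M) - (\<integral>y. D y (Y i - p) \<partial>M))
          /\<^sub>R norm (Y i - p)) \<longlonglongrightarrow> 0"
        unfolding eq_G by (simp only: integral_zero)
      then have "(\<lambda>i. norm (((\<integral>y. F (Y i) y \<partial>M) - (\<integral>y. F p y \<partial>M) - (\<integral>y. D y (Y i - p) \<partial>M))
          /\<^sub>R norm (Y i - p))) \<longlonglongrightarrow> 0"
        by (rule tendsto_norm_zero)
      then have "(\<lambda>i. ((\<lambda>x. norm ((\<integral>y. F x y \<partial>M) - (\<integral>y. F p y \<partial>M) - (\<integral>y. D y (x - p) \<partial>M)) / norm (x - p)) \<circ> X) (i + N)) \<longlonglongrightarrow> 0"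
        by (simp add: Y_def o_def divide_inverse mult.commute)
      then show "((\<lambda>x. norm ((\<integral>y. F x y \<partial>M) - (\<integral>y. F p y \<partial>M) - (\<integral>y. D y (x - p) \<partial>M)) / norm (x - p)) \<circ> X) \<longlonglongrightarrow> 0"
        by (rule LIMSEQ_offset)
    qed
  qed
qed

section \<open>The integral for the hyperbolic cosine\<close>

definition cosh_kernel :: "complex \<Rightarrow> complex \<Rightarrow> real \<Rightarrow> complex" where
  "cosh_kernel w u y = (cos (2 * of_real y * u) / sinh (w * of_real y) - 1 / (w * of_real y)) / of_real y"

text \<open>Minus the \<open>u\<close>-derivative of \<open>cosh_kernel\<close>: differentiating the
  cosine produces a factor y that cancels the outer 1 / y, and the term 1 / (w y) drops out.\<close>

definition tanh_kernel :: "complex \<Rightarrow> complex \<Rightarrow> real \<Rightarrow> complex" where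
  "tanh_kernel w u y = 2 * sin (2 * of_real y * u) / sinh (w * of_real y)"

text \<open>By the addition theorem the two sines differ by 2 i cos (2 y u) sinh (a y), and the
  factor sinh (a y) cancels against the denominator; the linear terms differ by i a, where a cancels
  too. Hence nothing on the right depends on \<open>a\<close>.\<close>

lemma gamma_kernel_shift:
  assumes "Re a > 0" "Re w > 0" "y > 0"
  shows "gamma_kernel a w (u + \<i> * a / 2) y - gamma_kernel a w (u - \<i> * a / 2) y = \<i> * cosh_kernel w u y"
proof -
  define Y where "Y = complex_of_real y"
  have nz: "sinh (a * Y) \<noteq> 0" "sinh (w * Y) \<noteq> 0" "a \<noteq> 0" "w \<noteq> 0" "Y \<noteq> 0"
    using assms by (auto simp: Y_def intro!: sinh_nonzero)
  have 1: "sin (2 * Y * (u + \<i> * a / 2)) - sin (2 * Y * (u - \<i> * a / 2)) = 2 * \<i> * cos (2 * Y * u) * sinh (a * Y)"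
    by (simp add: algebra_simps sin_add sin_diff sinh_conv_sin)
  have "gamma_kernel a w (u + \<i> * a / 2) y - gamma_kernel a w (u - \<i> * a / 2) y
      = ((sin (2 * Y * (u + \<i> * a / 2)) - sin (2 * Y * (u - \<i> * a / 2))) / (2 * sinh (a * Y) * sinh (w * Y))
         - \<i> * a / (a * w * Y)) / Y"
    unfolding gamma_kernel_def Y_def[symmetric] by (simp add: diff_divide_distrib add_divide_distrib)
  also have "\<dots> = \<i> * cosh_kernel w u y"
    unfolding 1 cosh_kernel_def Y_def[symmetric] using nz by (simp add: right_diff_distrib)
  finally show ?thesis .
qed

text \<open>With both parameters of \<open>gamma_kernel\<close> equal to \<open>w\<close>, the
  kernel is a difference of two gamma kernels at u + i w / 2 and u - i w / 2, which lie in the strip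
  of half-width Re w.\<close>

lemma set_integrable_cosh_kernel:
  assumes "Re w > 0" "\<bar>Im u\<bar> < Re w / 2"
  shows "set_integrable lborel {0<..} (cosh_kernel w u)"
proof -
  have "set_integrable lborel {0<..} (\<lambda>y. - \<i> * (gamma_kernel w w (u + \<i> * w / 2) y - gamma_kernel w w (u - \<i> * w / 2) y))"
    using assms by (intro set_integrable_mult_right set_integral_diff set_integrable_gamma_kernel) auto
  then show ?thesis
    by (rule set_integrable_cong[THEN iffD1, rotated -1]) (use assms in \<open>auto simp: gamma_kernel_shift\<close>)
qed

text \<open>The bound for the sine retains its zero at y = 0, which cancels that of sinh. What
  remains is (1 + 2 r y) exp (-\<delta> y) with r = Re w, the case c = 2 r of
  \<open>poly_exp_bound\<close>.\<close>

lemma tanh_kernel_bound: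
  assumes "Re w > 0" "\<delta> > 0" "2 * \<bar>Im u\<bar> + \<delta> \<le> Re w" "norm u \<le> R" "y > 0"
  shows "norm (tanh_kernel w u y) \<le> 4 * R / Re w * ((1 + 2 * Re w) * (1 + 3 / \<delta>) ^ 3) / (1 + y\<^sup>2)"
proof -
  define Y where "Y = complex_of_real y"
  define r where "r = Re w"
  have nY: "norm Y = y" using assms by (simp add: Y_def)
  have R0: "R \<ge> 0" using assms(4) norm_ge_zero order_trans by blast
  have r0: "r > 0" using assms by (simp add: r_def)
  have "norm (2 * sin (2 * Y * u)) \<le> 2 * (exp (2 * y * \<bar>Im u\<bar>) * (2 * y * R))"
  proof -
    have "norm (sin (2 * Y * u)) \<le> exp \<bar>Im (2 * Y * u)\<bar> * norm (2 * Y * u)" by (rule norm_sin_le_linear)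
    also have "\<dots> \<le> exp (2 * y * \<bar>Im u\<bar>) * (2 * y * R)"
      using assms by (intro mult_mono) (auto simp: Y_def abs_mult norm_mult)
    finally show ?thesis by (simp add: norm_mult mult_ac)
  qed
  moreover have "exp (r * y) * (r * y / (1 + 2 * (r * y))) \<le> norm (sinh (w * Y))"
    using norm_sinh_ge(1)[of "w * Y"] assms by (simp add: Y_def r_def)
  moreover have "exp (r * y) * (r * y / (1 + 2 * (r * y))) > 0"
    using r0 assms by (intro mult_pos_pos divide_pos_pos add_pos_pos) auto
  ultimately have "norm (tanh_kernel w u y)
      \<le> 2 * (exp (2 * y * \<bar>Im u\<bar>) * (2 * y * R)) / (exp (r * y) * (r * y / (1 + 2 * (r * y))))"
    unfolding tanh_kernel_def Y_def[symmetric] norm_divide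
    by (intro frac_le) (use R0 assms in auto)
  also have "\<dots> = 4 * R / r * ((1 + 2 * r * y) * exp (2 * y * \<bar>Im u\<bar> - r * y))"
    using r0 assms by (simp add: exp_diff field_simps)
  also have "\<dots> \<le> 4 * R / r * ((1 + 2 * r * y) * exp (- (\<delta> * y)))"
  proof -
    have "2 * y * \<bar>Im u\<bar> - r * y \<le> - (\<delta> * y)"
      using mult_right_mono[OF assms(3), of y] assms by (simp add: r_def algebra_simps)
    then show ?thesis using r0 R0 assms by (intro mult_left_mono) auto
  qed
  also have "\<dots> \<le> 4 * R / r * ((1 + 2 * r) * (1 + 3 / \<delta>) ^ 3 / (1 + y\<^sup>2))"
    using r0 R0 assms by (intro mult_left_mono poly_exp_bound) auto
  finally show ?thesis by (simp add: r_def)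
qed

lemma continuous_on_tanh_kernel:
  assumes "Re w > 0" shows "continuous_on {0<..} (tanh_kernel w u)"
  unfolding tanh_kernel_def by (intro continuous_intros) (use assms in \<open>auto intro!: sinh_nonzero\<close>)

lemma set_integrable_tanh_kernel:
  assumes "Re w > 0" "\<bar>Im u\<bar> < Re w / 2"
  shows "set_integrable lborel {0<..} (tanh_kernel w u)"
  by (rule set_integrable_positive_dominated[OF continuous_on_tanh_kernel[OF assms(1)]
        tanh_kernel_bound[OF assms(1), of "Re w - 2 * \<bar>Im u\<bar>" u "norm u"]])
     (use assms in auto)

lemma cosh_integral_derivative:
  assumes w: "Re w > 0" and u: "\<bar>Im u\<bar> < Re w / 2"
  shows "((\<lambda>u. LINT y:{0<..}|lborel. cosh_kernel w u y) has_field_derivative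
           - (LINT y:{0<..}|lborel. tanh_kernel w u y)) (at u)"
proof -
  \<comment> \<open>Half of the gap Re w - 2 |Im u|: on the ball of radius \<delta> / 2 twice the
    imaginary part moves by at most \<delta>, so a gap of \<delta> remains.\<close>
  define \<delta> where "\<delta> = (Re w - 2 * \<bar>Im u\<bar>) / 2"
  have \<delta>: "\<delta> > 0" using u by (simp add: \<delta>_def)
  define R where "R = norm u + \<delta> / 2"
  have near: "2 * \<bar>Im x\<bar> + \<delta> \<le> Re w" "norm x \<le> R" if "x \<in> ball u (\<delta> / 2)" for x
  proof -
    have n: "norm (x - u) < \<delta> / 2" using that by (simp add: dist_norm norm_minus_commute)
    have "\<bar>Im x\<bar> \<le> \<bar>Im u\<bar> + \<bar>Im (x - u)\<bar>" by simp
    also have "\<dots> \<le> \<bar>Im u\<bar> + \<delta> / 2" using n abs_Im_le_cmod[of "x - u"] by linarith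
    finally have "\<bar>Im x\<bar> \<le> \<bar>Im u\<bar> + \<delta> / 2" .
    moreover have "Re w = 2 * \<bar>Im u\<bar> + 2 * \<delta>" by (simp add: \<delta>_def field_simps)
    ultimately show "2 * \<bar>Im x\<bar> + \<delta> \<le> Re w" using \<delta> by linarith
    show "norm x \<le> R" using n norm_triangle_ineq2[of x u] by (simp add: R_def)
  qed
  define C where "C = 4 * R / Re w * ((1 + 2 * Re w) * (1 + 3 / \<delta>) ^ 3)"
  have der: "((\<lambda>u. cosh_kernel w u y) has_field_derivative - tanh_kernel w x y) (at x within A)" if "y > 0" for x y A
    using that sinh_nonzero[of "w * of_real y"] w unfolding cosh_kernel_def tanh_kernel_def
    by (auto intro!: derivative_eq_intros simp: field_simps)
  let ?F = "\<lambda>x y. indicator {0<..} y *\<^sub>R cosh_kernel w x y"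
  let ?D = "\<lambda>y v. indicator {0<..} y *\<^sub>R (- tanh_kernel w u y * v)"
  have "((\<lambda>x. \<integral>y. ?F x y \<partial>lborel) has_derivative (\<lambda>v. \<integral>y. ?D y v \<partial>lborel)) (at u)"
  proof (rule has_derivative_integral(2)[where r = "\<delta> / 2" and B = "\<lambda>y. indicator {0<..} y *\<^sub>R (C / (1 + y\<^sup>2))"])
    show "integrable lborel (?F x)" if "x \<in> ball u (\<delta> / 2)" for x
      using set_integrable_cosh_kernel[OF w, of x] near[OF that] \<delta> unfolding set_integrable_def by auto
    show "((\<lambda>x. ?F x y) has_derivative ?D y) (at u)" for y
    proof (cases "y > 0")
      case True
      have "(*) (- tanh_kernel w u y) = (\<lambda>v. - (tanh_kernel w u y * v))" by auto
      then show ?thesis using True der[of y u UNIV] by (simp add: has_field_derivative_def)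
    next
      case False
      then show ?thesis by simp
    qed
    show "norm (?F x y - ?F u y) \<le> indicator {0<..} y *\<^sub>R (C / (1 + y\<^sup>2)) * norm (x - u)"
      if "x \<in> ball u (\<delta> / 2)" for x y
    proof (cases "y > 0")
      case True
      have "norm (cosh_kernel w x y - cosh_kernel w u y) \<le> C / (1 + y\<^sup>2) * norm (x - u)"
      proof (rule field_differentiable_bound[OF convex_ball der[OF True]])
        show "norm (- tanh_kernel w z y) \<le> C / (1 + y\<^sup>2)" if "z \<in> ball u (\<delta> / 2)" for z
          using tanh_kernel_bound[OF w \<delta> near[OF that] True] by (simp add: C_def)
      qed (use that \<delta> in auto)
      then show ?thesis using True by simp
    qed simp
    show "integrable lborel (\<lambda>y. indicator {0<..} y *\<^sub>R (C / (1 + y\<^sup>2)))"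
      using set_integrable_inverse_square[of C] by (simp add: set_integrable_def)
  qed (use \<delta> in auto)
  moreover have "(\<lambda>v. \<integral>y. ?D y v \<partial>lborel) = (*) (- (LINT y:{0<..}|lborel. tanh_kernel w u y))"
  proof
    fix v
    have "(\<integral>y. ?D y v \<partial>lborel) = (LINT y:{0<..}|lborel. (- v) * tanh_kernel w u y)"
      by (simp add: set_lebesgue_integral_def mult.commute)
    then show "(\<integral>y. ?D y v \<partial>lborel) = - (LINT y:{0<..}|lborel. tanh_kernel w u y) * v"
      by (simp only: set_integral_mult_right) simp
  qed
  ultimately show ?thesis by (simp add: has_field_derivative_def set_lebesgue_integral_def)
qed

section \<open>Partial fractions of the hyperbolic tangent\<close>

lemma exp_integral:
  assumes "Re c > 0"
  shows "set_integrable lborel {0<..} (\<lambda>y::real. exp (- (c * of_real y)))"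
    and "(LINT y:{0<..}|lborel. exp (- (c * of_real y))) = 1 / c"
proof -
  show int: "set_integrable lborel {0<..} (\<lambda>y::real. exp (- (c * of_real y)))"
  proof (rule set_integrable_positive_dominated)
    fix y :: real assume "y > 0"
    then show "norm (exp (- (c * of_real y))) \<le> (1 + 0) * (1 + 3 / Re c) ^ 3 / (1 + y\<^sup>2)"
      using poly_exp_bound[of 0 "Re c" y] assms by simp
  qed (intro continuous_intros)
  have "(LBINT y=0..\<infinity>. exp (- (c * of_real y))) = 0 - (- 1 / c)"
  proof (rule interval_integral_FTC_integrable[where F = "\<lambda>y. - exp (- (c * of_real y)) / c"])
    show "((\<lambda>y. - exp (- (c * of_real y)) / c) has_vector_derivative exp (- (c * of_real x))) (at x)" for x
      using assms by (auto intro!: derivative_eq_intros has_vector_derivative_real_field simp: field_simps)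
    show "set_integrable lborel (einterval 0 \<infinity>) (\<lambda>y. exp (- (c * of_real y)))"
      using int by (simp add: zero_ereal_def)
    have "((\<lambda>y. - exp (- (c * of_real y)) / c) \<longlongrightarrow> - exp (- (c * of_real 0)) / c) (at_right 0)"
      using assms by (intro tendsto_intros) auto
    then show "(((\<lambda>y. - exp (- (c * of_real y)) / c) \<circ> real_of_ereal) \<longlongrightarrow> - 1 / c) (at_right 0)"
      unfolding zero_ereal_def ereal_tendsto_simps by simp
    have "norm c > 0" using assms by auto
    with assms have "((\<lambda>y. exp (- (Re c * y)) / norm c) \<longlongrightarrow> 0) at_top"
      by real_asymp
    then have "((\<lambda>y. norm (- exp (- (c * of_real y)) / c)) \<longlongrightarrow> 0) at_top"
      by (simp add: norm_divide)
    then show "(((\<lambda>y. - exp (- (c * of_real y)) / c) \<circ> real_of_ereal) \<longlongrightarrow> 0) (at_left \<infinity>)"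
      unfolding ereal_tendsto_simps by (rule tendsto_norm_zero_cancel)
  qed auto
  then show "(LINT y:{0<..}|lborel. exp (- (c * of_real y))) = 1 / c"
    by (simp add: interval_lebesgue_integral_0_infty)
qed

lemma sin_exp_integral:
  assumes "2 * \<bar>Im u\<bar> < Re a"
  shows "set_integrable lborel {0<..} (\<lambda>y::real. sin (2 * of_real y * u) * exp (- (a * of_real y)))"
    and "(LINT y:{0<..}|lborel. sin (2 * of_real y * u) * exp (- (a * of_real y))) = 2 * u / (a\<^sup>2 + 4 * u\<^sup>2)"
proof -
  have eq: "(\<lambda>y::real. sin (2 * of_real y * u) * exp (- (a * of_real y)))
      = (\<lambda>y. - \<i> / 2 * (exp (- ((a - 2 * \<i> * u) * of_real y)) - exp (- ((a + 2 * \<i> * u) * of_real y))))"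
    by (simp add: sin_exp_eq fun_eq_iff field_simps flip: exp_add)
  have re: "Re (a - 2 * \<i> * u) > 0" "Re (a + 2 * \<i> * u) > 0" using assms by auto
  show "set_integrable lborel {0<..} (\<lambda>y::real. sin (2 * of_real y * u) * exp (- (a * of_real y)))"
    unfolding eq using re by (intro set_integrable_mult_right set_integral_diff exp_integral)
  have nz: "a - 2 * \<i> * u \<noteq> 0" "a + 2 * \<i> * u \<noteq> 0"
    using re by (metis less_irrefl zero_complex.sel(1))+
  have "(LINT y:{0<..}|lborel. sin (2 * of_real y * u) * exp (- (a * of_real y)))
      = - \<i> / 2 * (1 / (a - 2 * \<i> * u) - 1 / (a + 2 * \<i> * u))"
    unfolding eq set_integral_mult_right
    by (subst set_integral_diff) (use re in \<open>auto simp: exp_integral\<close>)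
  also have "\<dots> = 2 * u / ((a - 2 * \<i> * u) * (a + 2 * \<i> * u))"
    using nz by (simp add: divide_simps)
  also have "(a - 2 * \<i> * u) * (a + 2 * \<i> * u) = a\<^sup>2 + 4 * u\<^sup>2"
    by (simp add: algebra_simps power2_eq_square)
  finally show "(LINT y:{0<..}|lborel. sin (2 * of_real y * u) * exp (- (a * of_real y))) = 2 * u / (a\<^sup>2 + 4 * u\<^sup>2)" .
qed

text \<open>A geometric sum in exp (-2 w y), since 1 / sinh v = 2 exp (-v) / (1 - exp (-2 v)). The
  remainder is kept as a multiple of the kernel, which can then dominate it.\<close>

lemma tanh_kernel_expansion:
  assumes "Re w > 0" "y > 0"
  shows "tanh_kernel w u y = (\<Sum>k<n. 4 * (sin (2 * of_real y * u) * exp (- (((2 * of_nat k + 1) * w) * of_real y))))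
           + exp (- (2 * w * of_real y)) ^ n * tanh_kernel w u y"
proof -
  define q where "q = exp (- (2 * w * of_real y))"
  define s where "s = exp (- (w * of_real y))"
  have "norm q < 1" using assms by (simp add: q_def)
  then have q1: "q \<noteq> 1" by auto
  have s0: "s \<noteq> 0" "q = s * s" by (auto simp: s_def q_def mult.assoc simp flip: exp_add)
  have sinh: "sinh (w * of_real y) = (1 - q) / (2 * s)"
    unfolding sinh_def s0(2) using s0(1) by (simp add: s_def exp_minus field_simps scaleR_conv_of_real)
  have t: "tanh_kernel w u y = 4 * sin (2 * of_real y * u) * s / (1 - q)"
    unfolding tanh_kernel_def sinh using q1 s0 by (simp add: field_simps)
  have "exp (- (((2 * of_nat k + 1) * w) * of_real y)) = s * q ^ k" for k
    unfolding s_def q_def exp_of_nat_mult[symmetric] exp_add[symmetric]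
    by (simp add: algebra_simps)
  note e = this
  have "(\<Sum>k<n. 4 * (sin (2 * of_real y * u) * exp (- (((2 * of_nat k + 1) * w) * of_real y))))
      = (\<Sum>k<n. 4 * sin (2 * of_real y * u) * s * q ^ k)"
    unfolding e by (simp add: mult.assoc)
  also have "\<dots> = 4 * sin (2 * of_real y * u) * s * (\<Sum>k<n. q ^ k)"
    by (simp only: sum_distrib_left)
  also have "(\<Sum>k<n. q ^ k) = (1 - q ^ n) / (1 - q)" using q1 by (simp add: sum_gp_strict)
  finally show ?thesis unfolding t q_def[symmetric] using q1
    by (simp add: divide_simps) (simp add: algebra_simps)
qed

text \<open>Only finite sums are integrated term by term. The remainder tends to 0 pointwise because
  exp (-2 w y) has modulus below 1, and the kernel itself is its majorant.\<close>

lemma tanh_integral_LIMSEQ: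
  assumes w: "Re w > 0" and u: "\<bar>Im u\<bar> < Re w / 2"
  shows "(\<lambda>n. \<Sum>k<n. 8 * u / (((2 * of_nat k + 1) * w)\<^sup>2 + 4 * u\<^sup>2)) \<longlonglongrightarrow> (LINT y:{0<..}|lborel. tanh_kernel w u y)"
proof -
  let ?T = "LINT y:{0<..}|lborel. tanh_kernel w u y"
  let ?r = "\<lambda>n y. exp (- (2 * w * of_real y)) ^ n * tanh_kernel w u y"
  let ?e = "\<lambda>k y. 4 * (sin (2 * of_real y * u) * exp (- (((2 * of_nat k + 1) * w) * of_real y)))"
  note intT = set_integrable_tanh_kernel[OF w u]
  have re: "2 * \<bar>Im u\<bar> < Re ((2 * of_nat k + 1) * w)" for k
  proof -
    have "0 \<le> Re w * (real k * 2)" using w by simp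
    moreover have "2 * \<bar>Im u\<bar> < Re w" using u by simp
    ultimately have "2 * \<bar>Im u\<bar> < Re w + Re w * (real k * 2)" by linarith
    then show ?thesis by (simp add: algebra_simps)
  qed
  have int_e: "set_integrable lborel {0<..} (?e k)" for k
    by (intro set_integrable_mult_right sin_exp_integral(1) re)
  have int_sum: "set_integrable lborel {0<..} (\<lambda>y. \<Sum>k<n. ?e k y)" for n
    using int_e unfolding set_integrable_def scaleR_sum_right by (intro Bochner_Integration.integrable_sum) auto
  have sum_eq: "(LINT y:{0<..}|lborel. (\<Sum>k<n. ?e k y)) = (\<Sum>k<n. 8 * u / (((2 * of_nat k + 1) * w)\<^sup>2 + 4 * u\<^sup>2))" for n
  proof -
    have "(LINT y:{0<..}|lborel. (\<Sum>k<n. ?e k y)) = (\<Sum>k<n. LINT y:{0<..}|lborel. ?e k y)"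
      using int_e unfolding set_integrable_def set_lebesgue_integral_def scaleR_sum_right
      by (intro Bochner_Integration.integral_sum) auto
    also have "\<dots> = (\<Sum>k<n. 4 * (2 * u / (((2 * of_nat k + 1) * w)\<^sup>2 + 4 * u\<^sup>2)))"
      unfolding set_integral_mult_right by (intro sum.cong refl arg_cong2[where f = "(*)"] sin_exp_integral(2) re)
    finally show ?thesis by simp
  qed
  have rem: "?T - (\<Sum>k<n. 8 * u / (((2 * of_nat k + 1) * w)\<^sup>2 + 4 * u\<^sup>2)) = (LINT y:{0<..}|lborel. ?r n y)" for n
  proof -
    have "(LINT y:{0<..}|lborel. tanh_kernel w u y - (\<Sum>k<n. ?e k y)) = (LINT y:{0<..}|lborel. ?r n y)"
    proof (rule set_lebesgue_integral_cong)
      show "\<forall>y. y \<in> {0<..} \<longrightarrow> tanh_kernel w u y - (\<Sum>k<n. ?e k y) = ?r n y"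
        using tanh_kernel_expansion[OF w, of _ u n] by (auto simp: algebra_simps)
    qed simp
    then show ?thesis using intT int_sum[of n] sum_eq[of n] by (simp add: set_integral_diff(2))
  qed
  have "(\<lambda>n. LINT y:{0<..}|lborel. ?r n y) \<longlonglongrightarrow> (\<integral>y. 0 \<partial>(lborel::real measure))"
    unfolding set_lebesgue_integral_def
  proof (rule integral_dominated_convergence[where w = "\<lambda>y. norm (indicator {0<..} y *\<^sub>R tanh_kernel w u y)"])
    show "integrable lborel (\<lambda>y. norm (indicator {0<..} y *\<^sub>R tanh_kernel w u y))"
      using intT unfolding set_integrable_def by (rule integrable_norm)
    show "(\<lambda>y. indicator {0<..} y *\<^sub>R ?r n y) \<in> borel_measurable lborel" for n
    proof -
      have "continuous_on {0<..} (?r n)" by (intro continuous_intros continuous_on_tanh_kernel w)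
      from borel_measurable_continuous_on_indicator[OF _ this] show ?thesis by simp
    qed
    have q: "norm (exp (- (2 * w * complex_of_real y))) < 1" if "y > 0" for y using w that by simp
    show "AE y in lborel. (\<lambda>n. indicator {0<..} y *\<^sub>R ?r n y) \<longlonglongrightarrow> 0"
    proof (rule AE_I2)
      fix y :: real
      show "(\<lambda>n. indicator {0<..} y *\<^sub>R ?r n y) \<longlonglongrightarrow> 0"
      proof (cases "y > 0")
        case True
        from tendsto_mult_left_zero[OF LIMSEQ_power_zero[OF q[OF True]]] show ?thesis using True by simp
      qed simp
    qed
    show "AE y in lborel. norm (indicator {0<..} y *\<^sub>R ?r n y) \<le> norm (indicator {0<..} y *\<^sub>R tanh_kernel w u y)" for n
    proof (rule AE_I2)
      fix y :: real
      have "norm (exp (- (2 * w * complex_of_real y)) ^ n) \<le> 1" if "y > 0"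
        using q[OF that] unfolding norm_power by (intro power_le_one) auto
      then show "norm (indicator {0<..} y *\<^sub>R ?r n y) \<le> norm (indicator {0<..} y *\<^sub>R tanh_kernel w u y)"
        using mult_right_mono[of _ 1 "norm (tanh_kernel w u y)"]
        by (cases "y > 0") (auto simp: norm_mult simp del: norm_exp_eq_Re)
    qed
  qed simp
  then have "(\<lambda>n. ?T - (\<Sum>k<n. 8 * u / (((2 * of_nat k + 1) * w)\<^sup>2 + 4 * u\<^sup>2))) \<longlonglongrightarrow> 0"
    unfolding rem by simp
  from tendsto_diff[OF tendsto_const[of ?T] this] show ?thesis by simp
qed

text \<open>The logarithmic derivative of the reflection formula, in the variables 1/2 + z and 1/2 -
  z, expresses \<pi> tan (\<pi> z) as a difference of two \<open>Digamma\<close> values. In the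
  limit formula for \<open>Digamma\<close> the logarithms cancel and the terms pair up.\<close>

lemma tan_partial_fractions_LIMSEQ:
  fixes z :: complex
  assumes "cos (pi * z) \<noteq> 0"
  shows "(\<lambda>n. \<Sum>k<n. 8 * z / ((2 * of_nat k + 1)\<^sup>2 - 4 * z\<^sup>2)) \<longlonglongrightarrow> pi * sin (pi * z) / cos (pi * z)"
proof -
  have refl: "rGamma (1/2 + z) * rGamma (1/2 - z) = cos (of_real pi * z) / of_real pi" for z :: complex
    using rGamma_reflection_complex[of "1/2 + z"]
    by (simp add: algebra_simps sin_add)
  have nz: "rGamma (1/2 + z) \<noteq> 0" "rGamma (1/2 - z) \<noteq> 0"
    using refl[of z] assms by auto
  then have ni: "1/2 + z \<notin> \<int>\<^sub>\<le>\<^sub>0" "1/2 - z \<notin> \<int>\<^sub>\<le>\<^sub>0" by (auto simp: rGamma_eq_zero_iff)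
  then have n0: "1/2 + z \<noteq> 0" "1/2 - z \<noteq> 0" by (metis zero_in_nonpos_Ints)+
  have "((\<lambda>z. rGamma (1/2 + z) * rGamma (1/2 - z)) has_field_derivative
      - (rGamma (1/2 + z) * rGamma (1/2 - z)) * (Digamma (1/2 + z) - Digamma (1/2 - z))) (at z)"
    using ni by (auto intro!: derivative_eq_intros simp: algebra_simps)
  moreover have "((\<lambda>z. cos (of_real pi * z) / of_real pi) has_field_derivative - sin (of_real pi * z)) (at z)"
    by (auto intro!: derivative_eq_intros)
  ultimately have "- (cos (of_real pi * z) / of_real pi) * (Digamma (1/2 + z) - Digamma (1/2 - z)) = - sin (of_real pi * z)"
    unfolding refl using DERIV_unique by blast
  then have dig: "Digamma (1/2 + z) - Digamma (1/2 - z) = pi * sin (pi * z) / cos (pi * z)"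
    using assms by (simp add: field_simps)
  have "(\<lambda>m. (of_real (ln (real m)) - (\<Sum>n<m. inverse (1/2 + z + of_nat n)))
      - (of_real (ln (real m)) - (\<Sum>n<m. inverse (1/2 - z + of_nat n))))
      \<longlonglongrightarrow> Digamma (1/2 + z) - Digamma (1/2 - z)"
    by (intro tendsto_diff Digamma_LIMSEQ n0)
  moreover have "(of_real (ln (real m)) - (\<Sum>n<m. inverse (1/2 + z + of_nat n)))
      - (of_real (ln (real m)) - (\<Sum>n<m. inverse (1/2 - z + of_nat n)))
      = (\<Sum>k<m. 8 * z / ((2 * of_nat k + 1)\<^sup>2 - 4 * z\<^sup>2))" for m
  proof -
    have "inverse (1/2 - z + of_nat k) - inverse (1/2 + z + of_nat k)
        = 8 * z / ((2 * of_nat k + 1)\<^sup>2 - 4 * z\<^sup>2)" for k :: nat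
    proof -
      have a: "1/2 + z + of_nat k \<noteq> 0" "1/2 - z + of_nat k \<noteq> 0"
        using ni by (metis add_eq_0_iff2 minus_of_nat_in_nonpos_Ints)+
      have "(2 * of_nat k + 1)\<^sup>2 - 4 * z\<^sup>2 = 4 * ((1/2 + z + of_nat k) * (1/2 - z + of_nat k))"
        by (simp add: algebra_simps power2_eq_square)
      moreover have "inverse (1/2 - z + of_nat k) - inverse (1/2 + z + of_nat k)
          = (2 * z) / ((1/2 + z + of_nat k) * (1/2 - z + of_nat k))"
        using a by (simp add: inverse_eq_divide diff_frac_eq)
      ultimately show ?thesis by simp
    qed
    then show ?thesis by (simp flip: sum_subtractf)
  qed
  ultimately show ?thesis unfolding dig by simp
qed

text \<open>The zeros are the points -i (n + 1/2) w with integer n, and their imaginary parts have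
  modulus at least Re w / 2.\<close>

lemma cosh_strip_nonzero:
  assumes w: "Re w > 0" and u: "\<bar>Im u\<bar> < Re w / 2"
  shows "cosh (of_real pi * u / w) \<noteq> 0"
proof
  assume "cosh (of_real pi * u / w) = 0"
  then have "cos (\<i> * (of_real pi * u / w)) = 0" by (simp add: cosh_conv_cos)
  then obtain n :: int where "\<i> * (of_real pi * u / w) = of_real (of_int n * pi) + of_real pi / 2"
    using cos_eq_0 by blast
  then have "\<i> * (of_real pi * u / w) = of_real pi * (of_int n + 1 / 2)"
    by (simp add: algebra_simps)
  then have "of_real pi * (\<i> * u / w) = of_real pi * (of_int n + 1 / 2)" by (simp add: mult_ac)
  then have "\<i> * u / w = of_int n + 1 / 2" by (simp only: mult_cancel_left) simp
  moreover have "w \<noteq> 0" using w by auto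
  ultimately have "\<i> * u = (of_int n + 1 / 2) * w" by (metis nonzero_divide_eq_eq)
  then have "Re (\<i> * u) = Re ((of_int n + 1 / 2) * w)" by (rule arg_cong)
  then have "Im u = - (real_of_int n + 1 / 2) * Re w" by (simp add: algebra_simps)
  then have "\<bar>Im u\<bar> = \<bar>real_of_int n + 1 / 2\<bar> * Re w" using w by (simp add: abs_mult)
  moreover have "\<bar>real_of_int n + 1 / 2\<bar> \<ge> 1 / 2" by (cases "n \<ge> 0") auto
  then have "\<bar>real_of_int n + 1 / 2\<bar> * Re w \<ge> 1 / 2 * Re w" using w by (intro mult_right_mono) auto
  ultimately show False using u by simp
qed

text \<open>The substitution z = i u / w turns the tangent into a hyperbolic tangent and (2 k + 1)^2
  - 4 z^2 into ((2 k + 1)^2 w^2 + 4 u^2) / w^2; the factor 1 / (i w) adjusts the numerators.\<close>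

lemma tanh_integral:
  assumes w: "Re w > 0" and u: "\<bar>Im u\<bar> < Re w / 2"
  shows "(LINT y:{0<..}|lborel. tanh_kernel w u y)
    = of_real pi / w * (sinh (of_real pi * u / w) / cosh (of_real pi * u / w))"
proof -
  define z where "z = \<i> * u / w"
  have w0: "w \<noteq> 0" using w by auto
  have pz: "of_real pi * z = \<i> * (of_real pi * u / w)" by (simp add: z_def)
  have cz: "cos (of_real pi * z) = cosh (of_real pi * u / w)" and sz: "sin (of_real pi * z) = \<i> * sinh (of_real pi * u / w)"
    unfolding pz by (simp_all add: cosh_conv_cos sinh_conv_sin)
  have "(\<lambda>n. \<Sum>k<n. 8 * z / ((2 * of_nat k + 1)\<^sup>2 - 4 * z\<^sup>2)) \<longlonglongrightarrow> pi * sin (pi * z) / cos (pi * z)"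
    by (rule tan_partial_fractions_LIMSEQ) (use cosh_strip_nonzero[OF assms] in \<open>simp add: cz\<close>)
  from tendsto_mult_left[OF this, of "1 / (\<i> * w)"]
  have "(\<lambda>n. 1 / (\<i> * w) * (\<Sum>k<n. 8 * z / ((2 * of_nat k + 1)\<^sup>2 - 4 * z\<^sup>2)))
      \<longlonglongrightarrow> 1 / (\<i> * w) * (pi * sin (pi * z) / cos (pi * z))" .
  moreover have "1 / (\<i> * w) * (\<Sum>k<n. 8 * z / ((2 * of_nat k + 1)\<^sup>2 - 4 * z\<^sup>2))
      = (\<Sum>k<n. 8 * u / (((2 * of_nat k + 1) * w)\<^sup>2 + 4 * u\<^sup>2))" for n
  proof -
    have "1 / (\<i> * w) * (8 * z / ((2 * of_nat k + 1)\<^sup>2 - 4 * z\<^sup>2)) = 8 * u / (((2 * of_nat k + 1) * w)\<^sup>2 + 4 * u\<^sup>2)"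
      for k :: nat
    proof -
      have "w\<^sup>2 * z\<^sup>2 = - u\<^sup>2" using w0 by (simp add: z_def power_mult_distrib power_divide)
      then have "((2 * of_nat k + 1) * w)\<^sup>2 + 4 * u\<^sup>2 = (2 * of_nat k + 1)\<^sup>2 * w\<^sup>2 - 4 * (w\<^sup>2 * z\<^sup>2)"
        unfolding power_mult_distrib by simp
      also have "\<dots> = w\<^sup>2 * ((2 * of_nat k + 1)\<^sup>2 - 4 * z\<^sup>2)"
        unfolding right_diff_distrib by (simp only: mult_ac)
      finally have "((2 * of_nat k + 1) * w)\<^sup>2 + 4 * u\<^sup>2 = w\<^sup>2 * ((2 * of_nat k + 1)\<^sup>2 - 4 * z\<^sup>2)" .
      moreover have "8 * u = w\<^sup>2 * (8 * z / (\<i> * w))"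
        using w0 by (simp add: z_def power2_eq_square)
      ultimately show ?thesis using w0 by simp
    qed
    then show ?thesis by (simp add: sum_distrib_left)
  qed
  ultimately have "(\<lambda>n. \<Sum>k<n. 8 * u / (((2 * of_nat k + 1) * w)\<^sup>2 + 4 * u\<^sup>2))
      \<longlonglongrightarrow> 1 / (\<i> * w) * (pi * sin (pi * z) / cos (pi * z))" by simp
  from LIMSEQ_unique[OF tanh_integral_LIMSEQ[OF assms] this] show ?thesis
    by (simp add: cz sz)
qed

text \<open>The kernel at \<open>\<i> w / 4\<close> is a rescaling of the kernel at \<open>0\<close>; this fixes the constant of
  integration in \<open>exp_cosh_integral\<close>.\<close>

lemma cosh_integral_duplication:
  assumes w: "Re w > 0"
  shows "(LINT y:{0<..}|lborel. cosh_kernel w (\<i> * w / 4) y) = (LINT y:{0<..}|lborel. cosh_kernel w 0 y) / 2"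
proof -
  \<comment> \<open>At 2 y the cosine becomes cosh v, which cancels in sinh (2 v) = 2 sinh v cosh v.
    One factor 1/2 comes from the bracket and one from the division by 2 y; the substitution returns
    a factor 2, which leaves half of the integral.\<close>
  have k: "cosh_kernel w (\<i> * w / 4) (2 * y) = cosh_kernel w 0 y / 4" if "y > 0" for y
  proof -
    define v where "v = w * of_real y"
    have nz: "sinh v \<noteq> 0" "sinh (2 * v) \<noteq> 0" "v \<noteq> 0"
      using w that sinh_nonzero[of v] sinh_nonzero[of "2 * v"] by (auto simp: v_def)
    have s2: "sinh (2 * v) = 2 * sinh v * cosh v" using sinh_double by blast
    with nz have "cosh v \<noteq> 0" by auto
    have 1: "cos (2 * complex_of_real (2 * y) * (\<i> * w / 4)) = cosh v"
      by (simp add: v_def cosh_conv_cos algebra_simps)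
    have 2: "sinh (w * complex_of_real (2 * y)) = 2 * sinh v * cosh v"
      using s2 by (simp add: v_def algebra_simps)
    show ?thesis unfolding cosh_kernel_def 1 2 using nz \<open>cosh v \<noteq> 0\<close> that
      by (simp add: v_def field_simps)
  qed
  have "(LINT y:{0<..}|lborel. cosh_kernel w (\<i> * w / 4) y)
      = \<bar>2\<bar> *\<^sub>R (\<integral>y. indicator {0<..} (0 + 2 * y) *\<^sub>R cosh_kernel w (\<i> * w / 4) (0 + 2 * y) \<partial>lborel)"
    unfolding set_lebesgue_integral_def by (rule lborel_integral_real_affine) simp
  also have "(\<integral>y. indicator {0<..} (0 + 2 * y) *\<^sub>R cosh_kernel w (\<i> * w / 4) (0 + 2 * y) \<partial>lborel)
      = (\<integral>y. (indicator {0<..} y *\<^sub>R cosh_kernel w 0 y) / 4 \<partial>lborel)"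
    by (intro Bochner_Integration.integral_cong) (auto simp: k split: split_indicator)
  finally show ?thesis by (simp add: set_lebesgue_integral_def scaleR_conv_of_real)
qed

lemma exp_cosh_integral:
  assumes w: "Re w > 0" and u: "\<bar>Im u\<bar> < Re w / 2"
  shows "exp (- (LINT y:{0<..}|lborel. cosh_kernel w u y)) = 2 * cosh (of_real pi * u / w)"
proof -
  define L where "L u = (LINT y:{0<..}|lborel. cosh_kernel w u y)" for u
  define S where "S = {u. Im u < Re w / 2} \<inter> {u. Im u > - (Re w / 2)}"
  have S: "v \<in> S \<longleftrightarrow> \<bar>Im v\<bar> < Re w / 2" for v by (auto simp: S_def)
  have w0: "w \<noteq> 0" using w by auto
  have der: "((\<lambda>v. exp (- L v) / cosh (of_real pi * v / w)) has_field_derivative 0) (at v within S)" if "v \<in> S" for v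
  proof -
    have v: "\<bar>Im v\<bar> < Re w / 2" using that S by simp
    have nz: "cosh (of_real pi * v / w) \<noteq> 0" by (rule cosh_strip_nonzero[OF w v])
    have dL: "(L has_field_derivative - (of_real pi / w * (sinh (of_real pi * v / w) / cosh (of_real pi * v / w)))) (at v)"
      using cosh_integral_derivative[OF w v] unfolding tanh_integral[OF w v] L_def .
    have dc: "((\<lambda>v. cosh (of_real pi * v / w)) has_field_derivative sinh (of_real pi * v / w) * (of_real pi / w)) (at v)"
      by (auto intro!: derivative_eq_intros simp: w0)
    have de: "((\<lambda>v. exp (- L v)) has_field_derivative exp (- L v) * (of_real pi / w * (sinh (of_real pi * v / w) / cosh (of_real pi * v / w)))) (at v)"
      by (auto intro!: derivative_eq_intros dL)
    have "((\<lambda>v. exp (- L v) / cosh (of_real pi * v / w)) has_field_derivative 0) (at v)"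
      using DERIV_divide[OF de dc nz] nz by (simp add: field_simps)
    then show ?thesis by (rule has_field_derivative_at_within)
  qed
  have "convex S" unfolding S_def
    by (intro convex_Int convex_halfspace_Im_lt convex_halfspace_Im_gt)
  from has_field_derivative_zero_constant[OF this der]
  obtain c where c: "\<And>v. v \<in> S \<Longrightarrow> exp (- L v) / cosh (of_real pi * v / w) = c" by blast
  have c': "exp (- L v) = c * cosh (of_real pi * v / w)" if "v \<in> S" for v
    using c[OF that] cosh_strip_nonzero[OF w, of v] that S by (simp add: field_simps)
  have q: "\<i> * w / 4 \<in> S" "0 \<in> S" using w by (auto simp: S)
  have "cosh (of_real pi * (\<i> * w / 4) / w) = of_real (sqrt 2 / 2)"
  proof -
    have "cosh (of_real pi * (\<i> * w / 4) / w) = cos (of_real (pi / 4))"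
      using w0 by (simp add: cosh_conv_cos algebra_simps)
    also have "\<dots> = of_real (sqrt 2 / 2)" unfolding cos_of_real by (simp add: cos_45)
    finally show ?thesis .
  qed
  with c'[OF q(1)] have "exp (- L (\<i> * w / 4)) = c * of_real (sqrt 2 / 2)" by simp
  moreover have "exp (- L 0) = exp (- L (\<i> * w / 4)) ^ 2"
  proof -
    have "L (\<i> * w / 4) = L 0 / 2" unfolding L_def by (rule cosh_integral_duplication[OF w])
    then have "- L 0 = of_nat 2 * - L (\<i> * w / 4)" by (simp add: field_simps)
    then show ?thesis by (simp only: exp_of_nat_mult)
  qed
  moreover have "exp (- L 0) = c" using c'[OF q(2)] by simp
  \<comment> \<open>At i w / 4 the cosh equals cos (\<pi> / 4), so duplication reads c = c^2 / 2. As
    a value of exp, \<open>c\<close> is nonzero, which leaves c = 2; working with exponentials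
    avoids any choice of logarithm.\<close>
  ultimately have "c = (c * of_real (sqrt 2 / 2))\<^sup>2" by (simp only:)
  then have "c = c\<^sup>2 * (of_real (sqrt 2 / 2))\<^sup>2" unfolding power_mult_distrib .
  moreover have "(of_real (sqrt 2 / 2))\<^sup>2 = (1 / 2 :: complex)"
    by (simp add: power_divide flip: of_real_power)
  moreover have "c \<noteq> 0" using \<open>exp (- L 0) = c\<close> by auto
  ultimately have "c = 2" by (simp add: power2_eq_square)
  then show ?thesis using c'[of u] u S by (simp add: L_def)
qed

section \<open>The hyperbolic gamma function\<close>

lemma hyp_gamma_strip_altdef:
  "hyp_gamma_strip w1 w2 z = exp (\<i> * (LINT y:{0<..}|lborel. gamma_kernel w1 w2 z y))"
  by (simp add: hyp_gamma_strip_def gamma_kernel_def)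

text \<open>The bound on \<open>u\<close> puts both u + i a / 2 and u - i a / 2 inside the strip of
  half-width Re ((a + w) / 2), so the two integrals may be subtracted.\<close>

lemma hyp_gamma_strip_shift:
  assumes a: "Re a > 0" and w: "Re w > 0" and u: "\<bar>Im u\<bar> < Re w / 2"
  shows "hyp_gamma_strip a w (u + \<i> * a / 2)
    = 2 * cosh (of_real pi * u / w) * hyp_gamma_strip a w (u - \<i> * a / 2)"
proof -
  have int: "set_integrable lborel {0<..} (gamma_kernel a w (u + \<i> * a / 2))"
    "set_integrable lborel {0<..} (gamma_kernel a w (u - \<i> * a / 2))"
    using a w u abs_triangle_ineq[of "Im u" "Re a / 2"] abs_triangle_ineq4[of "Im u" "Re a / 2"]
    by (auto intro!: set_integrable_gamma_kernel simp del: abs_triangle_ineq)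
  have "(LINT y:{0<..}|lborel. gamma_kernel a w (u + \<i> * a / 2) y)
      - (LINT y:{0<..}|lborel. gamma_kernel a w (u - \<i> * a / 2) y)
      = (LINT y:{0<..}|lborel. \<i> * cosh_kernel w u y)"
    unfolding set_integral_diff(2)[OF int, symmetric]
    by (intro set_lebesgue_integral_cong) (auto simp: gamma_kernel_shift a w)
  then have "(LINT y:{0<..}|lborel. gamma_kernel a w (u + \<i> * a / 2) y)
      = (LINT y:{0<..}|lborel. gamma_kernel a w (u - \<i> * a / 2) y) + \<i> * (LINT y:{0<..}|lborel. cosh_kernel w u y)"
    unfolding set_integral_mult_right by (simp add: algebra_simps)
  then have "hyp_gamma_strip a w (u + \<i> * a / 2)
      = exp (\<i> * (LINT y:{0<..}|lborel. gamma_kernel a w (u - \<i> * a / 2) y) + - (LINT y:{0<..}|lborel. cosh_kernel w u y))"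
    unfolding hyp_gamma_strip_altdef by (simp add: ring_distribs)
  then show ?thesis
    unfolding exp_add exp_cosh_integral[OF w u] hyp_gamma_strip_altdef by (simp add: mult_ac)
qed

text \<open>Any number of steps that ends in the strip gives the same value as the minimal number in
  the definition: all points from the minimal step on lie in the strip, where
  \<open>hyp_gamma_strip_shift\<close> applies. A fixed \<open>n\<close> can therefore be used on a
  whole neighbourhood.\<close>

lemma hyp_gamma_nonneg:
  assumes a: "Re a > 0" and b: "Re b > 0" and z: "Im z \<ge> 0"
    and n: "\<bar>Im z - real n * Re a\<bar> < Re ((a + b) / 2)"
  shows "hyp_gamma a b z = (\<Prod>k<n. 2 * cosh (of_real pi * (z - \<i> * (of_nat k + 1/2) * a) / b))
           * hyp_gamma_strip a b (z - \<i> * of_nat n * a)"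
proof -
  define F where "F n = (\<Prod>k<n. 2 * cosh (of_real pi * (z - \<i> * (of_nat k + 1/2) * a) / b))
           * hyp_gamma_strip a b (z - \<i> * of_nat n * a)" for n
  define m where "m = (LEAST n. Im z - real n * Re a < Re ((a + b) / 2))"
  have m: "m \<le> n" "Im z - real m * Re a < Re ((a + b) / 2)"
  proof -
    let ?P = "\<lambda>n. Im z - real n * Re a < Re ((a + b) / 2)"
    have P: "?P n" using n by linarith
    show "m \<le> n" unfolding m_def by (rule Least_le[of ?P, OF P])
    show "?P m" unfolding m_def by (rule LeastI[of ?P, OF P])
  qed
  have F: "F j = F m" if "m \<le> j" "j \<le> n" for j
    using that
  proof (induction j rule: dec_induct)
    case (step j)
    define u where "u = z - \<i> * (of_nat j + 1/2) * a"
    have "real m * Re a \<le> real j * Re a" "real (j + 1) * Re a \<le> real n * Re a"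
      using step a by (auto intro!: mult_right_mono)
    moreover have "Im u = Im z - real j * Re a - Re a / 2" "real (j + 1) * Re a = real j * Re a + Re a"
      "Re ((a + b) / 2) = Re a / 2 + Re b / 2" by (auto simp: u_def algebra_simps add_divide_distrib)
    \<comment> \<open>\<open>u\<close> is the midpoint between steps j and j + 1. Step j is below
      the upper edge as m \<le> j, and step j + 1 is above the lower edge as j + 1 \<le> n; moving
      Re a / 2 inwards from either edge leaves half-width Re b / 2.\<close>
    ultimately have "\<bar>Im u\<bar> < Re b / 2" using m(2) n unfolding abs_less_iff by linarith
    from hyp_gamma_strip_shift[OF a b this]
    have "hyp_gamma_strip a b (z - \<i> * of_nat j * a)
        = 2 * cosh (of_real pi * u / b) * hyp_gamma_strip a b (z - \<i> * of_nat (Suc j) * a)"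
      by (simp add: u_def algebra_simps)
    then have "F j = F (Suc j)" by (simp add: F_def u_def)
    then show ?case using step by simp
  qed simp
  have "F n = F m" by (rule F) (use m in auto)
  then show ?thesis using z by (simp add: hyp_gamma_def F_def m_def Let_def)
qed

lemma hyp_gamma_neg:
  assumes a: "Re a > 0" and b: "Re b > 0" and z: "Im z < 0"
    and n: "\<bar>Im z + real n * Re a\<bar> < Re ((a + b) / 2)"
  shows "hyp_gamma a b z = hyp_gamma_strip a b (z + \<i> * of_nat n * a)
           / (\<Prod>k<n. 2 * cosh (of_real pi * (z + \<i> * (of_nat k + 1/2) * a) / b))"
proof -
  define F where "F n = hyp_gamma_strip a b (z + \<i> * of_nat n * a)
           / (\<Prod>k<n. 2 * cosh (of_real pi * (z + \<i> * (of_nat k + 1/2) * a) / b))" for n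
  define m where "m = (LEAST n. - Re ((a + b) / 2) < Im z + real n * Re a)"
  have m: "m \<le> n" "- Re ((a + b) / 2) < Im z + real m * Re a"
  proof -
    let ?P = "\<lambda>n. - Re ((a + b) / 2) < Im z + real n * Re a"
    have P: "?P n" using n by linarith
    show "m \<le> n" unfolding m_def by (rule Least_le[of ?P, OF P])
    show "?P m" unfolding m_def by (rule LeastI[of ?P, OF P])
  qed
  have F: "F j = F m" if "m \<le> j" "j \<le> n" for j
    using that
  proof (induction j rule: dec_induct)
    case (step j)
    define u where "u = z + \<i> * (of_nat j + 1/2) * a"
    have "real m * Re a \<le> real j * Re a" "real (j + 1) * Re a \<le> real n * Re a"
      using step a by (auto intro!: mult_right_mono)
    moreover have "Im u = Im z + real j * Re a + Re a / 2" "real (j + 1) * Re a = real j * Re a + Re a"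
      "Re ((a + b) / 2) = Re a / 2 + Re b / 2" by (auto simp: u_def algebra_simps add_divide_distrib)
    ultimately have u: "\<bar>Im u\<bar> < Re b / 2" using m(2) n unfolding abs_less_iff by linarith
    from hyp_gamma_strip_shift[OF a b u]
    have "hyp_gamma_strip a b (z + \<i> * of_nat (Suc j) * a)
        = 2 * cosh (of_real pi * u / b) * hyp_gamma_strip a b (z + \<i> * of_nat j * a)"
      by (simp add: u_def algebra_simps)
    \<comment> \<open>The factor that the extra step adds to the denominator cancels, since
      \<open>u\<close> lies in the zero-free strip of cosh.\<close>
    then have "F j = F (Suc j)"
      using cosh_strip_nonzero[OF b u] by (simp add: F_def u_def)
    then show ?case using step by simp
  qed simp
  have "F n = F m" by (rule F) (use m in auto)
  then show ?thesis using z by (simp add: hyp_gamma_def F_def m_def Let_def)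
qed

lemma holomorphic_on_sinh_UNIV: "(sinh :: complex \<Rightarrow> complex) holomorphic_on UNIV"
proof -
  have "(sinh :: complex \<Rightarrow> complex) = (\<lambda>z. (exp z - exp (- z)) / 2)"
    by (simp add: fun_eq_iff sinh_field_def)
  moreover have "(\<lambda>z::complex. (exp z - exp (- z)) / 2) holomorphic_on UNIV"
    by (intro holomorphic_intros) auto
  ultimately show ?thesis by simp
qed

lemma holomorphic_on_cosh_UNIV: "(cosh :: complex \<Rightarrow> complex) holomorphic_on UNIV"
proof -
  have "(cosh :: complex \<Rightarrow> complex) = (\<lambda>z. (exp z + exp (- z)) / 2)"
    by (simp add: fun_eq_iff cosh_field_def)
  moreover have "(\<lambda>z::complex. (exp z + exp (- z)) / 2) holomorphic_on UNIV"
    by (intro holomorphic_intros) auto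
  ultimately show ?thesis by simp
qed

section \<open>Holomorphic dependence of integrals on parameters\<close>

text \<open>On the complex line in direction \<open>v\<close> the disc of radius \<open>s\<close> =
  r / (2 |v|) around \<open>x\<close> stays in the larger ball, and Cauchy's inequality for the
  first derivative gives B / s.\<close>

lemma cauchy_estimate_mv:
  assumes hol: "f holomorphic_mv_on ball p (2 * r)" and r: "r > 0"
    and bd: "\<And>x. x \<in> ball p (2 * r) \<Longrightarrow> norm (f x) \<le> B"
    and x: "x \<in> ball p r" and d: "has_complex_derivative_at f f' x"
  shows "norm (f' v) \<le> 2 * B / r * norm v"
proof (cases "v = 0")
  case True
  have "f' (0 *s v) = 0 * f' v" using d unfolding has_complex_derivative_at_def by blast
  then show ?thesis using True by simp
next
  case False
  define s where "s = r / (2 * norm v)"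
  have s: "s > 0" using r False by (simp add: s_def)
  have inb: "x + t *s v \<in> ball p (2 * r)" if "norm t \<le> s" for t
  proof -
    have "norm (t *s v) \<le> s * norm v"
      unfolding norm_complex_vector_scalar_mult using that by (intro mult_right_mono) auto
    also have "\<dots> < r" using r False by (simp add: s_def)
    finally have "dist x (x + t *s v) < r" by (simp add: dist_norm)
    then show ?thesis using x dist_triangle[of p "x + t *s v" x] by simp
  qed
  let ?g = "\<lambda>t. f (x + t *s v)"
  have hg: "?g holomorphic_on cball 0 s"
    by (rule holomorphic_on_subset[OF holomorphic_on_along_line[OF hol]]) (use inb in auto)
  have "norm ((deriv ^^ 1) ?g 0) \<le> fact 1 * B / s ^ 1"
  proof (rule Cauchy_inequality)
    show "?g holomorphic_on ball 0 s" using hg by (rule holomorphic_on_subset) auto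
    show "continuous_on (cball 0 s) ?g" using hg by (rule holomorphic_on_imp_continuous_on)
    show "norm (?g t) \<le> B" if "norm (0 - t) = s" for t using that by (intro bd inb) simp
  qed (rule s)
  moreover have "deriv ?g 0 = f' v"
    using d by (intro DERIV_imp_deriv has_field_derivative_along_line) simp
  ultimately have "norm (f' v) \<le> B / s" by simp
  also have "\<dots> = 2 * B / r * norm v" using r False by (simp add: s_def field_simps)
  finally show ?thesis .
qed

text \<open>A locally valid integrable majorant of the values suffices: on half the ball
  \<open>cauchy_estimate_mv\<close> turns it into the Lipschitz majorant that
  \<open>has_derivative_integral\<close> asks for. Complex homogeneity then passes through the
  integral.\<close>

lemma holomorphic_mv_on_integral:
  fixes F :: "complex^'n \<Rightarrow> 'b \<Rightarrow> complex"
  assumes hol: "\<And>y. y \<in> space M \<Longrightarrow> (\<lambda>p. F p y) holomorphic_mv_on U"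
    and meas: "\<And>p. p \<in> U \<Longrightarrow> F p \<in> borel_measurable M"
    and bd: "\<And>p. p \<in> U \<Longrightarrow> \<exists>e>0. \<exists>B. ball p e \<subseteq> U \<and> integrable M B \<and>
               (\<forall>q\<in>ball p e. \<forall>y\<in>space M. norm (F q y) \<le> B y)"
  shows "(\<lambda>p. \<integral>y. F p y \<partial>M) holomorphic_mv_on U"
  unfolding holomorphic_mv_on_def
proof
  fix p assume "p \<in> U"
  then obtain e B where e: "e > 0" "ball p e \<subseteq> U" and B: "integrable M B"
    "\<And>q y. q \<in> ball p e \<Longrightarrow> y \<in> space M \<Longrightarrow> norm (F q y) \<le> B y"
    using bd by meson
  define r where "r = e / 2"
  have r: "r > 0" "2 * r = e" using e by (auto simp: r_def)
  have "\<exists>D. \<forall>x\<in>U. has_complex_derivative_at (\<lambda>p. F p y) (D x) x" if "y \<in> space M" for y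
    using hol[OF that] by (metis holomorphic_mv_onE)
  then obtain D where D: "\<And>y x. y \<in> space M \<Longrightarrow> x \<in> U \<Longrightarrow> has_complex_derivative_at (\<lambda>p. F p y) (D y x) x"
    by metis
  have "integrable M (F x)" if "x \<in> ball p r" for x
  proof (rule Bochner_Integration.integrable_bound[OF B(1)])
    have x: "x \<in> ball p e" using that e r by simp
    then show "F x \<in> borel_measurable M" using meas e(2) by blast
    show "AE y in M. norm (F x y) \<le> norm (B y)"
      using B(2)[OF x] by (intro AE_I2) (metis abs_ge_self order_trans real_norm_def)
  qed
  moreover have "((\<lambda>x. F x y) has_derivative D y p) (at p)" if "y \<in> space M" for y
    using D[OF that \<open>p \<in> U\<close>] by (simp add: has_complex_derivative_at_def)
  moreover have "norm (F x y - F p y) \<le> (2 / r * B y) * norm (x - p)"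
    if "x \<in> ball p r" and y: "y \<in> space M" for x y
  proof (rule differentiable_bound[OF convex_ball])
    show "((\<lambda>x. F x y) has_derivative D y z) (at z within ball p r)" if "z \<in> ball p r" for z
    proof -
      have "z \<in> U" using that e r by auto
      from D[OF y this] show ?thesis
        by (auto simp: has_complex_derivative_at_def intro: has_derivative_at_withinI)
    qed
    show "onorm (D y z) \<le> 2 / r * B y" if z: "z \<in> ball p r" for z
    proof (rule onorm_le)
      fix v
      have "(\<lambda>x. F x y) holomorphic_mv_on ball p (2 * r)"
        using hol[OF y] by (rule holomorphic_mv_on_subset) (use e r in simp)
      moreover have "z \<in> U" using z e r by auto
      ultimately have "norm (D y z v) \<le> 2 * B y / r * norm v"
        using cauchy_estimate_mv[of "\<lambda>x. F x y" p r "B y" z "D y z" v] B(2) y r z D[OF y] by simp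
      then show "norm (D y z v) \<le> 2 / r * B y * norm v" by simp
    qed
  qed (use that r in auto)
  moreover have "integrable M (\<lambda>y. 2 / r * B y)" using B(1) by simp
  ultimately have I: "\<And>v. integrable M (\<lambda>y. D y p v)"
      "((\<lambda>x. \<integral>y. F x y \<partial>M) has_derivative (\<lambda>v. \<integral>y. D y p v \<partial>M)) (at p)"
    using has_derivative_integral[of r p M F "\<lambda>y. D y p" "\<lambda>y. 2 / r * B y"] r by blast+
  have "(\<integral>y. D y p (c *s v) \<partial>M) = c * (\<integral>y. D y p v \<partial>M)" for c v
  proof -
    have "(\<integral>y. D y p (c *s v) \<partial>M) = (\<integral>y. c * D y p v \<partial>M)"
      using D[OF _ \<open>p \<in> U\<close>] by (intro Bochner_Integration.integral_cong) (auto simp: has_complex_derivative_at_def)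
    then show ?thesis by simp
  qed
  with I(2) show "\<exists>f'. ((\<lambda>p. \<integral>y. F p y \<partial>M) has_derivative f') (at p) \<and> (\<forall>c v. f' (c *s v) = c * f' v)"
    by blast
qed

lemma holomorphic_mv_on_strip:
  assumes hol: "a holomorphic_mv_on U" "b holomorphic_mv_on U" "c holomorphic_mv_on U" and U: "open U"
    and re: "\<And>p. p \<in> U \<Longrightarrow> Re (a p) > 0" "\<And>p. p \<in> U \<Longrightarrow> Re (b p) > 0"
      "\<And>p. p \<in> U \<Longrightarrow> \<bar>Im (c p)\<bar> < Re ((a p + b p) / 2)"
  shows "(\<lambda>p. hyp_gamma_strip (a p) (b p) (c p)) holomorphic_mv_on U"
proof -
  have "(\<lambda>p. \<integral>y. indicator {0<..} y *\<^sub>R gamma_kernel (a p) (b p) (c p) y \<partial>lborel) holomorphic_mv_on U"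
  proof (rule holomorphic_mv_on_integral)
    fix y :: real
    show "(\<lambda>p. indicator {0<..} y *\<^sub>R gamma_kernel (a p) (b p) (c p) y) holomorphic_mv_on U"
    proof (cases "y > 0")
      case True
      have sh: "(\<lambda>p. sinh (f p * of_real y)) holomorphic_mv_on U" if "f holomorphic_mv_on U" for f
        by (rule holomorphic_mv_on_entire[OF _ holomorphic_on_sinh_UNIV])
           (intro holomorphic_mv_on_mult holomorphic_mv_on_const that)
      have si: "(\<lambda>p. sin (2 * of_real y * c p)) holomorphic_mv_on U"
        by (rule holomorphic_mv_on_entire[of "\<lambda>p. 2 * of_real y * c p" _ sin])
           (intro holomorphic_mv_on_mult holomorphic_mv_on_const hol, intro holomorphic_intros)
      have nz: "sinh (a p * of_real y) \<noteq> 0" "sinh (b p * of_real y) \<noteq> 0" "a p \<noteq> 0" "b p \<noteq> 0" if "p \<in> U" for p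
        using re(1,2)[OF that] True by (auto intro!: sinh_nonzero)
      have "gamma_kernel (a p) (b p) (c p) y = (sin (2 * of_real y * c p) / (2 * sinh (a p * of_real y) * sinh (b p * of_real y))
          - c p / (a p * b p * of_real y)) / of_real y" for p
        by (simp add: gamma_kernel_def)
      then have "(\<lambda>p. gamma_kernel (a p) (b p) (c p) y) holomorphic_mv_on U"
        using True nz hol by (simp only:) (intro holomorphic_mv_intros sh si; simp)
      then show ?thesis using True by simp
    qed (auto intro: holomorphic_mv_on_const)
  next
    fix p assume "p \<in> U"
    have "continuous_on {0<..} (gamma_kernel (a p) (b p) (c p))"
      using re \<open>p \<in> U\<close> by (intro continuous_on_gamma_kernel)
    from borel_measurable_continuous_on_indicator[OF _ this]
    show "(\<lambda>y. indicator {0<..} y *\<^sub>R gamma_kernel (a p) (b p) (c p) y) \<in> borel_measurable lborel" by simp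
    \<comment> \<open>Halving \<open>\<alpha>\<close> and \<open>d\<close> and adding 1 to
      \<open>R\<close> makes the conditions of \<open>gamma_kernel_bound\<close> strict at
      \<open>p\<close>, so by continuity they persist on a ball, where one constant \<open>C\<close>
      serves.\<close>
    define \<alpha> where "\<alpha> = min (Re (a p)) (Re (b p)) / 2"
    define d where "d = (Re ((a p + b p) / 2) - \<bar>Im (c p)\<bar>) / 2"
    define R where "R = max (norm (a p)) (max (norm (b p)) (norm (c p))) + 1"
    have pos: "\<alpha> > 0" "d > 0" using re[OF \<open>p \<in> U\<close>] by (auto simp: \<alpha>_def d_def)
    have \<alpha>: "\<alpha> < Re (a p)" "\<alpha> < Re (b p)"
      using re(1,2)[OF \<open>p \<in> U\<close>] unfolding \<alpha>_def by linarith+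
    obtain C where C: "\<And>w1 w2 z y. \<alpha> \<le> Re w1 \<Longrightarrow> \<alpha> \<le> Re w2 \<Longrightarrow> norm w1 \<le> R \<Longrightarrow> norm w2 \<le> R \<Longrightarrow>
      norm z \<le> R \<Longrightarrow> \<bar>Im z\<bar> + d \<le> Re ((w1 + w2) / 2) \<Longrightarrow> y > 0 \<Longrightarrow>
      norm (gamma_kernel w1 w2 z y) \<le> C / (1 + y\<^sup>2)"
      using gamma_kernel_bound[OF pos, of R] by blast
    have cont: "isCont f p" if "f holomorphic_mv_on U" for f
      using holomorphic_mv_on_imp_continuous_on[OF that] U \<open>p \<in> U\<close> continuous_on_eq_continuous_at by blast
    note c = cont[OF hol(1)] cont[OF hol(2)] cont[OF hol(3)]
    have "\<forall>\<^sub>F q in nhds p. q \<in> U \<and> \<alpha> < Re (a q) \<and> \<alpha> < Re (b q) \<and> norm (a q) < R \<and> norm (b q) < R \<and>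
        norm (c q) < R \<and> \<bar>Im (c q)\<bar> + d < Re ((a q + b q) / 2)"
    proof (intro eventually_conj)
      show "\<forall>\<^sub>F q in nhds p. q \<in> U" using U \<open>p \<in> U\<close> by (rule eventually_nhds_in_open)
      have t: "(f \<longlongrightarrow> f p) (nhds p)" if "isCont f p" for f :: "_ \<Rightarrow> complex"
        using that by (simp add: isCont_def tendsto_at_iff_tendsto_nhds)
      note t = t[OF c(1)] t[OF c(2)] t[OF c(3)]
      show "\<forall>\<^sub>F q in nhds p. \<alpha> < Re (a q)"
        using order_tendstoD(1)[OF tendsto_Re[OF t(1)]] \<alpha> by blast
      show "\<forall>\<^sub>F q in nhds p. \<alpha> < Re (b q)"
        using order_tendstoD(1)[OF tendsto_Re[OF t(2)]] \<alpha> by blast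
      show "\<forall>\<^sub>F q in nhds p. norm (a q) < R"
        using order_tendstoD(2)[OF tendsto_norm[OF t(1)]] by (simp add: R_def)
      show "\<forall>\<^sub>F q in nhds p. norm (b q) < R"
        using order_tendstoD(2)[OF tendsto_norm[OF t(2)]] by (simp add: R_def)
      show "\<forall>\<^sub>F q in nhds p. norm (c q) < R"
        using order_tendstoD(2)[OF tendsto_norm[OF t(3)]] by (simp add: R_def)
      have lim_d: "((\<lambda>q. Re ((a q + b q) / 2) - (\<bar>Im (c q)\<bar> + d)) \<longlongrightarrow> Re ((a p + b p) / 2) - (\<bar>Im (c p)\<bar> + d)) (nhds p)"
        by (intro tendsto_intros t) auto
      have "x = y + 2 * ((x - y) / 2)" for x y :: real by (simp add: field_simps)
      then have "Re ((a p + b p) / 2) = \<bar>Im (c p)\<bar> + 2 * d" unfolding d_def .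
      then have "0 < Re ((a p + b p) / 2) - (\<bar>Im (c p)\<bar> + d)" using pos(2) by linarith
      from order_tendstoD(1)[OF lim_d this]
      show "\<forall>\<^sub>F q in nhds p. \<bar>Im (c q)\<bar> + d < Re ((a q + b q) / 2)"
        by (simp only: diff_gt_0_iff_gt)
    qed
    then obtain e where e: "e > 0" and near: "\<And>q. q \<in> ball p e \<Longrightarrow> q \<in> U \<and> \<alpha> < Re (a q) \<and> \<alpha> < Re (b q) \<and>
        norm (a q) < R \<and> norm (b q) < R \<and> norm (c q) < R \<and> \<bar>Im (c q)\<bar> + d < Re ((a q + b q) / 2)"
      unfolding eventually_nhds_metric by (metis dist_commute mem_ball)
    show "\<exists>e>0. \<exists>B. ball p e \<subseteq> U \<and> integrable lborel B \<and>
        (\<forall>q\<in>ball p e. \<forall>y\<in>space lborel. norm (indicator {0<..} y *\<^sub>R gamma_kernel (a q) (b q) (c q) y) \<le> B y)"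
    proof (intro exI conjI ballI)
      show "0 < e" by (rule e)
      show "ball p e \<subseteq> U" using near by blast
      show "integrable lborel (\<lambda>y. indicator {0<..} y *\<^sub>R (C / (1 + y\<^sup>2)))"
        using set_integrable_inverse_square[of C] by (simp add: set_integrable_def)
      fix q and y :: real assume "q \<in> ball p e"
      from near[OF this] C[of "a q" "b q" "c q" y]
      show "norm (indicator {0<..} y *\<^sub>R gamma_kernel (a q) (b q) (c q) y) \<le> indicator {0<..} y *\<^sub>R (C / (1 + y\<^sup>2))"
        by (auto simp: indicator_def)
    qed
  qed
  then have "(\<lambda>p. \<i> * (\<integral>y. indicator {0<..} y *\<^sub>R gamma_kernel (a p) (b p) (c p) y \<partial>lborel)) holomorphic_mv_on U"
    by (intro holomorphic_mv_on_mult holomorphic_mv_on_const)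
  from holomorphic_mv_on_entire[OF this, of exp] show ?thesis
    unfolding hyp_gamma_strip_altdef set_lebesgue_integral_def by (simp add: holomorphic_on_exp)
qed

lemma holomorphic_mv_prod_nonzero:
  assumes "finite I" "open V" "connected V" "V \<noteq> {}"
    "\<And>i. i \<in> I \<Longrightarrow> f i holomorphic_mv_on V" "\<And>i. i \<in> I \<Longrightarrow> \<exists>q\<in>V. f i q \<noteq> 0"
  shows "\<exists>q\<in>V. (\<Prod>i\<in>I. f i q) \<noteq> 0"
  using assms(1,5,6)
proof (induction I)
  case (insert i I)
  then obtain x y where "x \<in> V" "f i x \<noteq> 0" "y \<in> V" "(\<Prod>i\<in>I. f i y) \<noteq> 0" by blast
  with holomorphic_mv_mult_nonzero[of "f i" V "\<lambda>q. \<Prod>i\<in>I. f i q" x y] insert assms(2,3)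
  show ?case by (simp add: holomorphic_mv_on_prod)
qed (use assms(4) in auto)

text \<open>Near \<open>p\<close> a fixed number of steps represents the function: for Im (c p) > 0
  as an exponential times a product of cosh factors, for Im (c p) < 0 as an exponential divided by
  such a product. The exponential never vanishes, and no cosh factor is identically zero, because
  \<open>c\<close> moves along \<open>e\<close> while \<open>a\<close> and \<open>b\<close> stay
  fixed.\<close>

lemma hyp_gamma_nonzero_meromorphic:
  fixes e :: "complex^'n"
  assumes hol: "a holomorphic_mv_on U" "b holomorphic_mv_on U" "c holomorphic_mv_on U" and U: "open U"
    and re: "\<And>p. p \<in> U \<Longrightarrow> Re (a p) > 0" "\<And>p. p \<in> U \<Longrightarrow> Re (b p) > 0"
    and dir: "\<And>p t. a (p + t *s e) = a p" "\<And>p t. b (p + t *s e) = b p"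
      "\<And>p t. c (p + t *s e) = c p + t * \<kappa>" "\<kappa> \<noteq> 0"
  shows "nonzero_meromorphic_mv_on (\<lambda>p. hyp_gamma (a p) (b p) (c p)) U"
  unfolding nonzero_meromorphic_mv_on_def
proof
  fix p assume p: "p \<in> U"
  note re_p = re(1)[OF p] re(2)[OF p]
  have cosh_hol: "(\<lambda>p. 2 * cosh (of_real pi * (c p + m * a p) / b p)) holomorphic_mv_on V" if "V \<subseteq> U" for m V
  proof -
    have "(\<lambda>p. of_real pi * (c p + m * a p) / b p) holomorphic_mv_on V"
      using re(2) that hol[THEN holomorphic_mv_on_subset[OF _ that]]
      by (intro holomorphic_mv_intros) (auto, force)
    from holomorphic_mv_on_entire[OF this holomorphic_on_cosh_UNIV] show ?thesis
      by (intro holomorphic_mv_on_mult holomorphic_mv_on_const)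
  qed
  have cosh_nz: "\<exists>q\<in>V. 2 * cosh (of_real pi * (c q + m * a q) / b q) \<noteq> 0"
    if V: "open V" "p \<in> V" "V \<subseteq> U" for V m
  proof (rule ccontr)
    assume contra: "\<not> ?thesis"
    have "open {t. p + t *s e \<in> V}" "0 \<in> {t. p + t *s e \<in> V}"
      using V by (auto intro: open_complex_line_vimage)
    then obtain r where r: "r > 0" "ball 0 r \<subseteq> {t. p + t *s e \<in> V}" by (meson openE)
    \<comment> \<open>\<open>t\<close> is chosen such that t \<beta> is the positive real
      \<open>s\<close> and |t| = r / 2. Zeros of cosh at both A and A + s would force sinh A = 0,
      against cosh^2 - sinh^2 = 1.\<close>
    define \<beta> where "\<beta> = of_real pi * \<kappa> / b p"
    have \<beta>: "\<beta> \<noteq> 0" using dir(4) re_p by (auto simp: \<beta>_def)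
    define s where "s = r * norm \<beta> / 2"
    have s: "s > 0" using r \<beta> by (simp add: s_def)
    define t where "t = of_real s / \<beta>"
    have "norm t = r / 2" using \<beta> r by (simp add: t_def s_def norm_divide norm_mult)
    then have t: "t \<in> ball 0 r" using r by simp
    have zero: "cosh (of_real pi * (c p + t' * \<kappa> + m * a p) / b p) = 0" if "t' \<in> ball 0 r" for t'
    proof -
      have "p + t' *s e \<in> V" using r that by auto
      then have "cosh (of_real pi * (c (p + t' *s e) + m * a (p + t' *s e)) / b (p + t' *s e)) = 0"
        using contra by simp
      then show ?thesis by (simp only: dir)
    qed
    define A where "A = of_real pi * (c p + m * a p) / b p"
    have "cosh A = 0" using zero[of 0] r by (simp add: A_def)
    have "of_real pi * (c p + t * \<kappa> + m * a p) / b p = A + t * \<beta>"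
      by (simp add: A_def \<beta>_def add_divide_distrib algebra_simps)
    also have "t * \<beta> = of_real s" using \<beta> by (simp add: t_def)
    finally have "cosh (A + of_real s) = 0" using zero[OF t] by simp
    then have "sinh A * sinh (of_real s :: complex) = 0" using \<open>cosh A = 0\<close> by (simp add: cosh_add)
    moreover have "sinh (of_real s :: complex) \<noteq> 0" using s by (intro sinh_nonzero) simp
    ultimately have "sinh A = 0" by simp
    then show False using \<open>cosh A = 0\<close> hyperbolic_pythagoras[of A] by simp
  qed
  have cont: "isCont f p" if "f holomorphic_mv_on U" for f
    using holomorphic_mv_on_imp_continuous_on[OF that] U p continuous_on_eq_continuous_at by blast
  have lim: "(f \<longlongrightarrow> f p) (nhds p)" if "f holomorphic_mv_on U" for f
    using cont[OF that] by (simp add: isCont_def tendsto_at_iff_tendsto_nhds)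
  note lims = lim[OF hol(1)] lim[OF hol(2)] lim[OF hol(3)]
  have nearby: "\<exists>r>0. ball p r \<subseteq> U \<and> (\<forall>q\<in>ball p r. \<bar>Im (c q) - s * Re (a q)\<bar> < Re ((a q + b q) / 2))"
    if "\<bar>Im (c p) - s * Re (a p)\<bar> < Re ((a p + b p) / 2)" for s :: real
  proof -
    have "((\<lambda>q. Re ((a q + b q) / 2) - \<bar>Im (c q) - s * Re (a q)\<bar>) \<longlongrightarrow>
        Re ((a p + b p) / 2) - \<bar>Im (c p) - s * Re (a p)\<bar>) (nhds p)"
      by (intro tendsto_intros lims) auto
    from order_tendstoD(1)[OF this, of 0] that
    have "\<forall>\<^sub>F q in nhds p. \<bar>Im (c q) - s * Re (a q)\<bar> < Re ((a q + b q) / 2)" by simp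
    then have "\<forall>\<^sub>F q in nhds p. q \<in> U \<and> \<bar>Im (c q) - s * Re (a q)\<bar> < Re ((a q + b q) / 2)"
      using eventually_nhds_in_open[OF U p] by eventually_elim auto
    then obtain r where "r > 0" "\<And>q. dist q p < r \<Longrightarrow> q \<in> U \<and> \<bar>Im (c q) - s * Re (a q)\<bar> < Re ((a q + b q) / 2)"
      unfolding eventually_nhds_metric by blast
    then show ?thesis by (intro exI[of _ r]) (auto simp: dist_commute)
  qed
  have strip_hol: "(\<lambda>q. hyp_gamma_strip (a q) (b q) (c q - m * a q)) holomorphic_mv_on ball p r"
    if "ball p r \<subseteq> U" "\<And>q. q \<in> ball p r \<Longrightarrow> \<bar>Im (c q - m * a q)\<bar> < Re ((a q + b q) / 2)" for m r
  proof (rule holomorphic_mv_on_strip)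
    show "(\<lambda>q. c q - m * a q) holomorphic_mv_on ball p r"
      using hol[THEN holomorphic_mv_on_subset[OF _ that(1)]] by (intro holomorphic_mv_intros)
  qed (use that re hol[THEN holomorphic_mv_on_subset[OF _ that(1)]] in auto)
  have strip_nz: "hyp_gamma_strip x y z \<noteq> 0" for x y z by (simp add: hyp_gamma_strip_def)
  \<comment> \<open>Rounding x / Re (a p) gets within Re (a p) / 2 of x, which is less than the
    half-width of the strip because Re (b p) > 0.\<close>
  have bound0: "\<exists>n::nat. \<bar>x - real n * Re (a p)\<bar> < Re ((a p + b p) / 2)" if "x \<ge> 0" for x
  proof -
    define k where "k = round (x / Re (a p))"
    have "k \<ge> 0" using that re_p by (simp add: k_def round_def)
    have "\<bar>x / Re (a p) - of_int k\<bar> \<le> 1 / 2"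
      using of_int_round_abs_le[of "x / Re (a p)"] by (simp add: k_def abs_minus_commute)
    then have "\<bar>x / Re (a p) - of_int k\<bar> * Re (a p) \<le> 1 / 2 * Re (a p)"
      using re_p by (intro mult_right_mono) auto
    also have "\<bar>x / Re (a p) - of_int k\<bar> * Re (a p) = \<bar>(x / Re (a p) - of_int k) * Re (a p)\<bar>"
      using re_p by (simp add: abs_mult)
    also have "\<dots> = \<bar>x - of_int k * Re (a p)\<bar>" using re_p by (simp add: left_diff_distrib)
    finally have "\<bar>x - of_int k * Re (a p)\<bar> < Re ((a p + b p) / 2)"
      using re_p by simp
    then show ?thesis using \<open>k \<ge> 0\<close> by (intro exI[of _ "nat k"]) simp
  qed
  have ball_I: "\<exists>V g h. open V \<and> connected V \<and> p \<in> V \<and> V \<subseteq> U \<and>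
      quotient_rep_on V (\<lambda>p. hyp_gamma (a p) (b p) (c p)) g h \<and> (\<exists>q\<in>V. g q \<noteq> 0)"
    if "r > 0" "ball p r \<subseteq> U" "g holomorphic_mv_on ball p r" "h holomorphic_mv_on ball p r"
      "\<exists>q\<in>ball p r. g q \<noteq> 0" "\<exists>q\<in>ball p r. h q \<noteq> 0"
      "\<And>q. q \<in> ball p r \<Longrightarrow> hyp_gamma (a q) (b q) (c q) = g q / h q" for r g h
    unfolding quotient_rep_on_def
    by (rule exI[of _ "ball p r"], rule exI[of _ g], rule exI[of _ h]) (use that in auto)
  \<comment> \<open>\<open>hyp_gamma\<close> branches on the sign of the imaginary part; a ball on
    which the sign is constant lies in a single branch.\<close>
  have sgn: "\<exists>r>0. \<forall>q\<in>ball p r. Im (c q) * Im (c p) > 0" if "Im (c p) \<noteq> 0"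
  proof -
    have "((\<lambda>q. Im (c q) * Im (c p)) \<longlongrightarrow> Im (c p) * Im (c p)) (nhds p)"
      by (intro tendsto_intros lims)
    moreover have "0 < Im (c p) * Im (c p)" using that not_real_square_gt_zero by blast
    ultimately have "\<forall>\<^sub>F q in nhds p. Im (c q) * Im (c p) > 0" by (rule order_tendstoD(1))
    then show ?thesis unfolding eventually_nhds_metric by (auto simp: dist_commute)
  qed
  consider "Im (c p) = 0" | "Im (c p) > 0" | "Im (c p) < 0" by linarith
  then show "\<exists>V g h. open V \<and> connected V \<and> p \<in> V \<and> V \<subseteq> U \<and>
      quotient_rep_on V (\<lambda>p. hyp_gamma (a p) (b p) (c p)) g h \<and> (\<exists>q\<in>V. g q \<noteq> 0)"
  proof cases
    \<comment> \<open>Here every ball may meet both branches of the definition. With n = 0 both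
      reduce to the strip integral, so one formula holds across the real axis.\<close>
    case 1
    then obtain r where r: "r > 0" "ball p r \<subseteq> U"
      "\<And>q. q \<in> ball p r \<Longrightarrow> \<bar>Im (c q)\<bar> < Re ((a q + b q) / 2)"
      using nearby[of 0] re_p by auto
    show ?thesis
    proof (rule ball_I[OF r(1,2)])
      show "(\<lambda>q. hyp_gamma_strip (a q) (b q) (c q)) holomorphic_mv_on ball p r"
        using strip_hol[OF r(2), of 0] r(3) by simp
      show "(\<lambda>_. 1) holomorphic_mv_on ball p r" by (rule holomorphic_mv_on_const)
      show "hyp_gamma (a q) (b q) (c q) = hyp_gamma_strip (a q) (b q) (c q) / 1" if "q \<in> ball p r" for q
        using hyp_gamma_nonneg[of "a q" "b q" "c q" 0] hyp_gamma_neg[of "a q" "b q" "c q" 0]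
          r(3)[OF that] re r(2) that by (cases "Im (c q) \<ge> 0") (auto simp: subset_iff)
      show "\<exists>q\<in>ball p r. hyp_gamma_strip (a q) (b q) (c q) \<noteq> 0" "\<exists>q\<in>ball p r. (1::complex) \<noteq> 0"
        using r(1) strip_nz by (meson centre_in_ball, meson centre_in_ball one_neq_zero)
    qed
  next
    case 2
    then obtain n where "\<bar>Im (c p) - real n * Re (a p)\<bar> < Re ((a p + b p) / 2)"
      using bound0[of "Im (c p)"] by auto
    then obtain r1 where r1: "r1 > 0" "ball p r1 \<subseteq> U"
      "\<And>q. q \<in> ball p r1 \<Longrightarrow> \<bar>Im (c q) - real n * Re (a q)\<bar> < Re ((a q + b q) / 2)"
      using nearby[of "real n"] by blast
    obtain r2 where r2: "r2 > 0" "\<And>q. q \<in> ball p r2 \<Longrightarrow> Im (c q) * Im (c p) > 0" using sgn 2 by auto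
    define B where "B = ball p (min r1 r2)"
    have B: "open B" "connected B" "p \<in> B" "B \<subseteq> U" "B \<noteq> {}" using r1 r2 by (auto simp: B_def)
    define P where "P q = (\<Prod>k<n. 2 * cosh (of_real pi * (c q + (- \<i> * (of_nat k + 1/2)) * a q) / b q))" for q
    have "P holomorphic_mv_on B" unfolding P_def using B by (intro holomorphic_mv_on_prod cosh_hol)
    moreover have "\<exists>q\<in>B. P q \<noteq> 0"
      unfolding P_def using B by (intro holomorphic_mv_prod_nonzero cosh_hol cosh_nz) auto
    moreover have "(\<lambda>q. hyp_gamma_strip (a q) (b q) (c q - \<i> * of_nat n * a q)) holomorphic_mv_on B"
      unfolding B_def using r1 r2 by (intro strip_hol) (auto simp: mult.assoc)
    moreover have "hyp_gamma (a q) (b q) (c q) = P q * hyp_gamma_strip (a q) (b q) (c q - \<i> * of_nat n * a q) / 1"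
      if "q \<in> B" for q
    proof -
      have "Im (c q) \<ge> 0" using r2(2)[of q] 2 that by (simp add: B_def zero_less_mult_iff)
      then show ?thesis
        using hyp_gamma_nonneg[of "a q" "b q" "c q" n] re B(4) that r1(3)[of q]
        by (auto simp: P_def B_def)
    qed
    moreover have "\<exists>q\<in>B. (1::complex) \<noteq> 0" using B(3) by auto
    ultimately show ?thesis
      using B(4) r1(1) r2(1) strip_nz unfolding B_def
      by (intro ball_I[where r = "min r1 r2" and h = "\<lambda>_. 1"
            and g = "\<lambda>q. P q * hyp_gamma_strip (a q) (b q) (c q - \<i> * of_nat n * a q)"])
         (auto intro: holomorphic_mv_on_mult holomorphic_mv_on_const simp del: mem_ball)
  next
    \<comment> \<open>Stepping upwards is the shift by \<open>- real n\<close> in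
      \<open>nearby\<close>. The cosh product now stands in the denominator, so \<open>P\<close>
      takes the role of \<open>h\<close>.\<close>
    case 3
    then obtain n where "\<bar>- Im (c p) - real n * Re (a p)\<bar> < Re ((a p + b p) / 2)"
      using bound0[of "- Im (c p)"] by auto
    moreover have "\<bar>- x - m * A\<bar> = \<bar>x - (- m) * A\<bar>" for x m A :: real
      using abs_minus_cancel[of "x + m * A"] by simp
    ultimately have "\<bar>Im (c p) - (- real n) * Re (a p)\<bar> < Re ((a p + b p) / 2)" by (simp only:)
    then obtain r1 where r1: "r1 > 0" "ball p r1 \<subseteq> U"
      "\<And>q. q \<in> ball p r1 \<Longrightarrow> \<bar>Im (c q) - (- real n) * Re (a q)\<bar> < Re ((a q + b q) / 2)"
      using nearby[of "- real n"] by blast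
    obtain r2 where r2: "r2 > 0" "\<And>q. q \<in> ball p r2 \<Longrightarrow> Im (c q) * Im (c p) > 0" using sgn 3 by auto
    define B where "B = ball p (min r1 r2)"
    have B: "open B" "connected B" "p \<in> B" "B \<subseteq> U" "B \<noteq> {}" using r1 r2 by (auto simp: B_def)
    define P where "P q = (\<Prod>k<n. 2 * cosh (of_real pi * (c q + (\<i> * (of_nat k + 1/2)) * a q) / b q))" for q
    have "P holomorphic_mv_on B" unfolding P_def using B by (intro holomorphic_mv_on_prod cosh_hol)
    moreover have "\<exists>q\<in>B. P q \<noteq> 0"
      unfolding P_def using B by (intro holomorphic_mv_prod_nonzero cosh_hol cosh_nz) auto
    moreover have "(\<lambda>q. hyp_gamma_strip (a q) (b q) (c q - (- \<i> * of_nat n) * a q)) holomorphic_mv_on B"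
      unfolding B_def using r1 r2 by (intro strip_hol) (auto simp: mult.assoc)
    moreover have "hyp_gamma (a q) (b q) (c q) = hyp_gamma_strip (a q) (b q) (c q - (- \<i> * of_nat n) * a q) / P q"
      if "q \<in> B" for q
    proof -
      have "Im (c q) < 0" using r2(2)[of q] 3 that by (simp add: B_def zero_less_mult_iff)
      then show ?thesis
        using hyp_gamma_neg[of "a q" "b q" "c q" n] re B(4) that r1(3)[of q]
        by (auto simp: P_def B_def)
    qed
    ultimately show ?thesis
      using B(4) r1(1) r2(1) strip_nz unfolding B_def
      by (intro ball_I[where r = "min r1 r2" and h = P
            and g = "\<lambda>q. hyp_gamma_strip (a q) (b q) (c q - (- \<i> * of_nat n) * a q)"])
         (auto simp del: mem_ball)
  qed
qed

section \<open>The parameter symmetry\<close>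

fun swap_var :: "var \<Rightarrow> var" where
  "swap_var Rho = Upsilon"
| "swap_var Upsilon = Rho"
| "swap_var X = Lambda"
| "swap_var Lambda = X"
| "swap_var v = v"

abbreviation swap_params :: "complex^var \<Rightarrow> complex^var" where
  "swap_params p \<equiv> (\<chi> v. p $ swap_var v)"

lemma swap_var_swap_var [simp]: "swap_var (swap_var v) = v"
  by (cases v) auto

lemma dual_gamma_of: "dual (gamma_of p) = gamma_of (swap_params p)"
  by (simp add: gamma_of_def field_simps)

lemma dual_dual: "dual (dual \<gamma>) = \<gamma>"
  by (cases \<gamma>) (simp add: field_simps)

lemma psi_gamma_of: "psi (p $ W1) (p $ W2) (gamma_of p) (p $ X) (p $ Lambda) = psi_ext p"
proof -
  have "point (p $ W1) (p $ W2) (p $ Rho) (p $ Sigma) (p $ Tau) (p $ Upsilon) (p $ X) (p $ Lambda) = p"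
    by (auto simp: point_def vec_eq_iff split: var.split)
  then show ?thesis by (simp add: gamma_of_def)
qed

text \<open>Besides \<open>w1\<close> and \<open>w2\<close>, the arguments contain 2 \<sigma>,
  \<sigma> - \<rho> - \<tau> - \<upsilon> and \<sigma> - \<rho> + \<tau> - \<upsilon>, all symmetric
  in \<rho> and \<upsilon>.\<close>

lemma N_norm_swap: "N_norm w1 w2 (gamma_of (swap_params p)) = N_norm w1 w2 (gamma_of p)"
  by (simp add: gamma_of_def algebra_simps)

text \<open>For real x and \<lambda> the shift \<open>t\<close> is real, and the Lebesgue integral
  is invariant under it whether or not the integrand is integrable. The numerator factors keep their
  places, while the \<rho>- and \<upsilon>-factors of the denominator change theirs.\<close>

lemma psi_integral_swap:
  assumes "p $ X \<in> \<real>" "p $ Lambda \<in> \<real>"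
  shows "psi_integral (swap_params p) = psi_integral p"
proof -
  define t where "t = Re (p $ X - p $ Lambda) / 2"
  have t: "of_real t = (p $ X - p $ Lambda) / 2"
    using assms by (auto simp: t_def complex_is_Real_iff complex_eq_iff)
  have eqs: "of_real (t + 1 * z) + p $ Lambda + p $ X / 2 = of_real z + p $ X + p $ Lambda / 2"
    "of_real (t + 1 * z) - p $ X / 2 = of_real z - p $ Lambda / 2"
    "of_real (t + 1 * z) + p $ Lambda - p $ X / 2 = of_real z + p $ Lambda / 2"
    "of_real (t + 1 * z) + p $ X / 2 = of_real z + p $ X - p $ Lambda / 2" for z
    by (auto simp: t field_simps)
  show ?thesis
    unfolding psi_integral_def Let_def
    by (subst lborel_integral_real_affine[of 1 _ t], simp,
        simp only: vec_lambda_beta swap_var.simps eqs abs_one scaleR_one)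
       (intro Bochner_Integration.integral_cong refl, simp add: mult_ac)
qed

text \<open>With radius 1/8 one has Re w1 + Re w2 > 7/4 and 4 \<open>xi p\<close> < 1/2, hence
  \<open>zeta p\<close> > 0, while the imaginary parts of x and \<lambda> are 0.\<close>

lemma dom_integral_real:
  assumes "p $ W1 \<in> \<real>" "p $ W2 \<in> \<real>" "p $ X \<in> \<real>" "p $ Lambda \<in> \<real>"
    and "norm (p $ W1 - 1) < 1/8" "norm (p $ W2 - 1) < 1/8"
    and "norm (p $ Rho) < 1/8" "norm (p $ Sigma) < 1/8" "norm (p $ Tau) < 1/8" "norm (p $ Upsilon) < 1/8"
  shows "p \<in> dom_integral"
proof -
  have w: "\<bar>Re (p $ W1) - 1\<bar> < 1/8" "\<bar>Re (p $ W2) - 1\<bar> < 1/8"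
    using assms(5,6) abs_Re_le_cmod[of "p $ W1 - 1"] abs_Re_le_cmod[of "p $ W2 - 1"] by auto
  have "xi p < 1/8"
    unfolding xi_def using assms(7-)[THEN le_less_trans[OF abs_Re_le_cmod]]
    by (subst Max_less_iff) auto
  moreover have pos: "7/8 < Re (p $ W1)" "7/8 < Re (p $ W2)" using w by linarith+
  moreover have "4 * zeta p = Re (p $ W1) + Re (p $ W2) - 4 * xi p"
    using assms(4) by (simp add: zeta_def complex_is_Real_iff)
  ultimately have "zeta p > 0" by linarith
  moreover have "0 < Re (p $ W1)" "0 < Re (p $ W2)" using pos by linarith+
  ultimately show ?thesis using assms(1-4) by (simp add: dom_integral_def complex_is_Real_iff)
qed

section \<open>The domain and the symmetry of the extended integral\<close>

lemma open_dom_O: "open dom_O"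
proof -
  have "dom_O = (\<lambda>p. Re (p $ W1)) -` {0<..} \<inter> (\<lambda>p. Re (p $ W2)) -` {0<..}"
    by (auto simp: dom_O_def)
  moreover have "open \<dots>" by (intro open_Int open_vimage) (auto intro!: continuous_intros)
  ultimately show ?thesis by simp
qed

lemma connected_dom_O: "connected dom_O"
proof (rule convex_connected, rule convexI)
  fix p q :: "complex^var" and u v :: real
  assume "p \<in> dom_O" "q \<in> dom_O" and uv: "0 \<le> u" "0 \<le> v" "u + v = 1"
  then have pos: "Re (p $ W1) > 0" "Re (p $ W2) > 0" "Re (q $ W1) > 0" "Re (q $ W2) > 0"
    by (auto simp: dom_O_def)
  have "0 < u * a + v * b" if "0 < a" "0 < b" for a b :: real
    using uv that by (cases "u = 0") (auto intro: add_pos_nonneg)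
  then show "u *\<^sub>R p + v *\<^sub>R q \<in> dom_O" using pos by (simp add: dom_O_def)
qed

lemma swap_dom_O: "p \<in> dom_O \<Longrightarrow> swap_params p \<in> dom_O"
  by (simp add: dom_O_def)

text \<open>Both branches of the definition are covered: the choice yields an extension, which is
  meromorphic by \<open>is_psi_extension\<close>, and the default is the zero function.\<close>

lemma psi_ext_meromorphic: "psi_ext meromorphic_mv_on dom_O"
proof (cases "\<exists>F. is_psi_extension F")
  case True
  then have "is_psi_extension psi_ext" unfolding psi_ext_def using someI_ex[OF True] by simp
  then show ?thesis by (simp add: is_psi_extension_def)
next
  case False
  show ?thesis
    unfolding meromorphic_mv_on_iff quotient_rep_on_def
  proof
    fix p assume "p \<in> dom_O"
    show "\<exists>V g h. open V \<and> connected V \<and> p \<in> V \<and> V \<subseteq> dom_O \<and> g holomorphic_mv_on V \<and>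
       h holomorphic_mv_on V \<and> (\<exists>q\<in>V. h q \<noteq> 0) \<and> (\<forall>q\<in>V. h q \<noteq> 0 \<longrightarrow> psi_ext q = g q / h q)"
      by (rule exI[of _ dom_O], rule exI[of _ "\<lambda>_. 0"], rule exI[of _ "\<lambda>_. 1"])
         (use \<open>p \<in> dom_O\<close> False open_dom_O connected_dom_O holomorphic_mv_on_const
           in \<open>auto simp: psi_ext_def\<close>)
  qed
qed

lemma psi_ext_swap_meromorphic: "(\<lambda>p. psi_ext (swap_params p)) meromorphic_mv_on dom_O"
  by (rule meromorphic_mv_on_permute[OF psi_ext_meromorphic]) (auto simp: swap_dom_O)

lemma psi_ext_swap_near:
  assumes "p \<in> dom_O"
  shows "agree_near dom_O psi_ext (\<lambda>p. psi_ext (swap_params p)) p"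
proof -
  define p0 where "p0 = point 1 1 0 0 0 0 0 0"
  have p0: "p0 $ W1 = 1" "p0 $ W2 = 1" "p0 $ Rho = 0" "p0 $ Sigma = 0" "p0 $ Tau = 0"
    "p0 $ Upsilon = 0" "p0 $ X = 0" "p0 $ Lambda = 0" by (simp_all add: p0_def point_def)
  have "p0 \<in> dom_O" by (simp add: dom_O_def p0)
  have "agree_near dom_O psi_ext (\<lambda>p. psi_ext (swap_params p)) p0"
  proof (rule agree_near_real_points[where r = "1/8"])
    show "p0 $ v \<in> \<real>" for v by (cases v) (auto simp: p0)
    fix q assume real: "\<And>v. q $ v \<in> \<real>" and near: "\<And>v. norm (q $ v - p0 $ v) < 1 / 8"
    have q: "q \<in> dom_integral"
      by (rule dom_integral_real)
         (use real near[of W1] near[of W2] near[of Rho] near[of Sigma] near[of Tau] near[of Upsilon] in \<open>auto simp: p0\<close>)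
    \<comment> \<open>The base point is fixed by the swap, so the swapped point satisfies the same
      bounds.\<close>
    have sq: "swap_params q \<in> dom_integral"
      by (rule dom_integral_real)
         (use real near[of W1] near[of W2] near[of Rho] near[of Sigma] near[of Tau] near[of Upsilon] in \<open>auto simp: p0\<close>)
    show "psi_ext q = psi_ext (swap_params q)"
    proof (cases "\<exists>F. is_psi_extension F")
      case True
      then have "is_psi_extension psi_ext" unfolding psi_ext_def using someI_ex[OF True] by simp
      then show ?thesis
        using q sq psi_integral_swap[of q] real by (simp add: is_psi_extension_def)
    qed (simp add: psi_ext_def)
  qed (use \<open>p0 \<in> dom_O\<close> psi_ext_meromorphic psi_ext_swap_meromorphic in auto)
  then show ?thesis
    using agree_near_spread[OF psi_ext_meromorphic psi_ext_swap_meromorphic connected_dom_O open_dom_O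
        \<open>p0 \<in> dom_O\<close> assms] by blast
qed

section \<open>Meromorphy of the prefactor\<close>

lemma hyp_gamma_var_nonzero_meromorphic:
  assumes "c holomorphic_mv_on dom_O" "v \<noteq> W1" "v \<noteq> W2" "\<kappa> \<noteq> 0"
    "\<And>p t. c (p + t *s axis v 1) = c p + t * \<kappa>"
  shows "nonzero_meromorphic_mv_on (\<lambda>p. hyp_gamma (p $ W1) (p $ W2) (c p)) dom_O"
proof (rule hyp_gamma_nonzero_meromorphic[where e = "axis v 1" and \<kappa> = \<kappa>])
  show "open dom_O" by (rule open_dom_O)
qed (use assms in \<open>auto simp: dom_O_def axis_def intro: holomorphic_mv_on_nth\<close>)

text \<open>The direction is \<sigma>, the one parameter that occurs in all three sums: it has
  coefficient 2 in the first and 1 in the other two. \<open>m\<close> is the part contributed by the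
  second summand.\<close>

lemma N_norm_nonzero_meromorphic:
  "nonzero_meromorphic_mv_on (\<lambda>p. N_norm (p $ W1) (p $ W2) (gamma_of p)) dom_O"
proof -
  have "nonzero_meromorphic_mv_on (\<lambda>p. hyp_gamma (p $ W1) (p $ W2)
      (\<i> * (- p $ Rho + p $ Sigma) + \<i> * d p + \<i> * ((p $ W1 + p $ W2) / 2))) dom_O"
    if "d holomorphic_mv_on dom_O" "\<And>p t. d (p + t *s axis Sigma 1) = d p + t * m" "1 + m \<noteq> 0" for d m
  proof (rule hyp_gamma_var_nonzero_meromorphic[where v = Sigma and \<kappa> = "\<i> * (1 + m)"])
    show "\<i> * (1 + m) \<noteq> 0" using that(3) by simp
    show "(\<lambda>p. \<i> * (- p $ Rho + p $ Sigma) + \<i> * d p + \<i> * ((p $ W1 + p $ W2) / 2)) holomorphic_mv_on dom_O"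
      by (intro holomorphic_mv_intros that) auto
  qed (use that(2) in \<open>auto simp: axis_def algebra_simps\<close>)
  note * = this
  have "nonzero_meromorphic_mv_on (\<lambda>p. hyp_gamma (p $ W1) (p $ W2)
      (\<i> * (- p $ Rho + p $ Sigma) + \<i> * (p $ Rho + p $ Sigma) + \<i> * ((p $ W1 + p $ W2) / 2))) dom_O"
    by (rule *[where m = 1]) (auto simp: axis_def intro!: holomorphic_mv_intros)
  moreover have "nonzero_meromorphic_mv_on (\<lambda>p. hyp_gamma (p $ W1) (p $ W2)
      (\<i> * (- p $ Rho + p $ Sigma) + \<i> * (- p $ Tau - p $ Upsilon) + \<i> * ((p $ W1 + p $ W2) / 2))) dom_O"
    by (rule *[where m = 0]) (auto simp: axis_def intro!: holomorphic_mv_intros)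
  moreover have "nonzero_meromorphic_mv_on (\<lambda>p. hyp_gamma (p $ W1) (p $ W2)
      (\<i> * (- p $ Rho + p $ Sigma) + \<i> * (p $ Tau - p $ Upsilon) + \<i> * ((p $ W1 + p $ W2) / 2))) dom_O"
    by (rule *[where m = 0]) (auto simp: axis_def intro!: holomorphic_mv_intros)
  ultimately show ?thesis
    unfolding gamma_of_def N_norm.simps list.map prod_list.Cons prod_list.Nil mult_1_right
    by (intro nonzero_meromorphic_mult)
qed

text \<open>The parameters are kept abstract so that both the factor in x and the factor in
  \<lambda> with the dual parameters are instances. As they are constant in direction
  \<open>v\<close>, every argument has slope 1 there.\<close>

lemma Delta_nonzero_meromorphic:
  assumes "v \<noteq> W1" "v \<noteq> W2"
    and "g0 holomorphic_mv_on dom_O" "g1 holomorphic_mv_on dom_O"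
      "g2 holomorphic_mv_on dom_O" "g3 holomorphic_mv_on dom_O"
    and "\<And>p t. g0 (p + t *s axis v 1) = g0 p" "\<And>p t. g1 (p + t *s axis v 1) = g1 p"
      "\<And>p t. g2 (p + t *s axis v 1) = g2 p" "\<And>p t. g3 (p + t *s axis v 1) = g3 p"
  shows "nonzero_meromorphic_mv_on (\<lambda>p. Delta (p $ W1) (p $ W2) (g0 p, g1 p, g2 p, g3 p) (p $ v)) dom_O"
  unfolding Delta.simps
  by (intro nonzero_meromorphic_divide nonzero_meromorphic_mult
      hyp_gamma_var_nonzero_meromorphic[where v = v and \<kappa> = 1])
     (use assms in \<open>auto simp: axis_def intro!: holomorphic_mv_intros\<close>)

lemma csqrt_nonzero_meromorphic:
  "nonzero_meromorphic_mv_on (\<lambda>p. csqrt (p $ W1 * p $ W2)) dom_O"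
proof (rule nonvanishing_holomorphic_imp_nonzero_meromorphic)
  \<comment> \<open>If a b is real, then Im a Im b \<le> 0 and hence Re (a b) > 0, so the product
    avoids the branch cut of the principal root.\<close>
  have slit: "a * b \<notin> \<real>\<^sub>\<le>\<^sub>0" if "Re a > 0" "Re b > 0" for a b :: complex
  proof
    assume "a * b \<in> \<real>\<^sub>\<le>\<^sub>0"
    then have re: "Re a * Re b - Im a * Im b \<le> 0" and im: "Re a * Im b + Im a * Re b = 0"
      by (auto simp: complex_nonpos_Reals_iff)
    have "Im a * Im b * (Re a * Re b) = - (Im a * Re b)\<^sup>2"
    proof -
      have "Re a * Im b = - (Im a * Re b)" using im by simp
      then have "Im a * Re b * (Re a * Im b) = - (Im a * Re b)\<^sup>2" by (simp add: power2_eq_square)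
      then show ?thesis by (simp add: mult_ac)
    qed
    then have "Im a * Im b * (Re a * Re b) \<le> 0" by simp
    moreover have "Re a * Re b > 0" using that by simp
    ultimately have "Im a * Im b \<le> 0" by (meson mult_pos_pos not_le)
    moreover note \<open>Re a * Re b > 0\<close>
    ultimately show False using re by linarith
  qed
  show "(\<lambda>p. csqrt (p $ W1 * p $ W2)) holomorphic_mv_on dom_O"
  proof (rule holomorphic_mv_on_compose[where S = "- \<real>\<^sub>\<le>\<^sub>0" and g = csqrt])
    show "csqrt holomorphic_on - \<real>\<^sub>\<le>\<^sub>0" by (intro holomorphic_on_csqrt)
    show "open (- \<real>\<^sub>\<le>\<^sub>0 :: complex set)" by (simp add: open_Compl closed_nonpos_Reals_complex)
  qed (use slit in \<open>auto simp: dom_O_def intro!: holomorphic_mv_intros\<close>)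
  show "csqrt (p $ W1 * p $ W2) \<noteq> 0" if "p \<in> dom_O" for p
    using that by (auto simp: dom_O_def)
qed (rule open_dom_O)

theorem theorem6p5:
  "equal_as_meromorphic_on dom_O
     (\<lambda>p. S_fun (p $ W1) (p $ W2) (gamma_of p) (p $ X) (p $ Lambda))
     (\<lambda>p. S_fun (p $ W1) (p $ W2) (dual (gamma_of p)) (p $ Lambda) (p $ X))"
proof -
  \<comment> \<open>Everything except the integral. The swap exchanges the two \<open>Delta\<close>
    factors and fixes \<open>N_norm\<close>, so both sides carry literally the same total function
    \<open>K\<close>, also at points where a denominator is 0.\<close>
  define K where "K p = N_norm (p $ W1) (p $ W2) (gamma_of p)
      / (csqrt (p $ W1 * p $ W2) * (Delta (p $ W1) (p $ W2) (gamma_of p) (p $ X)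
           * Delta (p $ W1) (p $ W2) (gamma_of (swap_params p)) (p $ Lambda)))" for p
  have "nonzero_meromorphic_mv_on (\<lambda>p. Delta (p $ W1) (p $ W2) (gamma_of p) (p $ X)) dom_O"
    unfolding gamma_of_def
    by (rule Delta_nonzero_meromorphic) (auto simp: axis_def intro!: holomorphic_mv_intros)
  moreover have "nonzero_meromorphic_mv_on (\<lambda>p. Delta (p $ W1) (p $ W2) (gamma_of (swap_params p)) (p $ Lambda)) dom_O"
    unfolding gamma_of_def vec_lambda_beta swap_var.simps
    by (rule Delta_nonzero_meromorphic) (auto simp: axis_def intro!: holomorphic_mv_intros)
  ultimately have "nonzero_meromorphic_mv_on K dom_O"
    unfolding K_def
    by (intro nonzero_meromorphic_divide nonzero_meromorphic_mult N_norm_nonzero_meromorphic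
        csqrt_nonzero_meromorphic)
  then have K: "K meromorphic_mv_on dom_O" by (rule nonzero_meromorphic_imp_meromorphic)
  have f1: "S_fun (p $ W1) (p $ W2) (gamma_of p) (p $ X) (p $ Lambda) = K p * psi_ext p" for p
    unfolding S_fun_def psi_gamma_of dual_gamma_of K_def by (simp add: mult.assoc)
  have f2: "S_fun (p $ W1) (p $ W2) (dual (gamma_of p)) (p $ Lambda) (p $ X) = K p * psi_ext (swap_params p)" for p
  proof -
    have "psi (p $ W1) (p $ W2) (gamma_of (swap_params p)) (p $ Lambda) (p $ X) = psi_ext (swap_params p)"
      using psi_gamma_of[of "swap_params p"] by simp
    moreover have "dual (gamma_of (swap_params p)) = gamma_of p"
      unfolding dual_gamma_of[symmetric] by (rule dual_dual)
    ultimately show ?thesis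
      unfolding S_fun_def dual_gamma_of N_norm_swap K_def by (simp add: mult_ac)
  qed
  \<comment> \<open>Equality of the two values of \<open>psi_ext\<close> survives multiplication by
    \<open>K\<close>, so the same exceptional function \<open>h\<close> serves.\<close>
  have "agree_near dom_O (\<lambda>p. K p * psi_ext p) (\<lambda>p. K p * psi_ext (swap_params p)) p" if "p \<in> dom_O" for p
    using psi_ext_swap_near[OF that] unfolding agree_near_def by metis
  then show ?thesis
    unfolding f1 f2 equal_as_meromorphic_on_def agree_near_def
    using meromorphic_mv_on_mult[OF K psi_ext_meromorphic]
      meromorphic_mv_on_mult[OF K psi_ext_swap_meromorphic] by blast
qed

end
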